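(* Let $n\ge2$, let $L_\lambda$ be the irreducible representation of $\mathfrak o_{2n}(\mathbb C)=\mathfrak o(\tilde E)$ of highest weight $\lambda\in P_+$, and let $P[\Lambda E]$ be the set of weights of the spinor representation $\Lambda E$. Then, as $\mathfrak o(\tilde E)$-modules, $$L_\lambda\otimes\Lambda E\cong\bigoplus_{\mu\in P[\Lambda E]:\ \lambda+\mu\in P_+}L_{\lambda+\mu}.$$
   Context: $E$ is an $n$-dimensional complex vector space with basis $e_1,\dots,e_n$, $\tilde E=E\oplus E^*$ with symmetric form $(x+x^*,y+y^* )=\langle x,y^*\rangle+\langle x^*,y\rangle$. In the basis $(e_1,\dots,e_n,e_1^*,\dots,e_n^* )$ the Cartan subalgebra of $\mathfrak o(\tilde E)$ is spanned by $h_i=E_{ii}-E_{i+n,i+n}$; weights are $n$-tuples in the dual basis $h_i^*$, positive roots are $h_i^*\pm h_j^*$ for $i<j$, and $P_+$ is the set of dominant integral weights (entries all in $\mathbb Z$ or all in $\frac12+\mathbb Z$, $\lambda_1\ge\dots\ge\lambda_{n-1}\ge|\lambda_n|$). The spinor representation is $\Lambda E$, where, with $M_{e_i}$ = left exterior multiplication by $e_i$ and $D_{e_i^*}$ = contraction with $e_i^*$, $E_{ij}-E_{j+n,i+n}$ acts by $\frac12(M_{e_i}D_{e_j^*}-D_{e_j^*}M_{e_i})$, $E_{i+n,j}-E_{j+n,i}$ by $D_{e_i^*}D_{e_j^*}$, and $E_{i,j+n}-E_{j,i+n}$ by $M_{e_i}M_{e_j}$. Its set of weights is $P[\Lambda E]=\{(\pm\frac12,\dots,\pm\frac12)\}$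 (all $2^n$ sign choices, each of multiplicity one). *)

theory Defs
  imports Complex_Main "HOL-Library.Nat_Bijection"
    "Jordan_Normal_Form.Matrix" "Jordan_Normal_Form.VS_Connect"
begin

text \<open>
  Indices start at 0: the basis vectors \<open>e\<^sub>1, \<dots>, e\<^sub>n\<close> and \<open>e\<^sub>1\<^sup>*, \<dots>, e\<^sub>n\<^sup>*\<close> of
  \<open>E \<oplus> E\<^sup>*\<close> are the unit vectors with indices \<open>0, \<dots>, n - 1\<close> and \<open>n, \<dots>, 2 * n - 1\<close>
  of \<open>\<complex>\<^sup>2\<^sup>n\<close>.
\<close>

definition sym_form :: "nat \<Rightarrow> complex vec \<Rightarrow> complex vec \<Rightarrow> complex" where
  "sym_form n x y = (\<Sum>i<n. x $ i * y $ (i + n)) + (\<Sum>i<n. x $ (i + n) * y $ i)"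

definition orth :: "nat \<Rightarrow> complex mat set" where
  "orth n = {X \<in> carrier_mat (2 * n) (2 * n).
     \<forall>x \<in> carrier_vec (2 * n). \<forall>y \<in> carrier_vec (2 * n).
       sym_form n (X *\<^sub>v x) y + sym_form n x (X *\<^sub>v y) = 0}"

definition bracket :: "complex mat \<Rightarrow> complex mat \<Rightarrow> complex mat" where
  "bracket X Y = X * Y - Y * X"

definition elem_mat :: "nat \<Rightarrow> nat \<Rightarrow> nat \<Rightarrow> complex mat" where
  "elem_mat n i j = mat (2 * n) (2 * n) (\<lambda>p. if p = (i, j) then 1 else 0)"

definition cartan :: "nat \<Rightarrow> nat \<Rightarrow> complex mat" where
  "cartan n i = elem_mat n i i - elem_mat n (i + n) (i + n)"


text \<open>
  A finite-dimensional representation is given in coordinates, as a Lie algebra homomorphism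
  into the \<open>d \<times> d\<close> matrices acting on \<open>\<complex>\<^sup>d\<close>. Values of \<open>act\<close> outside
  \<open>orth n\<close> are irrelevant.
\<close>

record rep =
  rdim :: nat
  act :: "complex mat \<Rightarrow> complex mat"

definition is_rep :: "nat \<Rightarrow> rep \<Rightarrow> bool" where
  "is_rep n V \<longleftrightarrow>
     (\<forall>X \<in> orth n. act V X \<in> carrier_mat (rdim V) (rdim V)) \<and>
     (\<forall>X \<in> orth n. \<forall>Y \<in> orth n. act V (X + Y) = act V X + act V Y) \<and>
     (\<forall>c. \<forall>X \<in> orth n. act V (c \<cdot>\<^sub>m X) = c \<cdot>\<^sub>m act V X) \<and>
     (\<forall>X \<in> orth n. \<forall>Y \<in> orth n. act V (bracket X Y) = bracket (act V X) (act V Y))"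

definition invariant_subspace :: "nat \<Rightarrow> rep \<Rightarrow> complex vec set \<Rightarrow> bool" where
  "invariant_subspace n V W \<longleftrightarrow>
     VectorSpace.subspace class_ring W (module_vec TYPE(complex) (rdim V)) \<and>
     (\<forall>X \<in> orth n. \<forall>w \<in> W. act V X *\<^sub>v w \<in> W)"

definition irreducible_rep :: "nat \<Rightarrow> rep \<Rightarrow> bool" where
  "irreducible_rep n V \<longleftrightarrow> is_rep n V \<and> rdim V > 0 \<and>
     (\<forall>W. invariant_subspace n V W \<longrightarrow> W = {0\<^sub>v (rdim V)} \<or> W = carrier_vec (rdim V))"

definition rep_iso :: "nat \<Rightarrow> rep \<Rightarrow> rep \<Rightarrow> bool" where
  "rep_iso n V W \<longleftrightarrow> rdim V = rdim W \<and>
     (\<exists>P \<in> carrier_mat (rdim W) (rdim V). invertible_mat P \<and>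
        (\<forall>X \<in> orth n. P * act V X = act W X * P))"


text \<open>
  A weight is the vector in \<open>\<complex>\<^sup>n\<close> of its values on the basis \<open>cartan n 0, \<dots>, cartan n (n - 1)\<close>
  of the Cartan subalgebra.
\<close>

definition weight_space :: "nat \<Rightarrow> rep \<Rightarrow> complex vec \<Rightarrow> complex vec set" where
  "weight_space n V \<nu> =
     {v \<in> carrier_vec (rdim V). \<forall>i<n. act V (cartan n i) *\<^sub>v v = \<nu> $ i \<cdot>\<^sub>v v}"

definition weights :: "nat \<Rightarrow> rep \<Rightarrow> complex vec set" where
  "weights n V = {\<nu> \<in> carrier_vec n. \<exists>v \<in> weight_space n V \<nu>. v \<noteq> 0\<^sub>v (rdim V)}"

definition positive_roots :: "nat \<Rightarrow> complex vec set" where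
  "positive_roots n =
     {unit_vec n i + unit_vec n j | i j. i < j \<and> j < n} \<union>
     {unit_vec n i - unit_vec n j | i j. i < j \<and> j < n}"

definition root_space :: "nat \<Rightarrow> complex vec \<Rightarrow> complex mat set" where
  "root_space n \<alpha> = {X \<in> orth n. \<forall>i<n. bracket (cartan n i) X = \<alpha> $ i \<cdot>\<^sub>m X}"

text \<open>Membership in \<open>\<int>\<close> or \<open>1/2 + \<int>\<close> makes all entries real, so \<open>Re\<close> loses nothing.\<close>

definition dominant_weights :: "nat \<Rightarrow> complex vec set" where
  "dominant_weights n = {\<nu> \<in> carrier_vec n.
     ((\<forall>i<n. \<nu> $ i \<in> \<int>) \<or> (\<forall>i<n. \<nu> $ i - 1 / 2 \<in> \<int>)) \<and>
     (\<forall>i. i + 2 < n \<longrightarrow> Re (\<nu> $ (i + 1)) \<le> Re (\<nu> $ i)) \<and>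
     \<bar>Re (\<nu> $ (n - 1))\<bar> \<le> Re (\<nu> $ (n - 2))}"

definition irreducible_of_highest_weight :: "nat \<Rightarrow> complex vec \<Rightarrow> rep \<Rightarrow> bool" where
  "irreducible_of_highest_weight n \<nu> V \<longleftrightarrow> irreducible_rep n V \<and>
     (\<exists>v \<in> weight_space n V \<nu>. v \<noteq> 0\<^sub>v (rdim V) \<and>
        (\<forall>\<alpha> \<in> positive_roots n. \<forall>X \<in> root_space n \<alpha>. act V X *\<^sub>v v = 0\<^sub>v (rdim V)))"


definition kronecker :: "complex mat \<Rightarrow> complex mat \<Rightarrow> complex mat" where
  "kronecker A B = mat (dim_row A * dim_row B) (dim_col A * dim_col B)
     (\<lambda>(r, c). A $$ (r div dim_row B, c div dim_col B) * B $$ (r mod dim_row B, c mod dim_col B))"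

definition tensor_rep :: "rep \<Rightarrow> rep \<Rightarrow> rep" where
  "tensor_rep V W = \<lparr>rdim = rdim V * rdim W,
     act = (\<lambda>X. kronecker (act V X) (1\<^sub>m (rdim W)) + kronecker (1\<^sub>m (rdim V)) (act W X))\<rparr>"

definition direct_sum_rep :: "rep list \<Rightarrow> rep" where
  "direct_sum_rep Vs = \<lparr>rdim = sum_list (map rdim Vs),
     act = (\<lambda>X. diag_block_mat (map (\<lambda>V. act V X) Vs))\<rparr>"


text \<open>
  The basis vector of \<open>\<Lambda>E\<close> with index \<open>c < 2 ^ n\<close> is the wedge product, in increasing order,
  of the \<open>e\<^sub>j\<close> with \<open>j \<in> set_decode c\<close> (the positions of the binary digits 1 of \<open>c\<close>).
\<close>

definition wedge_sign :: "nat \<Rightarrow> nat set \<Rightarrow> complex" where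
  "wedge_sign i S = (- 1) ^ card {j \<in> S. j < i}"

definition ext_mult :: "nat \<Rightarrow> nat \<Rightarrow> complex mat" where
  "ext_mult n i = mat (2 ^ n) (2 ^ n) (\<lambda>(r, c).
     if i \<notin> set_decode c \<and> set_decode r = insert i (set_decode c)
     then wedge_sign i (set_decode c) else 0)"

definition contraction :: "nat \<Rightarrow> nat \<Rightarrow> complex mat" where
  "contraction n i = mat (2 ^ n) (2 ^ n) (\<lambda>(r, c).
     if i \<in> set_decode c \<and> set_decode r = set_decode c - {i}
     then wedge_sign i (set_decode c) else 0)"

text \<open>
  For \<open>X \<in> orth n\<close>,
  \<open>X = (\<Sum>i j. X\<^sub>i\<^sub>,\<^sub>j (E\<^sub>i\<^sub>,\<^sub>j - E\<^sub>j\<^sub>+\<^sub>n\<^sub>,\<^sub>i\<^sub>+\<^sub>n))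
     + (\<Sum>i<j. X\<^sub>i\<^sub>,\<^sub>j\<^sub>+\<^sub>n (E\<^sub>i\<^sub>,\<^sub>j\<^sub>+\<^sub>n - E\<^sub>j\<^sub>,\<^sub>i\<^sub>+\<^sub>n)) + (\<Sum>i<j. X\<^sub>i\<^sub>+\<^sub>n\<^sub>,\<^sub>j (E\<^sub>i\<^sub>+\<^sub>n\<^sub>,\<^sub>j - E\<^sub>j\<^sub>+\<^sub>n\<^sub>,\<^sub>i))\<close>;
  the spinor action extends the prescribed action of these basis elements linearly, entry by entry.
\<close>

definition spinor_act :: "nat \<Rightarrow> complex mat \<Rightarrow> complex mat" where
  "spinor_act n X = (let M = ext_mult n; D = contraction n in
     mat (2 ^ n) (2 ^ n) (\<lambda>p.
       (\<Sum>i<n. \<Sum>j<n. X $$ (i, j) * (1 / 2 * (M i * D j - D j * M i) $$ p)) +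
       (\<Sum>j<n. \<Sum>i<j. X $$ (i, j + n) * (M i * M j) $$ p) +
       (\<Sum>j<n. \<Sum>i<j. X $$ (i + n, j) * (D i * D j) $$ p)))"

definition spinor :: "nat \<Rightarrow> rep" where
  "spinor n = \<lparr>rdim = 2 ^ n, act = spinor_act n\<rparr>"

end

theory Submission
  imports Defs "HOL-Library.Function_Algebras" "HOL-Library.Product_Plus"
begin

text \<open>
  Let \<open>v\<close> be a highest weight vector of \<open>L\<^sub>\<lambda>\<close> and index the weights of the spinor module by the subsets
  \<open>J\<close> of \<open>{1..n}\<close>. The vectors \<open>v \<otimes> e\<^sub>J\<close> generate the tensor product. Modulo the submodule
  generated by the \<open>v \<otimes> e\<^sub>K\<close> with \<open>(\<lambda> + \<rho>, \<mu>\<^sub>K) > (\<lambda> + \<rho>, \<mu>\<^sub>J)\<close>, the vector \<open>v \<otimes> e\<^sub>J\<close> is singular of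
  weight \<open>\<lambda> + \<mu>\<^sub>J\<close>, and the Casimir operator has larger eigenvalues on that submodule. A polynomial in the
  Casimir operator therefore turns \<open>v \<otimes> e\<^sub>J\<close> into a (possibly zero) singular vector \<open>w\<^sub>J\<close>, and the \<open>w\<^sub>J\<close>
  still generate. A nonzero \<open>w\<^sub>J\<close> generates an irreducible submodule, and these submodules are
  independent, so it remains to see that \<open>w\<^sub>J\<close> is nonzero exactly if \<open>\<lambda> + \<mu>\<^sub>J\<close> is dominant.
  Finite dimension gives one direction. For the other, a singular vector of weight \<open>\<lambda> + \<mu>\<^sub>J\<close> is
  found by induction on \<open>n\<close>, restricting to \<open>o\<^sub>2\<^sub>n\<^sub>-\<^sub>2\<close> and using that the spinor module is self-dual
  to exchange the roles of \<open>\<lambda>\<close> and \<open>\<lambda> + \<mu>\<^sub>J\<close>.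
\<close>

section \<open>Representations of even orthogonal Lie algebras\<close>

text \<open>All weights \<mu>_J have the same norm, so on weight \<lambda> + \<mu>_J the Casimir
  eigenvalue is a constant plus 4 (\<lambda> + \<rho>, \<mu>_J). The same number is the degree of
  e_J for the Cartan element \<lambda> + \<rho>, and raising operators increase this degree by
  positive integers because \<lambda> + \<rho> is strictly dominant. This coincidence drives the
  proof: Casimir polynomials separate v \<otimes> e_J from the vectors above it, and a singular
  vector strictly below the generator of a submodule would have another Casimir eigenvalue, which
  makes the submodule irreducible. Complete reducibility is thus obtained, not presupposed. The
  obstacle is that w_J must be nonzero for dominant \<lambda> + \<mu>_J. Restriction to the smaller
  algebra reaches only those J that contain the largest index, since wedging with the top basis
  vector keeps a vector singular. In the other case a homomorphism from L_\<lambda> to L' \<otimes>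
  S, with L' of highest weight \<lambda> + \<mu>_J, is turned into one from L_\<lambda> \<otimes> S
  to L' by pairing the two spinor factors.\<close>

declare One_nat_def [simp del]

text \<open>As a type class the structure passes to functions and pairs:
  \<open>nat set \<Rightarrow> 'v\<close> carries the tensor product with the spinor module, and
  pairs carry the graph of a homomorphism.\<close>

class complex_space = ab_group_add +
  fixes cscale :: "complex \<Rightarrow> 'a \<Rightarrow> 'a" (infixr "*c" 75)
  assumes cscale_right_distrib: "a *c (x + y) = a *c x + a *c y"
    and cscale_left_distrib: "(a + b) *c x = a *c x + b *c x"
    and cscale_cscale [simp]: "a *c (b *c x) = (a * b) *c x"
    and cscale_one [simp]: "1 *c x = x"

interpretation cv: vector_space cscale
  by unfold_locales (simp_all add: cscale_right_distrib cscale_left_distrib)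

instantiation complex :: complex_space
begin
definition cscale_complex_def: "a *c (x::complex) = a * x"
instance by standard (simp_all add: cscale_complex_def algebra_simps)
end

instantiation "fun" :: (type, complex_space) complex_space
begin
definition cscale_fun_def: "a *c f = (\<lambda>x. a *c f x)"
instance by standard (simp_all add: cscale_fun_def fun_eq_iff cscale_right_distrib cscale_left_distrib)
end

instantiation prod :: (complex_space, complex_space) complex_space
begin
definition cscale_prod_def: "a *c u = (a *c fst u, a *c snd u)"
instance by standard (simp_all add: cscale_prod_def prod_eq_iff cscale_right_distrib cscale_left_distrib)
end

lemma cscale_apply [simp]: "(a *c f) x = a *c f x"
  by (simp add: cscale_fun_def)

lemma cscale_Pair [simp]: "a *c (u, v) = (a *c u, a *c v)"
  by (simp add: cscale_prod_def)

lemma cscale_two: "2 *c x = x + x"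
  by (metis cscale_left_distrib cscale_one one_add_one)

lemma sum_fun_apply: "sum f A x = (\<Sum>a\<in>A. f a x)"
  by (induction A rule: infinite_finite_induct) auto

definition clin :: "('v::complex_space \<Rightarrow> 'w::complex_space) \<Rightarrow> bool" where
  "clin f \<longleftrightarrow> (\<forall>x y. f (x + y) = f x + f y) \<and> (\<forall>c x. f (c *c x) = c *c f x)"

lemma
  assumes "clin f"
  shows clin_add: "f (x + y) = f x + f y" and clin_scale: "f (c *c x) = c *c f x"
    and clin_zero: "f 0 = 0" and clin_minus: "f (- x) = - f x"
    and clin_diff: "f (x - y) = f x - f y"
    and clin_sum: "f (sum g A) = (\<Sum>a\<in>A. f (g a))"
proof -
  have a: "f (x + y) = f x + f y" for x y using assms by (simp add: clin_def)
  have s: "f (c *c x) = c *c f x" for c x using assms by (simp add: clin_def)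
  have z: "f 0 = 0" using s[of 0 0] by simp
  have m: "f (- x) = - f x" for x using a[of x "- x"] z by (simp add: eq_neg_iff_add_eq_0 add.commute)
  show "f (x + y) = f x + f y" "f (c *c x) = c *c f x" "f 0 = 0" "f (- x) = - f x" by fact+
  show "f (x - y) = f x - f y" using a[of x "- y"] m by simp
  show "f (sum g A) = (\<Sum>a\<in>A. f (g a))"
    by (induction A rule: infinite_finite_induct) (simp_all add: a z)
qed

lemmas clin_simps = clin_add clin_scale clin_zero clin_minus clin_diff clin_sum

section \<open>Signed indices, submodules and singular vectors\<close>

definition index_set :: "nat \<Rightarrow> int set" where
  "index_set k = {p. p \<noteq> 0 \<and> \<bar>p\<bar> \<le> int k}"

lemma finite_index_set [simp]: "finite (index_set k)"
  by (rule finite_subset[of _ "{- int k..int k}"]) (auto simp: index_set_def)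

lemma uminus_in_index_set [simp]: "- p \<in> index_set k \<longleftrightarrow> p \<in> index_set k"
  by (simp add: index_set_def)

lemma index_set_mono: "k \<le> l \<Longrightarrow> index_set k \<subseteq> index_set l"
  by (auto simp: index_set_def)

lemma index_set_cases:
  assumes "p \<in> index_set k"
  obtains i where "i \<in> {1..k}" "p = - int i" | i where "i \<in> {1..k}" "p = int i"
proof (cases "p < 0")
  case True
  then show ?thesis using assms that(1)[of "nat (- p)"] by (auto simp: index_set_def)
next
  case False
  then show ?thesis using assms that(2)[of "nat p"] by (auto simp: index_set_def)
qed

lemma int_in_index_set [simp]: "i \<in> {1..k} \<Longrightarrow> int i \<in> index_set k"
  by (auto simp: index_set_def)

definition delta :: "int \<Rightarrow> int \<Rightarrow> complex" where
  "delta p q = (if p = q then 1 else 0)"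

text \<open>The eigenvalue of \<open>F p p\<close> on a vector of weight \<open>\<kappa>\<close>:
  index \<open>- i\<close> stands for a basis vector of \<open>E\<close> and counts positively,
  \<open>i\<close> for its dual and counts negatively. So
  \<open>odd_ext \<kappa> p - odd_ext \<kappa> q\<close> is the pairing of \<open>\<kappa>\<close>
  with the root of \<open>F p q\<close>.\<close>

definition odd_ext :: "(nat \<Rightarrow> real) \<Rightarrow> int \<Rightarrow> real" where
  "odd_ext \<kappa> p = (if p < 0 then \<kappa> (nat (- p)) else - \<kappa> (nat p))"

lemma odd_ext_neg [simp]: "0 < i \<Longrightarrow> odd_ext \<kappa> (- int i) = \<kappa> i"
  by (auto simp: odd_ext_def)

lemma odd_ext_pos [simp]: "odd_ext \<kappa> (int i) = - \<kappa> i"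
  by (auto simp: odd_ext_def)

lemma odd_ext_uminus: "p \<in> index_set k \<Longrightarrow> odd_ext \<kappa> (- p) = - odd_ext \<kappa> p"
  by (auto simp: odd_ext_def index_set_def)

text \<open>Applying \<open>H - a b\<close> removes the term with index \<open>b\<close> and
  multiplies each other term by a nonzero scalar, so induction applies. With \<open>W = {0}\<close>
  this is the independence of eigenvectors for distinct eigenvalues.\<close>

lemma eigen_sum_mem:
  fixes H :: "'v::complex_space \<Rightarrow> 'v"
  assumes "finite A" "clin H" "cv.subspace W" "\<And>u. u \<in> W \<Longrightarrow> H u \<in> W"
    and "inj_on a A" "\<And>m. m \<in> A \<Longrightarrow> H (f m) = a m *c f m" "(\<Sum>m\<in>A. f m) \<in> W" "m \<in> A"
  shows "f m \<in> W"
  using assms(1,5-)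
proof (induction A arbitrary: f m rule: finite_induct)
  case empty
  then show ?case by simp
next
  case (insert b A)
  have W: "u \<in> W \<Longrightarrow> c *c u \<in> W" "u \<in> W \<Longrightarrow> v \<in> W \<Longrightarrow> u - v \<in> W" for c u v
    using assms(3) by (auto simp: cv.subspace_scale cv.subspace_diff)
  let ?s = "\<Sum>m\<in>insert b A. f m"
  have "H ?s - a b *c ?s = (\<Sum>m\<in>insert b A. (a m - a b) *c f m)"
    using insert.prems(2) by (simp add: clin_sum[OF assms(2)] cv.scale_sum_right cv.scale_left_diff_distrib flip: sum_subtractf)
  also have "\<dots> = (\<Sum>m\<in>A. (a m - a b) *c f m)"
    using insert.hyps by simp
  finally have s: "(\<Sum>m\<in>A. (a m - a b) *c f m) \<in> W"
    using assms(4) insert.prems(3) W by metis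
  have fA: "f m \<in> W" if m: "m \<in> A" for m
  proof -
    have "(a m - a b) *c f m \<in> W"
    proof (rule insert.IH[where f = "\<lambda>m. (a m - a b) *c f m"])
      show "inj_on a A" using insert.prems(1) by simp
      show "H ((a m - a b) *c f m) = a m *c (a m - a b) *c f m" if "m \<in> A" for m
        using insert.prems(2)[of m] that by (simp add: clin_scale[OF assms(2)] mult.commute)
    qed (use s m in auto)
    moreover have "a m \<noteq> a b" using insert.prems(1) insert.hyps m by (auto simp: inj_on_def)
    ultimately show ?thesis using W(1)[of "(a m - a b) *c f m" "inverse (a m - a b)"] by simp
  qed
  have "(\<Sum>m\<in>A. f m) \<in> W" using fA assms(3) by (simp add: cv.subspace_sum)
  then have "f b \<in> W" using W(2)[OF insert.prems(3)] insert.hyps by fastforce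
  then show ?case using fA insert.prems(4) by auto
qed

text \<open>\<open>F p q\<close> with \<open>p, q\<close> in \<open>{-k, \<dots>, -1, 1, \<dots>, k}\<close> is the action of \<open>E\<^sub>p\<^sub>q - E\<^sub>-\<^sub>q\<^sub>,\<^sub>-\<^sub>p\<close>. The elements
  \<open>F (-i) (-i)\<close> span the Cartan subalgebra and those with \<open>p < q\<close> are raising operators, so the
  entries of a dominant weight increase with \<open>i\<close>: position \<open>i\<close> here is entry \<open>n - i\<close> of a weight
  vector. This order makes \<open>o\<^sub>2\<^sub>k\<close> the subalgebra with indices up to \<open>k\<close>.\<close>

locale so_rep =
  fixes k :: nat and F :: "int \<Rightarrow> int \<Rightarrow> 'v::complex_space \<Rightarrow> 'v"
  assumes F_clin: "p \<in> index_set k \<Longrightarrow> q \<in> index_set k \<Longrightarrow> clin (F p q)"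
    and F_skew: "p \<in> index_set k \<Longrightarrow> q \<in> index_set k \<Longrightarrow> F (- q) (- p) u = - F p q u"
    and F_comm: "p \<in> index_set k \<Longrightarrow> q \<in> index_set k \<Longrightarrow> r \<in> index_set k \<Longrightarrow> s \<in> index_set k \<Longrightarrow>
      F p q (F r s u) - F r s (F p q u) =
        delta q r *c F p s u - delta p s *c F r q u
        - delta (- p) r *c F (- q) s u + delta (- q) s *c F r (- p) u"

lemma so_rep_mono:
  assumes "so_rep l F" "k \<le> l"
  shows "so_rep k F"
proof -
  interpret so_rep l F by fact
  have *: "p \<in> index_set k \<Longrightarrow> p \<in> index_set l" for p
    using index_set_mono[OF assms(2)] by blast
  show ?thesis
    by unfold_locales (simp_all add: F_clin F_skew F_comm *)
qed

definition inv_sub :: "nat \<Rightarrow> (int \<Rightarrow> int \<Rightarrow> 'v::complex_space \<Rightarrow> 'v) \<Rightarrow> 'v set \<Rightarrow> bool" where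
  "inv_sub k F W \<longleftrightarrow> cv.subspace W \<and> (\<forall>p\<in>index_set k. \<forall>q\<in>index_set k. \<forall>u\<in>W. F p q u \<in> W)"

definition gens :: "nat \<Rightarrow> (int \<Rightarrow> int \<Rightarrow> 'v::complex_space \<Rightarrow> 'v) \<Rightarrow> 'v set \<Rightarrow> 'v set" where
  "gens k F A = \<Inter>{W. inv_sub k F W \<and> A \<subseteq> W}"

abbreviation gen :: "nat \<Rightarrow> (int \<Rightarrow> int \<Rightarrow> 'v::complex_space \<Rightarrow> 'v) \<Rightarrow> 'v \<Rightarrow> 'v set" where
  "gen k F w \<equiv> gens k F {w}"

definition sing :: "nat \<Rightarrow> (int \<Rightarrow> int \<Rightarrow> 'v::complex_space \<Rightarrow> 'v) \<Rightarrow> 'v \<Rightarrow> bool" where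
  "sing k F w \<longleftrightarrow> (\<forall>p\<in>index_set k. \<forall>q\<in>index_set k. p < q \<longrightarrow> F p q w = 0)"

definition has_wt :: "nat \<Rightarrow> (int \<Rightarrow> int \<Rightarrow> 'v::complex_space \<Rightarrow> 'v) \<Rightarrow> (nat \<Rightarrow> real) \<Rightarrow> 'v \<Rightarrow> bool" where
  "has_wt k F \<kappa> w \<longleftrightarrow> (\<forall>i\<in>{1..k}. F (- int i) (- int i) w = complex_of_real (\<kappa> i) *c w)"

text \<open>The module is a subset \<open>N\<close> of the ambient type and \<open>k\<close> is
  explicit, so submodules of a tensor product and modules over a smaller algebra live in the same
  type.\<close>

definition hw_irred :: "nat \<Rightarrow> (int \<Rightarrow> int \<Rightarrow> 'v::complex_space \<Rightarrow> 'v) \<Rightarrow> 'v set \<Rightarrow> (nat \<Rightarrow> real) \<Rightarrow> 'v \<Rightarrow> bool" where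
  "hw_irred k F N \<kappa> v \<longleftrightarrow> inv_sub k F N \<and> v \<in> N \<and> v \<noteq> 0 \<and> sing k F v \<and> has_wt k F \<kappa> v \<and>
    (\<forall>W. inv_sub k F W \<longrightarrow> W \<subseteq> N \<longrightarrow> W = {0} \<or> W = N)"

lemma inv_subD:
  assumes "inv_sub k F W"
  shows "cv.subspace W" "p \<in> index_set k \<Longrightarrow> q \<in> index_set k \<Longrightarrow> u \<in> W \<Longrightarrow> F p q u \<in> W"
    "0 \<in> W" "u \<in> W \<Longrightarrow> v \<in> W \<Longrightarrow> u + v \<in> W" "u \<in> W \<Longrightarrow> v \<in> W \<Longrightarrow> u - v \<in> W"
    "u \<in> W \<Longrightarrow> c *c u \<in> W" "(\<And>a. a \<in> A \<Longrightarrow> f a \<in> W) \<Longrightarrow> sum f A \<in> W"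
  using assms by (auto simp: inv_sub_def cv.subspace_0 cv.subspace_add cv.subspace_diff cv.subspace_scale cv.subspace_sum)

lemma inv_sub_gens: "inv_sub k F (gens k F A)"
  unfolding gens_def inv_sub_def cv.subspace_def by auto

lemma gens_incl: "a \<in> A \<Longrightarrow> a \<in> gens k F A"
  by (auto simp: gens_def)

lemma gens_least: "inv_sub k F W \<Longrightarrow> A \<subseteq> W \<Longrightarrow> gens k F A \<subseteq> W"
  by (auto simp: gens_def)

lemma gen_self [simp]: "w \<in> gen k F w"
  by (simp add: gens_incl)

lemma hw_irredD:
  assumes "hw_irred k F N \<kappa> v"
  shows "inv_sub k F N" "v \<in> N" "v \<noteq> 0" "sing k F v" "has_wt k F \<kappa> v"
    "inv_sub k F W \<Longrightarrow> W \<subseteq> N \<Longrightarrow> u \<in> W \<Longrightarrow> u \<noteq> 0 \<Longrightarrow> W = N"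
  using assms unfolding hw_irred_def by blast+

lemma hw_irred_gen:
  assumes "hw_irred k F N \<kappa> v" "u \<in> N" "u \<noteq> 0"
  shows "gen k F u = N"
  using hw_irredD[OF assms(1)] assms(2,3) inv_sub_gens[of k F "{u}"] gens_least[of k F N "{u}"]
    gen_self[of u k F] by blast

context so_rep
begin

lemma F_diag_pos: "i \<in> {1..k} \<Longrightarrow> F (int i) (int i) u = - F (- int i) (- int i) u"
  using F_skew[of "- int i" "- int i" u] by simp

lemma F_anti_diag: assumes "p \<in> index_set k" shows "F p (- p) u = 0"
proof -
  have "F p (- p) u = - F p (- p) u" using F_skew[of p "- p" u] assms by simp
  then have "2 *c F p (- p) u = 0"
    by (metis add.right_inverse cscale_two)
  then show ?thesis by simp
qed

lemma has_wt_diag: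
  assumes "has_wt k F \<kappa> w" "p \<in> index_set k"
  shows "F p p w = complex_of_real (odd_ext \<kappa> p) *c w"
  using assms(2) by (cases rule: index_set_cases)
    (use assms(1) F_diag_pos in \<open>auto simp: has_wt_def\<close>)

end

section \<open>Lowering operators and the grading of generated submodules\<close>

inductive_set low :: "nat \<Rightarrow> (int \<Rightarrow> int \<Rightarrow> 'v::complex_space \<Rightarrow> 'v) \<Rightarrow> 'v set \<Rightarrow> 'v set" for k F A where
  low_base: "w \<in> A \<Longrightarrow> w \<in> low k F A"
| low_zero: "0 \<in> low k F A"
| low_add: "x \<in> low k F A \<Longrightarrow> y \<in> low k F A \<Longrightarrow> x + y \<in> low k F A"
| low_scale: "x \<in> low k F A \<Longrightarrow> c *c x \<in> low k F A"
| low_step: "x \<in> low k F A \<Longrightarrow> p \<in> index_set k \<Longrightarrow> q \<in> index_set k \<Longrightarrow> q < p \<Longrightarrow> F p q x \<in> low k F A"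

lemma low_subspace: "cv.subspace (low k F A)"
  by (auto simp: cv.subspace_def intro: low.intros)

lemma span_le_low: "cv.span A \<subseteq> low k F A"
  by (intro cv.span_minimal low_subspace) (auto intro: low.intros)

lemma low_diff: "x \<in> low k F A \<Longrightarrow> y \<in> low k F A \<Longrightarrow> x - y \<in> low k F A"
  using low_subspace cv.subspace_diff by blast

text \<open>A form of the triangular decomposition: an operator is commuted to the right through the
  lowering operators until it meets a vector of \<open>A\<close>, where raising operators give 0 and
  Cartan elements stay in the span of \<open>A\<close>.\<close>

lemma (in so_rep) gens_eq_low:
  assumes sing: "\<And>w. w \<in> A \<Longrightarrow> sing k F w"
    and diag: "\<And>w i. w \<in> A \<Longrightarrow> i \<in> {1..k} \<Longrightarrow> F (- int i) (- int i) w \<in> cv.span A"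
  shows "gens k F A = low k F A"
proof
  have diag': "F p p w \<in> low k F A" if "p \<in> index_set k" "w \<in> A" for p w
    using that(1)
  proof (cases rule: index_set_cases)
    case (1 i)
    then show ?thesis using diag[of w i] that(2) span_le_low[of A k F] by blast
  next
    case (2 i)
    have "(- 1) *c F (- int i) (- int i) w \<in> low k F A"
      using diag[OF that(2) 2(1)] span_le_low[of A k F] by (blast intro: low.intros)
    then show ?thesis using 2 F_diag_pos by simp
  qed
  \<comment> \<open>The claim covers all index pairs at once, because the commutator with
    \<open>F r s\<close> produces operators with other indices.\<close>
  have "\<forall>p\<in>index_set k. \<forall>q\<in>index_set k. F p q u \<in> low k F A" if "u \<in> low k F A" for u
    using that
  proof induction
    case (low_base w)
    show ?case
    proof (intro ballI)
      fix p q assume pq: "p \<in> index_set k" "q \<in> index_set k"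
      consider "p < q" | "p = q" | "q < p" by linarith
      then show "F p q w \<in> low k F A"
        using pq sing[OF low_base] diag' low_base
        by cases (auto simp: sing_def intro: low.intros)
    qed
  next
    case low_zero
    then show ?case using clin_zero[OF F_clin] by (auto intro: low.intros)
  next
    case (low_add x y)
    then show ?case using clin_add[OF F_clin] by (auto intro: low.intros)
  next
    case (low_scale x c)
    then show ?case using clin_scale[OF F_clin] by (auto intro: low.intros)
  next
    case (low_step x r s)
    show ?case
    proof (intro ballI)
      fix p q assume pq: "p \<in> index_set k" "q \<in> index_set k"
      have c: "F p q (F r s x) = F r s (F p q x) +
        (delta q r *c F p s x - delta p s *c F r q x
        - delta (- p) r *c F (- q) s x + delta (- q) s *c F r (- p) x)"
        using F_comm[OF pq low_step.hyps(2,3), of x] by (simp add: algebra_simps)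
      have i: "F p' q' x \<in> low k F A" if "p' \<in> index_set k" "q' \<in> index_set k" for p' q'
        using low_step.IH that by blast
      show "F p q (F r s x) \<in> low k F A"
        unfolding c using pq low_step.hyps
        by (intro low.low_add low_diff low.low_scale i low.low_step[OF i]) auto
    qed
  qed
  then have "inv_sub k F (low k F A)" using low_subspace by (auto simp: inv_sub_def)
  then show "gens k F A \<subseteq> low k F A" by (intro gens_least) (auto intro: low.intros)
  show "low k F A \<subseteq> gens k F A"
  proof
    fix u assume "u \<in> low k F A"
    then show "u \<in> gens k F A"
      by induction (use inv_sub_gens gens_incl in \<open>auto intro: inv_subD\<close>)
  qed
qed

definition strictly_dom :: "nat \<Rightarrow> (nat \<Rightarrow> real) \<Rightarrow> bool" where
  "strictly_dom k r \<longleftrightarrow> (\<forall>i j. 1 \<le> i \<longrightarrow> i < j \<longrightarrow> j \<le> k \<longrightarrow>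
     (\<exists>m. r j - r i = real (Suc m)) \<and> (\<exists>m. r j + r i = real (Suc m)))"

lemma strictly_dom_of_nat: "strictly_dom k real"
  unfolding strictly_dom_def
proof (intro allI impI)
  fix i j :: nat assume "1 \<le> i" "i < j"
  then have "real j - real i = real (Suc (j - i - 1))" "real j + real i = real (Suc (j + i - 1))"
    by (auto simp: of_nat_diff)
  then show "(\<exists>m. real j - real i = real (Suc m)) \<and> (\<exists>m. real j + real i = real (Suc m))" by blast
qed

text \<open>For \<open>q < p\<close> the operator \<open>F p q\<close> is lowering, so its root
  pairs with \<open>r\<close> to a negative integer. The pair \<open>q = - p\<close> has to stay
  out: it would give \<open>2 * r i\<close>, which can be negative since the smallest entry of
  \<open>r\<close> may be; there \<open>F p q\<close> is 0 by \<open>F_anti_diag\<close>.\<close>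

lemma strictly_domD:
  assumes "strictly_dom k r" "p \<in> index_set k" "q \<in> index_set k" "q < p" "q \<noteq> - p"
  obtains m where "odd_ext r q - odd_ext r p = real (Suc m)"
proof -
  have *: "(\<exists>m. r j - r i = real (Suc m)) \<and> (\<exists>m. r j + r i = real (Suc m)) \<and> (\<exists>m. r i + r j = real (Suc m))"
    if "i \<in> {1..k}" "j \<in> {1..k}" "i < j" for i j
  proof -
    have "(\<exists>m. r j - r i = real (Suc m)) \<and> (\<exists>m. r j + r i = real (Suc m))"
      using assms(1) that unfolding strictly_dom_def by auto
    then show ?thesis by (simp add: add.commute)
  qed
  from assms(2) have "\<exists>m. odd_ext r q - odd_ext r p = real (Suc m)"
  proof (cases rule: index_set_cases)
    case i: (1 i)
    from assms(3) show ?thesis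
    proof (cases rule: index_set_cases)
      case j: (1 j)
      then show ?thesis using i assms(4) *[of i j] by auto
    next
      case (2 j)
      then show ?thesis using i assms(4) by auto
    qed
  next
    case i: (2 i)
    from assms(3) show ?thesis
    proof (cases rule: index_set_cases)
      case j: (1 j)
      then have "i < j \<or> j < i" using i assms(5) by auto
      then show ?thesis using i j *[of i j] *[of j i] by auto
    next
      case j: (2 j)
      then show ?thesis using i assms(4) *[of j i] by auto
    qed
  qed
  then show ?thesis using that by blast
qed

lemma sum_delta_odd_ext:
  assumes "p \<in> index_set k"
  shows "(\<Sum>i\<in>{1..k}. complex_of_real (r i) * (delta (- int i) p - delta (int i) p)) = complex_of_real (odd_ext r p)"
  using assms
proof (cases rule: index_set_cases)
  case (1 i)
  then have "(\<Sum>j\<in>{1..k}. complex_of_real (r j) * (delta (- int j) p - delta (int j) p)) =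
    (\<Sum>j\<in>{1..k}. if j = i then complex_of_real (r i) else 0)"
    by (intro sum.cong) (auto simp: delta_def)
  then show ?thesis using 1 by simp
next
  case (2 i)
  then have "(\<Sum>j\<in>{1..k}. complex_of_real (r j) * (delta (- int j) p - delta (int j) p)) =
    (\<Sum>j\<in>{1..k}. if j = i then - complex_of_real (r i) else 0)"
    by (intro sum.cong) (auto simp: delta_def)
  then show ?thesis using 2 by simp
qed

context so_rep
begin

text \<open>The Cartan element with coordinates \<open>r\<close>. For strictly dominant
  \<open>r\<close> it grades the module: \<open>F p q\<close> shifts its eigenvalue by
  \<open>odd_ext r p - odd_ext r q\<close>, a nonzero integer for every root.\<close>

definition hop :: "(nat \<Rightarrow> real) \<Rightarrow> 'v \<Rightarrow> 'v" where
  "hop r u = (\<Sum>i\<in>{1..k}. complex_of_real (r i) *c F (- int i) (- int i) u)"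

lemma F_diag_clin: "i \<in> {1..k} \<Longrightarrow> clin (F (- int i) (- int i))"
  by (intro F_clin) auto

lemma hop_clin: "clin (hop r)"
  unfolding clin_def hop_def
  by (auto simp: clin_add[OF F_diag_clin] clin_scale[OF F_diag_clin] cscale_right_distrib
      sum.distrib cv.scale_sum_right mult.commute intro!: sum.cong)

lemma hop_mem:
  assumes "inv_sub k F W" "u \<in> W"
  shows "hop r u \<in> W"
  unfolding hop_def
  by (intro inv_subD(7)[OF assms(1)] inv_subD(6)[OF assms(1)] inv_subD(2)[OF assms(1)] assms(2)) auto

lemma hop_has_wt: "has_wt k F \<kappa> u \<Longrightarrow> hop r u = complex_of_real (\<Sum>i\<in>{1..k}. r i * \<kappa> i) *c u"
  unfolding hop_def has_wt_def by (simp add: cv.scale_sum_left)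

lemma diag_comm:
  assumes "i \<in> {1..k}" "p \<in> index_set k" "q \<in> index_set k"
  shows "F (- int i) (- int i) (F p q u) = F p q (F (- int i) (- int i) u) +
    ((delta (- int i) p - delta (int i) p) - (delta (- int i) q - delta (int i) q)) *c F p q u"
proof -
  have "F (- int i) (- int i) (F p q u) - F p q (F (- int i) (- int i) u) =
    delta (- int i) p *c F (- int i) q u - delta (- int i) q *c F p (- int i) u
        - delta (int i) p *c F (int i) q u + delta (- q) (- int i) *c F p (int i) u"
    using F_comm[of "- int i" "- int i" p q u] assms by (auto simp: delta_def)
  also have "\<dots> = (delta (- int i) p - delta (int i) p - (delta (- int i) q - delta (int i) q)) *c F p q u"
    by (auto simp: delta_def cscale_two)
  finally show ?thesis by (simp add: algebra_simps)
qed

lemma hop_comm: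
  assumes "p \<in> index_set k" "q \<in> index_set k"
  shows "hop r (F p q u) = F p q (hop r u) + complex_of_real (odd_ext r p - odd_ext r q) *c F p q u"
proof -
  have "hop r (F p q u) = (\<Sum>i\<in>{1..k}. complex_of_real (r i) *c F p q (F (- int i) (- int i) u)
    + (complex_of_real (r i) * (delta (- int i) p - delta (int i) p) -
       complex_of_real (r i) * (delta (- int i) q - delta (int i) q)) *c F p q u)"
    unfolding hop_def
    by (intro sum.cong refl) (simp add: diag_comm assms cscale_right_distrib algebra_simps)
  also have "\<dots> = F p q (hop r u) + complex_of_real (odd_ext r p - odd_ext r q) *c F p q u"
    unfolding hop_def clin_sum[OF F_clin[OF assms]] clin_scale[OF F_clin[OF assms]]
    by (simp add: sum.distrib sum_subtractf sum_delta_odd_ext[OF assms(1)] sum_delta_odd_ext[OF assms(2)]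
        flip: cv.scale_sum_left)
  finally show ?thesis .
qed

text \<open>A singular vector generates itself together with vectors whose eigenvalues are lower by
  positive integers.\<close>

lemma gens_graded:
  assumes "\<And>w. w \<in> A \<Longrightarrow> sing k F w"
    and "\<And>w i. w \<in> A \<Longrightarrow> i \<in> {1..k} \<Longrightarrow> F (- int i) (- int i) w \<in> cv.span A"
    and "strictly_dom k r" "\<And>w. w \<in> A \<Longrightarrow> hop r w = complex_of_real d *c w" "u \<in> gens k F A"
  shows "\<exists>M f. u = (\<Sum>m<M. f m) \<and> (\<forall>m::nat. M \<le> m \<longrightarrow> f m = 0) \<and>
    (\<forall>m. f m \<in> gens k F A \<and> hop r (f m) = complex_of_real (d - real m) *c f m) \<and> f 0 \<in> cv.span A"
    (is "\<exists>M f. ?P u M f")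
proof -
  have inv: "inv_sub k F (gens k F A)" by (rule inv_sub_gens)
  note sp = cv.span_zero[of A] and g0 = inv_subD(3)[OF inv]
  have "u \<in> low k F A" using assms(5) gens_eq_low[OF assms(1,2)] by simp
  then show ?thesis
  proof induction
    case (low_base w)
    have "?P w (Suc 0) (\<lambda>m. if m = 0 then w else 0)"
      using assms(4)[OF low_base] clin_zero[OF hop_clin] g0 low_base gens_incl[OF low_base] sp
      by (simp add: cv.span_base)
    then show ?case by blast
  next
    case low_zero
    have "?P 0 0 (\<lambda>m. 0)" using clin_zero[OF hop_clin] g0 sp
      by simp
    then show ?case by blast
  next
    case (low_add x y)
    then obtain M f M' g where f: "?P x M f" and g: "?P y M' g" by blast
    \<comment> \<open>The two families may have different lengths; their zero tails allow a common
      bound.\<close>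
    define L where "L = max M M'"
    have "x = (\<Sum>m<L. f m)" using f
      by (auto simp: L_def intro!: sum.mono_neutral_left) (meson not_le)
    moreover have "y = (\<Sum>m<L. g m)" using g
      by (auto simp: L_def intro!: sum.mono_neutral_left) (meson not_le)
    ultimately have s: "x + y = (\<Sum>m<L. f m + g m)" by (simp add: sum.distrib)
    have "f 0 + g 0 \<in> cv.span A" using f g by (simp add: cv.span_add)
    then have "?P (x + y) L (\<lambda>m. f m + g m)" using f g s inv_subD(4)[OF inv]
      by (simp add: L_def clin_add[OF hop_clin] cscale_right_distrib)
    then show ?case by blast
  next
    case (low_scale x c)
    then obtain M f where f: "?P x M f" by blast
    then have "?P (c *c x) M (\<lambda>m. c *c f m)"
      by (simp add: clin_scale[OF hop_clin] cv.scale_sum_right mult.commute inv_subD(6)[OF inv] cv.span_scale)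
    then show ?case by blast
  next
    case (low_step x p q)
    then obtain M f where f: "?P x M f" by blast
    show ?case
    proof (cases "q = - p")
      case True
      have "?P (F p q x) 0 (\<lambda>m. 0)" using clin_zero[OF hop_clin] g0 True low_step.hyps sp
        by (simp add: F_anti_diag)
      then show ?thesis by blast
    next
      case False
      obtain m0 where m0: "odd_ext r q - odd_ext r p = real (Suc m0)"
        using strictly_domD[OF assms(3)] low_step.hyps False by blast
      let ?t = "Suc m0"
      \<comment> \<open>All components move down by \<open>?t > 0\<close>, so the new component with
        index 0 vanishes: only vectors of \<open>A\<close> ever contribute to it.\<close>
      define g where "g m = (if m < ?t then 0 else F p q (f (m - ?t)))" for m
      have "F p q x = (\<Sum>m<M. F p q (f m))" using f clin_sum[OF F_clin] low_step.hyps by simp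
      also have "\<dots> = (\<Sum>m\<in>{?t..<M + ?t}. g m)"
        by (rule sum.reindex_bij_witness[where j = "\<lambda>m. m + ?t" and i = "\<lambda>m. m - ?t"])
          (auto simp: g_def)
      also have "\<dots> = (\<Sum>m<M + ?t. g m)"
        by (rule sum.mono_neutral_left) (auto simp: g_def)
      finally have 1: "F p q x = (\<Sum>m<M + ?t. g m)" .
      have 2: "g m = 0" if "M + ?t \<le> m" for m
        using f that clin_zero[OF F_clin] low_step.hyps by (auto simp: g_def)
      have 3: "g m \<in> gens k F A" for m
        using f low_step.hyps g0 inv_subD(2)[OF inv] by (simp add: g_def)
      have 4: "hop r (g m) = complex_of_real (d - real m) *c g m" for m
      proof (cases "m < ?t")
        case True
        then show ?thesis using clin_zero[OF hop_clin] by (simp add: g_def)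
      next
        case False
        have "hop r (g m) = F p q (hop r (f (m - ?t))) + complex_of_real (odd_ext r p - odd_ext r q) *c g m"
          using False hop_comm low_step.hyps by (simp add: g_def)
        also have "F p q (hop r (f (m - ?t))) = complex_of_real (d - real (m - ?t)) *c g m"
          using f False clin_scale[OF F_clin] low_step.hyps by (simp add: g_def)
        also have "odd_ext r p - odd_ext r q = - real ?t" using m0 by simp
        also have "real (m - ?t) = real m - real ?t" using False by (simp add: of_nat_diff)
        finally show ?thesis
          by (simp only: cscale_left_distrib[symmetric] of_real_add[symmetric]) simp
      qed
      have "?P (F p q x) (M + ?t) g"
        using 1 2 3 4 sp by (simp add: g_def)
      then show ?thesis by blast
    qed
  qed
qed

text \<open>The module is a sum of eigenspaces for the values \<open>d - m\<close>; an eigenvector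
  for any other value would be independent of its own components.\<close>

lemma gens_eigenvalue:
  assumes "\<And>w. w \<in> A \<Longrightarrow> sing k F w"
    and "\<And>w i. w \<in> A \<Longrightarrow> i \<in> {1..k} \<Longrightarrow> F (- int i) (- int i) w \<in> cv.span A"
    and "strictly_dom k r" "\<And>w. w \<in> A \<Longrightarrow> hop r w = complex_of_real d *c w" "u \<in> gens k F A"
    and "u \<noteq> 0" "hop r u = complex_of_real e *c u"
  shows "\<exists>m::nat. e = d - real m"
proof (rule ccontr)
  assume n: "\<nexists>m::nat. e = d - real m"
  obtain M f where f: "u = (\<Sum>m<M. f m)"
    "\<And>m. hop r (f m) = complex_of_real (d - real m) *c f m"
    using gens_graded[OF assms(1-5)] by blast
  \<comment> \<open>The index \<open>M\<close> lies outside the sum and serves as a slot for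
    \<open>- u\<close>, so that all terms add up to 0.\<close>
  define g where "g m = (if m = M then - u else f m)" for m
  have s: "(\<Sum>m<Suc M. g m) = 0" using f(1) by (simp add: g_def)
  have "g M \<in> {0}"
  proof (rule eigen_sum_mem[where A = "{..<Suc M}" and H = "hop r" and
        a = "\<lambda>m. complex_of_real (if m = M then e else d - real m)"])
    show "hop r (g m) = complex_of_real (if m = M then e else d - real m) *c g m" for m
      using f(2)[of m] assms(7) by (simp add: g_def clin_minus[OF hop_clin])
    show "inj_on (\<lambda>m. complex_of_real (if m = M then e else d - real m)) {..<Suc M}"
      using n by (auto simp: inj_on_def)
  qed (use s hop_clin clin_zero[OF hop_clin] in \<open>auto simp: cv.subspace_def\<close>)
  then show False using assms(6) by (simp add: g_def)
qed

lemma gen_graded: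
  assumes "sing k F w" "has_wt k F \<kappa> w" "strictly_dom k r" "u \<in> gen k F w"
  defines "d \<equiv> (\<Sum>i\<in>{1..k}. r i * \<kappa> i)"
  shows "\<exists>M f. u = (\<Sum>m<M. f m) \<and> (\<forall>m::nat. M \<le> m \<longrightarrow> f m = 0) \<and>
    (\<forall>m. f m \<in> gen k F w \<and> hop r (f m) = complex_of_real (d - real m) *c f m) \<and> (\<exists>c. f 0 = c *c w)"
proof -
  have "F (- int i) (- int i) w \<in> cv.span {w}" if "i \<in> {1..k}" for i
    using assms(2) that by (auto simp: has_wt_def cv.span_singleton)
  moreover have "hop r w = complex_of_real d *c w" unfolding d_def by (rule hop_has_wt[OF assms(2)])
  ultimately have "\<exists>M f. u = (\<Sum>m<M. f m) \<and> (\<forall>m::nat. M \<le> m \<longrightarrow> f m = 0) \<and>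
    (\<forall>m. f m \<in> gen k F w \<and> hop r (f m) = complex_of_real (d - real m) *c f m) \<and> f 0 \<in> cv.span {w}"
    using assms(1,3,4) by (intro gens_graded) auto
  then show ?thesis by (simp add: cv.span_singleton image_iff)
qed

lemma gen_top:
  assumes "sing k F w" "has_wt k F \<kappa> w" "strictly_dom k r" "u \<in> gen k F w"
    "hop r u = complex_of_real (\<Sum>i\<in>{1..k}. r i * \<kappa> i) *c u"
  shows "\<exists>c. u = c *c w"
proof -
  let ?d = "\<Sum>i\<in>{1..k}. r i * \<kappa> i"
  obtain M f c where f: "u = (\<Sum>m<M. f m)" "\<And>m. M \<le> m \<Longrightarrow> f m = 0"
    "\<And>m. hop r (f m) = complex_of_real (?d - real m) *c f m" "f 0 = c *c w"
    using gen_graded[OF assms(1-4)] by blast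
  \<comment> \<open>A further zero term makes the index 0 occur even if \<open>M = 0\<close>; there
    \<open>u\<close> is compared with the top component, a multiple of \<open>w\<close>.\<close>
  have u: "u = (\<Sum>m<Suc M. f m)" using f(1) f(2)[of M] by simp
  define g where "g m = (if m = 0 then f 0 - u else f m)" for m
  have "(\<Sum>m<Suc M. g m) = (\<Sum>m<Suc M. f m) - u"
    unfolding g_def sum.lessThan_Suc_shift by simp
  then have s: "(\<Sum>m<Suc M. g m) = 0" using u by simp
  have "g 0 \<in> {0}"
  proof (rule eigen_sum_mem[where A = "{..<Suc M}" and H = "hop r" and a = "\<lambda>m. complex_of_real (?d - real m)"])
    show "hop r (g m) = complex_of_real (?d - real m) *c g m" for m
      using f(3)[of m] f(3)[of 0] assms(5) by (auto simp: g_def clin_diff[OF hop_clin] cv.scale_right_diff_distrib)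
  qed (use s hop_clin clin_zero[OF hop_clin] in \<open>auto simp: inj_on_def cv.subspace_def\<close>)
  then show ?thesis using f(4) by (auto simp: g_def)
qed

lemma gen_eigenvalue:
  assumes "sing k F w" "has_wt k F \<kappa> w" "strictly_dom k r" "u \<in> gen k F w" "u \<noteq> 0"
    "hop r u = complex_of_real e *c u"
  shows "\<exists>m::nat. e = (\<Sum>i\<in>{1..k}. r i * \<kappa> i) - real m"
proof (rule gens_eigenvalue[OF _ _ assms(3) _ assms(4-6)])
  show "F (- int i) (- int i) x \<in> cv.span {w}" if "i \<in> {1..k}" "x \<in> {w}" for i x
    using assms(2) that by (auto simp: has_wt_def cv.span_singleton)
  show "hop r x = complex_of_real (\<Sum>i\<in>{1..k}. r i * \<kappa> i) *c x" if "x \<in> {w}" for x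
    using hop_has_wt[OF assms(2)] that by blast
  show "sing k F x" if "x \<in> {w}" for x using assms(1) that by blast
qed

lemma inv_sub_homogeneous:
  assumes "sing k F w" "has_wt k F \<kappa> w" "strictly_dom k r" "inv_sub k F W" "W \<subseteq> gen k F w"
    "u \<in> W" "u \<noteq> 0"
  shows "\<exists>x\<in>W. \<exists>m::nat. x \<noteq> 0 \<and> hop r x = complex_of_real ((\<Sum>i\<in>{1..k}. r i * \<kappa> i) - real m) *c x"
proof -
  let ?d = "\<Sum>i\<in>{1..k}. r i * \<kappa> i"
  obtain M f where f: "u = (\<Sum>m<M. f m)"
    "\<And>m. hop r (f m) = complex_of_real (?d - real m) *c f m"
    using gen_graded[OF assms(1-3) subsetD[OF assms(5,6)]] by blast
  have "f m \<in> W" if "m \<in> {..<M}" for m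
    by (rule eigen_sum_mem[where A = "{..<M}" and H = "hop r" and a = "\<lambda>m. complex_of_real (?d - real m)"])
      (use f(2) f(1)[symmetric] that assms(6) hop_clin hop_mem[OF assms(4)] inv_subD(1)[OF assms(4)] in \<open>simp_all add: inj_on_def\<close>)
  moreover obtain m where m: "m \<in> {..<M}" and nz: "f m \<noteq> 0"
  proof -
    have "(\<Sum>m<M. f m) \<noteq> 0" using f(1) assms(7) by simp
    from sum.not_neutral_contains_not_neutral[OF this] show ?thesis using that by blast
  qed
  ultimately have mem: "f m \<in> W" by blast
  have "f m \<noteq> 0 \<and> hop r (f m) = complex_of_real (?d - real m) *c f m" using nz f(2) by blast
  with mem show ?thesis by blast
qed

text \<open>A nonzero homogeneous vector of \<open>W\<close> of least depth \<open>m\<close> is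
  singular, as a raising operator would lead to a smaller depth inside \<open>W\<close>; depths are
  natural numbers because nothing in \<open>gen k F w\<close> lies above \<open>w\<close>. The
  vector is homogeneous for \<open>hop r\<close> and not necessarily a weight vector.\<close>

lemma inv_sub_singular:
  assumes "sing k F w" "has_wt k F \<kappa> w" "strictly_dom k r" "inv_sub k F W" "W \<subseteq> gen k F w"
    "u \<in> W" "u \<noteq> 0"
  shows "\<exists>x\<in>W. \<exists>m::nat. x \<noteq> 0 \<and> sing k F x \<and>
    hop r x = complex_of_real ((\<Sum>i\<in>{1..k}. r i * \<kappa> i) - real m) *c x"
proof -
  let ?d = "\<Sum>i\<in>{1..k}. r i * \<kappa> i"
  let ?P = "\<lambda>m::nat. \<exists>x\<in>W. x \<noteq> 0 \<and> hop r x = complex_of_real (?d - real m) *c x"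
  define m where "m = (LEAST m. ?P m)"
  have ex: "\<exists>m. ?P m"
    using inv_sub_homogeneous[OF assms] by (elim bexE exE) (intro exI bexI)
  have "?P m" unfolding m_def by (rule LeastI_ex[OF ex])
  then obtain x where x: "x \<in> W" "x \<noteq> 0" "hop r x = complex_of_real (?d - real m) *c x" by blast
  have "sing k F x" unfolding sing_def
  proof (intro ballI impI)
    fix p q assume pq: "p \<in> index_set k" "q \<in> index_set k" "p < q"
    show "F p q x = 0"
    proof (cases "q = - p")
      case True
      then show ?thesis using F_anti_diag pq by simp
    next
      case False
      then obtain t where t: "odd_ext r p - odd_ext r q = real (Suc t)"
        using strictly_domD[OF assms(3), of q p] pq by auto
      have y: "F p q x \<in> W" using x pq inv_subD(2)[OF assms(4)] by blast
      have h: "hop r (F p q x) = complex_of_real (?d - real m + real (Suc t)) *c F p q x"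
        using hop_comm[OF pq(1,2), of r x] x(3) t clin_scale[OF F_clin[OF pq(1,2)]]
        by (simp only: cscale_left_distrib[symmetric] of_real_add[symmetric])
      show ?thesis
      proof (rule ccontr)
        assume nz: "F p q x \<noteq> 0"
        obtain m' :: nat where m': "?d - real m + real (Suc t) = ?d - real m'"
          using gen_eigenvalue[OF assms(1-3) _ nz h] y assms(5) by blast
        then have "m' < m" by simp
        moreover have "?P m'" using y nz h unfolding m' by blast
        ultimately show False using not_less_Least[of m' ?P] unfolding m_def by blast
      qed
    qed
  qed
  then show ?thesis using x by blast
qed

text \<open>Each homogeneous component of a singular vector is singular. One of positive depth would
  yield, by irreducibility, all of \<open>N\<close> through lowering operators, whereas
  \<open>v\<close> has a higher degree than everything so obtained.\<close>

lemma hw_irred_singular: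
  assumes "hw_irred k F N \<kappa> v" "u \<in> N" "sing k F u"
  shows "\<exists>c. u = c *c v"
proof -
  note v = hw_irredD[OF assms(1)]
  let ?r = "real :: nat \<Rightarrow> real"
  let ?d = "\<Sum>i\<in>{1..k}. ?r i * \<kappa> i"
  note sd = strictly_dom_of_nat[of k]
  have N: "gen k F v = N" using hw_irred_gen[OF assms(1) v(2,3)] .
  obtain M f c where f: "u = (\<Sum>m<M. f m)" "\<And>m. M \<le> m \<Longrightarrow> f m = 0" "\<And>m. f m \<in> N"
    "\<And>m. hop ?r (f m) = complex_of_real (?d - real m) *c f m" "f 0 = c *c v"
    using gen_graded[OF v(4,5) sd, of u] assms(2) N by blast
  have sf: "sing k F (f m)" if "m < M" for m
    unfolding sing_def
  proof (intro ballI impI)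
    fix p q assume pq: "p \<in> index_set k" "q \<in> index_set k" "p < q"
    let ?t = "odd_ext ?r p - odd_ext ?r q"
    have s: "(\<Sum>m<M. F p q (f m)) = 0"
      using assms(3) pq f(1) clin_sum[OF F_clin[OF pq(1,2)], of f "{..<M}"] by (auto simp: sing_def)
    \<comment> \<open>\<open>F p q\<close> shifts all eigenvalues by the same \<open>?t\<close>, so
      the images of the components stay separated and vanish individually.\<close>
    have "F p q (f m) \<in> {0}"
    proof (rule eigen_sum_mem[where A = "{..<M}" and H = "hop ?r" and a = "\<lambda>m. complex_of_real (?d - real m + ?t)"])
      show "hop ?r (F p q (f m)) = complex_of_real (?d - real m + ?t) *c F p q (f m)" for m
        using hop_comm[OF pq(1,2), of ?r "f m"] f(4)[of m] clin_scale[OF F_clin[OF pq(1,2)]]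
        by (simp flip: cscale_left_distrib of_real_add of_real_diff)
    qed (use s that hop_clin clin_zero[OF hop_clin] in \<open>auto simp: inj_on_def cv.subspace_def\<close>)
    then show "F p q (f m) = 0" by simp
  qed
  have "f m = 0" if m: "0 < m" "m < M" for m
  proof (rule ccontr)
    assume nz: "f m \<noteq> 0"
    \<comment> \<open>\<open>f m\<close> alone need not be a weight vector; the space of all
      singular vectors of this degree is stable under the Cartan subalgebra, as the grading argument
      requires of its generators.\<close>
    let ?T = "{x \<in> N. sing k F x \<and> hop ?r x = complex_of_real (?d - real m) *c x}"
    have "f m \<in> gens k F ?T" using f(3,4) sf[OF m(2)] by (intro gens_incl) auto
    moreover have "gens k F ?T \<subseteq> N" by (rule gens_least[OF v(1)]) auto
    ultimately have vin: "v \<in> gens k F ?T"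
      using v(2) hw_irredD(6)[OF assms(1) inv_sub_gens _ _ nz] by blast
    have "\<exists>m'::nat. ?d = (?d - real m) - real m'"
    proof (rule gens_eigenvalue[OF _ _ sd _ vin v(3) hop_has_wt[OF v(5)]])
      show "F (- int i) (- int i) x \<in> cv.span ?T" if x: "x \<in> ?T" and i: "i \<in> {1..k}" for x i
      proof (rule cv.span_base, safe)
        have ii: "- int i \<in> index_set k" using i by auto
        show "F (- int i) (- int i) x \<in> N" using ii x inv_subD(2)[OF v(1)] by blast
        show "sing k F (F (- int i) (- int i) x)"
          unfolding sing_def
        proof (intro ballI impI)
          fix p q assume pq: "p \<in> index_set k" "q \<in> index_set k" "p < q"
          then have "F p q x = 0" using x by (auto simp: sing_def)
          then show "F p q (F (- int i) (- int i) x) = 0"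
            using diag_comm[OF i pq(1,2), of x] clin_zero[OF F_clin[OF ii ii]] by simp
        qed
        show "hop ?r (F (- int i) (- int i) x) = complex_of_real (?d - real m) *c F (- int i) (- int i) x"
          using hop_comm[OF ii ii, of ?r x] x clin_scale[OF F_clin[OF ii ii]] by simp
      qed
    qed auto
    then show False using m by auto
  qed
  then have "(\<Sum>m<M. f m) = (\<Sum>m<M. if m = 0 then f 0 else 0)" by (intro sum.cong) auto
  then have "u = (if M = 0 then 0 else c) *c v" using f(1,5) by simp
  then show "\<exists>c. u = c *c v" by (rule exI[of "\<lambda>c. u = c *c v"])
qed

end

section \<open>The Casimir operator\<close>

lemma index_set_0 [simp]: "index_set 0 = {}"
  by (auto simp: index_set_def)

lemma index_set_Suc: "index_set (Suc k) = insert (- int (Suc k)) (insert (int (Suc k)) (index_set k))"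
  by (auto simp: index_set_def)

lemma sum_index_set_Suc:
  fixes g :: "int \<Rightarrow> 'a::ab_group_add"
  shows "(\<Sum>p\<in>index_set (Suc k). g p) = (\<Sum>p\<in>index_set k. g p) + g (- int (Suc k)) + g (int (Suc k))"
proof -
  have "- int (Suc k) \<notin> insert (int (Suc k)) (index_set k)" "int (Suc k) \<notin> index_set k"
    by (auto simp: index_set_def)
  then show ?thesis unfolding index_set_Suc by (simp add: add_ac)
qed

lemma sum_index_set:
  fixes g :: "int \<Rightarrow> 'a::ab_group_add"
  shows "(\<Sum>p\<in>index_set k. g p) = (\<Sum>i\<in>{1..k}. g (- int i) + g (int i))"
  by (induction k) (simp_all only: sum_index_set_Suc index_set_0 sum.empty, simp_all add: add_ac)

text \<open>Here \<rho> enters. The positive roots add up to 2 \<rho>, and \<rho> has entry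
  \<open>i - 1\<close> at position \<open>i\<close>; every root occurs twice, as
  \<open>(p, q)\<close> and as \<open>(- q, - p)\<close>, whence \<open>4 * (i - 1)\<close>. The
  induction step adds the pairs that contain one of the two new indices.\<close>

lemma sum_raising_differences:
  fixes g :: "int \<Rightarrow> 'a::complex_space"
  assumes "\<And>i. i \<in> {1..k} \<Longrightarrow> g (int i) = - g (- int i)"
  shows "(\<Sum>p\<in>index_set k. \<Sum>q\<in>index_set k. if p < q \<and> q \<noteq> - p then g p - g q else 0) =
    (\<Sum>i\<in>{1..k}. (4 * (of_nat i - 1)) *c g (- int i))"
  using assms
proof (induction k)
  case 0
  then show ?case by simp
next
  case (Suc k)
  let ?m = "int (Suc k)"
  let ?t = "\<lambda>p q. if p < q \<and> q \<noteq> - p then g p - g q else 0"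
  have sum0: "(\<Sum>p\<in>index_set k. g p) = 0"
    unfolding sum_index_set using Suc.prems by (intro sum.neutral) auto
  have gm: "g ?m = - g (- ?m)" using Suc.prems[of "Suc k"] by simp
  have card: "card (index_set k) = 2 * k"
  proof -
    have "int (card (index_set k)) = (\<Sum>p\<in>index_set k. 1)" by simp
    also have "\<dots> = 2 * int k" unfolding sum_index_set by simp
    finally show ?thesis by simp
  qed
  have bd: "- ?m < p \<and> p < ?m" if "p \<in> index_set k" for p using that by (auto simp: index_set_def)
  have const: "(\<Sum>p\<in>index_set k. c) = (2 * of_nat k) *c c" for c :: 'a
    by (simp add: cv.sum_constant_scale card)
  have a: "(\<Sum>q\<in>index_set k. ?t (- ?m) q) = (2 * of_nat k) *c g (- ?m)"
  proof -
    have "(\<Sum>q\<in>index_set k. ?t (- ?m) q) = (\<Sum>q\<in>index_set k. g (- ?m) - g q)"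
      by (rule sum.cong[OF refl], frule bd) auto
    then show ?thesis by (simp only: sum_subtractf sum0 const) simp
  qed
  have b: "(\<Sum>p\<in>index_set k. ?t p ?m) = (2 * of_nat k) *c g (- ?m)"
  proof -
    have "(\<Sum>p\<in>index_set k. ?t p ?m) = (\<Sum>p\<in>index_set k. g p - g ?m)"
      by (rule sum.cong[OF refl], frule bd) auto
    then show ?thesis by (simp only: sum_subtractf sum0 const gm) simp
  qed
  have c: "(\<Sum>p\<in>index_set k. ?t p (- ?m)) = 0" "(\<Sum>q\<in>index_set k. ?t ?m q) = 0"
    by (rule sum.neutral, rule ballI, frule bd, simp)+
  have "(\<Sum>p\<in>index_set (Suc k). \<Sum>q\<in>index_set (Suc k). ?t p q) =
    (\<Sum>p\<in>index_set k. \<Sum>q\<in>index_set k. ?t p q) + (4 * of_nat k) *c g (- ?m)"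
    unfolding sum_index_set_Suc sum.distrib a b c
    by (simp flip: cscale_left_distrib)
  also have "(\<Sum>p\<in>index_set k. \<Sum>q\<in>index_set k. ?t p q) = (\<Sum>i\<in>{1..k}. (4 * (of_nat i - 1)) *c g (- int i))"
    using Suc by auto
  finally show ?case by simp
qed

context so_rep
begin

text \<open>\<open>F q p\<close> is, up to a scalar, dual to \<open>F p q\<close> for the trace
  form. By \<open>F_skew\<close> each term of the usual Casimir sum is counted twice, which explains
  the factors 2 and 4 in the eigenvalues below.\<close>

definition casimir :: "'v \<Rightarrow> 'v" where
  "casimir u = (\<Sum>p\<in>index_set k. \<Sum>q\<in>index_set k. F p q (F q p u))"

lemma casimir_clin: "clin casimir"
  unfolding clin_def casimir_def
  by (simp add: clin_add[OF F_clin] clin_scale[OF F_clin] sum.distrib cv.scale_sum_right)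

lemma casimir_mem:
  assumes "inv_sub k F W" "u \<in> W"
  shows "casimir u \<in> W"
  unfolding casimir_def
  by (intro inv_subD(7)[OF assms(1)] inv_subD(2)[OF assms(1)] assms(2))

lemma casimir_comm:
  assumes r: "r \<in> index_set k" and s: "s \<in> index_set k"
  shows "casimir (F r s u) = F r s (casimir u)"
proof -
  let ?K = "index_set k"
  have d: "(\<Sum>p\<in>?K. delta x p *c g p) = g x" if "x \<in> ?K" for x and g :: "int \<Rightarrow> 'v"
  proof -
    have "(\<Sum>p\<in>?K. delta x p *c g p) = (\<Sum>p\<in>?K. if p = x then g x else 0)"
      by (intro sum.cong) (auto simp: delta_def)
    then show ?thesis using that by simp
  qed
  have dd: "(\<Sum>p\<in>?K. \<Sum>q\<in>?K. delta x p *c g p q) = (\<Sum>q\<in>?K. g x q)" if "x \<in> ?K"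
    for x and g :: "int \<Rightarrow> int \<Rightarrow> 'v"
    using d[OF that, of "\<lambda>p. \<Sum>q\<in>?K. g p q"] by (simp add: cv.scale_sum_right)
  have c: "F r s (F p q v) = F p q (F r s v) + (delta s p *c F r q v - delta r q *c F p s v
        - delta (- r) p *c F (- s) q v + delta (- s) q *c F p (- r) v)"
    if "p \<in> ?K" "q \<in> ?K" for p q v
    using F_comm[OF r s that, of v] by (simp add: algebra_simps)
  have "F r s (F p q (F q p u)) - F p q (F q p (F r s u)) =
     (delta s p *c F r q (F q p u) - delta r q *c F p s (F q p u)
        - delta (- r) p *c F (- s) q (F q p u) + delta (- s) q *c F p (- r) (F q p u))
   + (delta s q *c F p q (F r p u) - delta r p *c F p q (F q s u)
        - delta (- r) q *c F p q (F (- s) p u) + delta (- s) p *c F p q (F q (- r) u))"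
    if "p \<in> ?K" "q \<in> ?K" for p q
    using that r s c[OF that, of "F q p u"] c[OF that(2,1), of u]
    by (simp add: clin_simps[OF F_clin])
  then have "F r s (casimir u) - casimir (F r s u) = (\<Sum>p\<in>?K. \<Sum>q\<in>?K.
     (delta s p *c F r q (F q p u) - delta r q *c F p s (F q p u)
        - delta (- r) p *c F (- s) q (F q p u) + delta (- s) q *c F p (- r) (F q p u))
   + (delta s q *c F p q (F r p u) - delta r p *c F p q (F q s u)
        - delta (- r) q *c F p q (F (- s) p u) + delta (- s) p *c F p q (F q (- r) u)))"
    unfolding casimir_def clin_sum[OF F_clin[OF r s]] sum_subtractf[symmetric]
    by (intro sum.cong refl)
  \<comment> \<open>Once the deltas are contracted, each of the four sums from commuting with the
    left factor cancels one from the right factor, for instance the two occurrences of the sum of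
    \<open>F r q (F q s u)\<close> over \<open>q\<close>.\<close>
  also have "\<dots> = 0"
    using r s by (simp add: sum.distrib sum_subtractf d dd)
  finally show ?thesis by simp
qed

text \<open>After raising operators have been commuted so as to act first, only the Cartan part
  survives modulo \<open>W\<close>. Allowing a submodule \<open>W\<close> covers both truly singular
  vectors, with \<open>W = {0}\<close>, and the v \<otimes> e_J, which are singular only modulo
  higher ones.\<close>

lemma casimir_mod:
  assumes "inv_sub k F W" and "\<And>p q. p \<in> index_set k \<Longrightarrow> q \<in> index_set k \<Longrightarrow> p < q \<Longrightarrow> F p q u \<in> W"
  shows "casimir u - (\<Sum>i\<in>{1..k}. 2 *c F (- int i) (- int i) (F (- int i) (- int i) u) +
    (4 * (of_nat i - 1)) *c F (- int i) (- int i) u) \<in> W"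
proof -
  let ?K = "index_set k"
  define a where "a p q = (if p = q then F p p (F p p u) else 0) +
    (if p < q \<and> q \<noteq> - p then F p p u - F q q u else 0)" for p q
  have t: "F p q (F q p u) - a p q \<in> W" if p: "p \<in> ?K" and q: "q \<in> ?K" for p q
  proof -
    consider "p = q" | "q < p" | "q = - p" "p < q" | "p < q" "q \<noteq> - p" by linarith
    then show ?thesis
    proof cases
      case 1
      then show ?thesis using inv_subD(3)[OF assms(1)] by (simp add: a_def)
    next
      case 2
      then show ?thesis using inv_subD(2)[OF assms(1) p q assms(2)[OF q p]] by (simp add: a_def)
    next
      case 3
      have "F q p u = 0" using F_anti_diag[OF q, of u] 3 by simp
      then show ?thesis using 3 inv_subD(3)[OF assms(1)] clin_zero[OF F_clin[OF p q]] by (simp add: a_def)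
    next
      case 4
      have "F p q (F q p u) - F q p (F p q u) = F p p u - F q q u"
        using F_comm[OF p q q p, of u] 4 by (auto simp: delta_def)
      then have "F p q (F q p u) - a p q = F q p (F p q u)"
        using 4 by (simp add: a_def algebra_simps)
      then show ?thesis using inv_subD(2)[OF assms(1) q p assms(2)[OF p q 4(1)]] by simp
    qed
  qed
  have "casimir u - (\<Sum>p\<in>?K. \<Sum>q\<in>?K. a p q) \<in> W"
    unfolding casimir_def sum_subtractf[symmetric]
    by (intro inv_subD(7)[OF assms(1)] t)
  moreover have "(\<Sum>p\<in>?K. \<Sum>q\<in>?K. a p q) = (\<Sum>p\<in>?K. F p p (F p p u)) +
     (\<Sum>p\<in>?K. \<Sum>q\<in>?K. if p < q \<and> q \<noteq> - p then F p p u - F q q u else 0)"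
    unfolding a_def sum.distrib by simp
  moreover have "(\<Sum>p\<in>?K. \<Sum>q\<in>?K. if p < q \<and> q \<noteq> - p then F p p u - F q q u else 0) =
     (\<Sum>i\<in>{1..k}. (4 * (of_nat i - 1)) *c F (- int i) (- int i) u)"
    by (rule sum_raising_differences) (rule F_diag_pos)
  moreover have "(\<Sum>p\<in>?K. F p p (F p p u)) = (\<Sum>i\<in>{1..k}. 2 *c F (- int i) (- int i) (F (- int i) (- int i) u))"
    unfolding sum_index_set
    by (intro sum.cong refl) (simp add: F_diag_pos clin_minus[OF F_diag_clin] cscale_two)
  ultimately show ?thesis by (simp add: sum.distrib)
qed

text \<open>The scalar is twice (\<kappa>, \<kappa> + 2 \<rho>).\<close>

lemma casimir_wt_mod:
  assumes "inv_sub k F W" and "\<And>p q. p \<in> index_set k \<Longrightarrow> q \<in> index_set k \<Longrightarrow> p < q \<Longrightarrow> F p q u \<in> W"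
    and "has_wt k F \<kappa> u"
  shows "casimir u - complex_of_real (\<Sum>i\<in>{1..k}. 2 * \<kappa> i ^ 2 + 4 * (real i - 1) * \<kappa> i) *c u \<in> W"
proof -
  have "2 *c F (- int i) (- int i) (F (- int i) (- int i) u) +
    (4 * (of_nat i - 1)) *c F (- int i) (- int i) u =
    complex_of_real (2 * \<kappa> i ^ 2 + 4 * (real i - 1) * \<kappa> i) *c u" if "i \<in> {1..k}" for i
    using assms(3) that
    by (simp add: has_wt_def clin_scale[OF F_diag_clin] power2_eq_square mult.assoc flip: cscale_left_distrib)
  then have "(\<Sum>i\<in>{1..k}. 2 *c F (- int i) (- int i) (F (- int i) (- int i) u) +
    (4 * (of_nat i - 1)) *c F (- int i) (- int i) u) =
    complex_of_real (\<Sum>i\<in>{1..k}. 2 * \<kappa> i ^ 2 + 4 * (real i - 1) * \<kappa> i) *c u"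
    unfolding of_real_sum cv.scale_sum_left by (intro sum.cong refl)
  then show ?thesis using casimir_mod[OF assms(1,2)] by simp
qed

end

section \<open>Isomorphism of irreducible representations, and the spinor module\<close>

lemma has_wt_cong: "(\<And>i. i \<in> {1..k} \<Longrightarrow> \<kappa> i = \<kappa>' i) \<Longrightarrow> has_wt k F \<kappa> w = has_wt k F \<kappa>' w"
  by (simp add: has_wt_def)

definition hom_on :: "nat \<Rightarrow> (int \<Rightarrow> int \<Rightarrow> 'v::complex_space \<Rightarrow> 'v) \<Rightarrow> (int \<Rightarrow> int \<Rightarrow> 'w::complex_space \<Rightarrow> 'w)
    \<Rightarrow> 'v set \<Rightarrow> ('v \<Rightarrow> 'w) \<Rightarrow> bool" where
  "hom_on k F F' N T \<longleftrightarrow> (\<forall>x\<in>N. \<forall>y\<in>N. T (x + y) = T x + T y) \<and> (\<forall>c. \<forall>x\<in>N. T (c *c x) = c *c T x) \<and>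
     (\<forall>p\<in>index_set k. \<forall>q\<in>index_set k. \<forall>x\<in>N. T (F p q x) = F' p q (T x))"

lemma so_rep_prod:
  assumes "so_rep k F" "so_rep k F'"
  shows "so_rep k (\<lambda>p q z. (F p q (fst z), F' p q (snd z)))"
proof -
  interpret f: so_rep k F by fact
  interpret g: so_rep k F' by fact
  show ?thesis
  proof
    show "clin (\<lambda>z. (F p q (fst z), F' p q (snd z)))" if "p \<in> index_set k" "q \<in> index_set k" for p q
      using f.F_clin[OF that] g.F_clin[OF that] by (auto simp: clin_def)
  qed (simp_all add: f.F_skew g.F_skew f.F_comm g.F_comm)
qed

text \<open>The submodule \<open>G\<close> of \<open>N \<times> N'\<close> generated by
  \<open>(v, v')\<close> is the graph of the isomorphism. It projects onto both factors by
  irreducibility. A nonzero kernel would be a whole factor, so \<open>G\<close> would contain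
  \<open>(0, v')\<close> or \<open>(v, 0)\<close>; these have the top degree, in which
  \<open>G\<close> has only multiples of \<open>(v, v')\<close>.\<close>

lemma hw_irred_iso:
  assumes F: "so_rep k F" and F': "so_rep k F'"
    and hw: "hw_irred k F N \<kappa> v" and hw': "hw_irred k F' N' \<kappa> v'"
  shows "\<exists>T. hom_on k F F' N T \<and> bij_betw T N N' \<and> T v = v'"
proof -
  define P where "P = (\<lambda>p q z. (F p q (fst z), F' p q (snd z)))"
  interpret f: so_rep k F by fact
  interpret g: so_rep k F' by fact
  interpret P: so_rep k P unfolding P_def by (rule so_rep_prod[OF F F'])
  note h = hw_irredD[OF hw] and h' = hw_irredD[OF hw']
  define G where "G = gen k P (v, v')"
  have invG: "inv_sub k P G" unfolding G_def by (rule inv_sub_gens)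
  note G = inv_subD[OF invG]
  have sub: "G \<subseteq> N \<times> N'"
  proof -
    have "inv_sub k P (N \<times> N')"
      using h(1) h'(1) by (auto simp: inv_sub_def P_def cv.subspace_def zero_prod_def plus_prod_def)
    then show ?thesis unfolding G_def using h(2) h'(2) by (intro gens_least) auto
  qed
  have vG: "(v, v') \<in> G" unfolding G_def by simp
  have sing: "sing k P (v, v')" using h(4) h'(4) by (simp add: sing_def P_def zero_prod_def)
  have wt: "has_wt k P \<kappa> (v, v')" using h(5) h'(5) by (simp add: has_wt_def P_def)
  note top = P.gen_top[OF sing wt strictly_dom_of_nat, folded G_def]
  have hop: "P.hop r (x, y) = (f.hop r x, g.hop r y)" for r x y
    unfolding P.hop_def f.hop_def g.hop_def by (simp add: P_def prod_eq_iff fst_sum snd_sum)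
  have Y0: "y = 0" if "(0, y) \<in> G" for y
  proof (rule ccontr)
    assume "y \<noteq> 0"
    let ?Y = "{y. (0, y) \<in> G}"
    have "inv_sub k F' ?Y"
      unfolding inv_sub_def cv.subspace_def
    proof (intro conjI ballI allI CollectI; (elim CollectE)?)
      show "(0, 0) \<in> G" using G(3) by (simp add: zero_prod_def)
      show "(0, x + y) \<in> G" if "(0, x) \<in> G" "(0, y) \<in> G" for x y using G(4)[OF that] by simp
      show "(0, c *c x) \<in> G" if "(0, x) \<in> G" for c x using G(6)[OF that, of c] by simp
      show "(0, F' p q x) \<in> G" if "p \<in> index_set k" "q \<in> index_set k" "(0, x) \<in> G" for p q x
        using G(2)[OF that] clin_zero[OF f.F_clin[OF that(1,2)]] by (simp add: P_def)
    qed
    moreover have "?Y \<subseteq> N'" using sub by auto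
    ultimately have "?Y = N'" using h'(6) that \<open>y \<noteq> 0\<close> by blast
    then have z: "(0, v') \<in> G" using h'(2) by blast
    have "\<exists>c. (0, v') = c *c (v, v')"
      by (rule top[OF z]) (simp add: hop clin_zero[OF f.hop_clin] g.hop_has_wt[OF h'(5)])
    then show False using h(3) h'(3) by (metis cscale_Pair cv.scale_eq_0_iff prod.inject)
  qed
  have X0: "x = 0" if "(x, 0) \<in> G" for x
  proof (rule ccontr)
    assume "x \<noteq> 0"
    let ?X = "{x. (x, 0) \<in> G}"
    have "inv_sub k F ?X"
      unfolding inv_sub_def cv.subspace_def
    proof (intro conjI ballI allI CollectI; (elim CollectE)?)
      show "(0, 0) \<in> G" using G(3) by (simp add: zero_prod_def)
      show "(x + y, 0) \<in> G" if "(x, 0) \<in> G" "(y, 0) \<in> G" for x y using G(4)[OF that] by simp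
      show "(c *c x, 0) \<in> G" if "(x, 0) \<in> G" for c x using G(6)[OF that, of c] by simp
      show "(F p q x, 0) \<in> G" if "p \<in> index_set k" "q \<in> index_set k" "(x, 0) \<in> G" for p q x
        using G(2)[OF that] clin_zero[OF g.F_clin[OF that(1,2)]] by (simp add: P_def)
    qed
    moreover have "?X \<subseteq> N" using sub by auto
    ultimately have "?X = N" using h(6) that \<open>x \<noteq> 0\<close> by blast
    then have z: "(v, 0) \<in> G" using h(2) by blast
    have "\<exists>c. (v, 0) = c *c (v, v')"
      by (rule top[OF z]) (simp add: hop clin_zero[OF g.hop_clin] f.hop_has_wt[OF h(5)])
    then show False using h(3) h'(3) by (metis cscale_Pair cv.scale_eq_0_iff prod.inject)
  qed
  have fstG: "fst ` G = N"
  proof (rule h(6))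
    show "inv_sub k F (fst ` G)"
      unfolding inv_sub_def cv.subspace_def
    proof (intro conjI ballI allI; (elim imageE)?; clarify?)
      show "0 \<in> fst ` G" using G(3) by (force simp: zero_prod_def)
      show "fst a + fst b \<in> fst ` G" if "a \<in> G" "b \<in> G" for a b using G(4)[OF that] by force
      show "c *c fst a \<in> fst ` G" if "a \<in> G" for a c using G(6)[OF that, of c] by (force simp: cscale_prod_def)
      show "F p q (fst a) \<in> fst ` G" if "p \<in> index_set k" "q \<in> index_set k" "a \<in> G" for p q a
        using G(2)[OF that] by (force simp: P_def)
    qed
    show "fst ` G \<subseteq> N" using sub by auto
    show "v \<in> fst ` G" using vG by force
  qed (rule h(3))
  have sndG: "snd ` G = N'"
  proof (rule h'(6))
    show "inv_sub k F' (snd ` G)"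
      unfolding inv_sub_def cv.subspace_def
    proof (intro conjI ballI allI; (elim imageE)?; clarify?)
      show "0 \<in> snd ` G" using G(3) by (force simp: zero_prod_def)
      show "snd a + snd b \<in> snd ` G" if "a \<in> G" "b \<in> G" for a b using G(4)[OF that] by force
      show "c *c snd a \<in> snd ` G" if "a \<in> G" for a c using G(6)[OF that, of c] by (force simp: cscale_prod_def)
      show "F' p q (snd a) \<in> snd ` G" if "p \<in> index_set k" "q \<in> index_set k" "a \<in> G" for p q a
        using G(2)[OF that] by (force simp: P_def)
    qed
    show "snd ` G \<subseteq> N'" using sub by auto
    show "v' \<in> snd ` G" using vG by force
  qed (rule h'(3))
  define T where "T x = (THE y. (x, y) \<in> G)" for x
  have uni: "y = y'" if "(x, y) \<in> G" "(x, y') \<in> G" for x y y'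
    using Y0[of "y - y'"] G(5)[OF that] by simp
  have T: "T x = y" if "(x, y) \<in> G" for x y
    unfolding T_def using that uni by blast
  have TG: "(x, T x) \<in> G" if "x \<in> N" for x
    using that fstG T by force
  have "hom_on k F F' N T"
    unfolding hom_on_def
  proof (intro conjI ballI allI)
    show "T (x + y) = T x + T y" if "x \<in> N" "y \<in> N" for x y
      using T G(4)[OF TG[OF that(1)] TG[OF that(2)]] by simp
    show "T (c *c x) = c *c T x" if "x \<in> N" for x c
      using T G(6)[OF TG[OF that], of c] by simp
    show "T (F p q x) = F' p q (T x)" if "p \<in> index_set k" "q \<in> index_set k" "x \<in> N" for p q x
      using T G(2)[OF that(1,2) TG[OF that(3)]] by (simp add: P_def)
  qed
  moreover have "bij_betw T N N'"
    unfolding bij_betw_def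
  proof
    show "inj_on T N"
    proof (rule inj_onI)
      fix x y assume "x \<in> N" "y \<in> N" "T x = T y"
      then have "(x - y, 0) \<in> G" using G(5)[OF TG TG, of x y] by simp
      then show "x = y" using X0 by fastforce
    qed
    show "T ` N = N'"
    proof
      show "T ` N \<subseteq> N'" using TG sub by auto
      show "N' \<subseteq> T ` N"
      proof
        fix y assume "y \<in> N'"
        then obtain x where "(x, y) \<in> G" using sndG by force
        then show "y \<in> T ` N" using T sub by force
      qed
    qed
  qed
  ultimately show ?thesis using T[OF vG] by blast
qed

section \<open>Clifford generators and the spinor action\<close>

definition nsign :: "nat \<Rightarrow> nat set \<Rightarrow> complex" where
  "nsign i J = (- 1) ^ card {j \<in> J. j < i}"

lemma nsign_insert: "m \<notin> J \<Longrightarrow> nsign i (insert m J) = (if m < i then - nsign i J else nsign i J)"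
proof -
  assume m: "m \<notin> J"
  have "{j \<in> insert m J. j < i} = (if m < i then insert m {j \<in> J. j < i} else {j \<in> J. j < i})" by auto
  moreover have "finite {j \<in> J. j < i}" by (rule finite_subset[of _ "{..<i}"]) auto
  ultimately show ?thesis using m by (simp add: nsign_def)
qed

lemma nsign_remove: "m \<in> J \<Longrightarrow> nsign i (J - {m}) = (if m < i then - nsign i J else nsign i J)"
  using nsign_insert[of m "J - {m}" i] by (auto simp: insert_absorb split: if_splits)

lemma nsign_sq [simp]: "nsign i J * nsign i J = 1"
  by (simp add: nsign_def flip: power_mult_distrib)

text \<open>\<open>cliff p\<close> is exterior multiplication by the basis vector with index \<open>\<bar>p\<bar>\<close> if \<open>p < 0\<close>,
  and contraction if \<open>p > 0\<close>.\<close>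

definition cliff :: "int \<Rightarrow> (nat set \<Rightarrow> 'v::complex_space) \<Rightarrow> nat set \<Rightarrow> 'v" where
  "cliff p \<phi> = (\<lambda>J. let i = nat \<bar>p\<bar> in
     if p < 0 then (if i \<in> J then nsign i J *c \<phi> (J - {i}) else 0)
     else (if i \<in> J then 0 else nsign i J *c \<phi> (insert i J)))"

lemma cliff_clin: "clin (cliff p)"
  by (auto simp: clin_def cliff_def Let_def fun_eq_iff cscale_right_distrib mult.commute)

lemma cliff_neg: "0 < i \<Longrightarrow> cliff (- int i) \<phi> = (\<lambda>J. if i \<in> J then nsign i J *c \<phi> (J - {i}) else 0)"
  by (simp add: cliff_def)

lemma cliff_pos: "0 < i \<Longrightarrow> cliff (int i) \<phi> = (\<lambda>J. if i \<in> J then 0 else nsign i J *c \<phi> (insert i J))"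
  by (simp add: cliff_def)

lemma signed_int_cases:
  assumes "(p::int) \<noteq> 0"
  obtains i where "0 < i" "p = - int i" | i where "0 < i" "p = int i"
  using assms that(1)[of "nat (- p)"] that(2)[of "nat p"] by (cases "p < 0") auto

text \<open>The Clifford relations, with \<open>p\<close> paired to \<open>- p\<close>. For two
  different positions only the sign of the larger one depends on whether the smaller one is present,
  so reversing the order changes exactly one sign.\<close>

lemma cliff_anticomm:
  assumes "p \<noteq> 0" "q \<noteq> 0"
  shows "cliff p (cliff q \<phi>) = delta p (- q) *c \<phi> - cliff q (cliff p \<phi>)"
proof -
  have s: "insert a (insert b J) = insert b (insert a J)" "J - {a} - {b} = J - {b} - {a}" for a b :: nat and J
    by auto
  have s2: "insert b (J - {a}) = insert b J - {a}" if "a \<noteq> b" for a b :: nat and J using that by auto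
  have s3: "insert a J - {a} = J" if "a \<notin> J" for a :: nat and J using that by auto
  note r = fun_eq_iff cliff_neg cliff_pos nsign_insert nsign_remove insert_absorb mult.commute delta_def
  from assms(1) show ?thesis
  proof (cases rule: signed_int_cases)
    case p: (1 i)
    from assms(2) show ?thesis
    proof (cases rule: signed_int_cases)
      case (1 m)
      then show ?thesis using p s(2)[of _ i m] by (cases i m rule: linorder_cases) (auto simp: r)
    next
      case (2 m)
      then show ?thesis using p s2[of i m] s3[of i] by (cases i m rule: linorder_cases) (auto simp: r)
    qed
  next
    case p: (2 i)
    from assms(2) show ?thesis
    proof (cases rule: signed_int_cases)
      case (1 m)
      then show ?thesis using p s2[of m i] s3[of i] by (cases i m rule: linorder_cases) (auto simp: r)
    next
      case (2 m)
      then show ?thesis using p s(1)[of i m] by (cases i m rule: linorder_cases) (auto simp: r)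
    qed
  qed
qed

text \<open>Half the commutator of two generators is the standard embedding of the orthogonal Lie
  algebra into the Clifford algebra. Antisymmetrising gives \<open>F_skew\<close> at once and the
  weights \<open>1/2\<close> and \<open>- 1/2\<close> on the diagonal.\<close>

definition spin :: "int \<Rightarrow> int \<Rightarrow> (nat set \<Rightarrow> 'v::complex_space) \<Rightarrow> nat set \<Rightarrow> 'v" where
  "spin p q \<phi> = (1/2) *c (cliff p (cliff (- q) \<phi>) - cliff (- q) (cliff p \<phi>))"

lemma spin_eq:
  assumes "p \<noteq> 0" "q \<noteq> 0"
  shows "spin p q \<phi> = cliff p (cliff (- q) \<phi>) - (delta p q / 2) *c \<phi>"
proof -
  have "cliff (- q) (cliff p \<phi>) = delta p q *c \<phi> - cliff p (cliff (- q) \<phi>)"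
    using cliff_anticomm[of "- q" p \<phi>] assms by (auto simp: delta_def)
  then have "spin p q \<phi> = (1/2) *c (2 *c cliff p (cliff (- q) \<phi>) - delta p q *c \<phi>)"
    by (simp add: spin_def cscale_two)
  then show ?thesis by (simp add: cv.scale_right_diff_distrib)
qed

lemma spin_clin: "clin (spin p q)"
  unfolding clin_def spin_def
  by (simp add: clin_add[OF cliff_clin] clin_scale[OF cliff_clin] cscale_right_distrib cv.scale_right_diff_distrib
      mult.commute)

text \<open>Up to central scalars this is the commutator of two products of two generators. Moving
  one pair past the other takes four exchanges; each costs one delta and yields one of the four
  terms.\<close>

lemma spin_comm:
  assumes "p \<noteq> 0" "q \<noteq> 0" "r \<noteq> 0" "s \<noteq> 0"
  shows "spin p q (spin r s \<phi>) - spin r s (spin p q \<phi>) =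
    delta q r *c spin p s \<phi> - delta p s *c spin r q \<phi>
    - delta (- p) r *c spin (- q) s \<phi> + delta (- q) s *c spin r (- p) \<phi>"
proof -
  note L = clin_simps[OF cliff_clin]
  let ?c = cliff
  have 1: "?c (- q) (?c r (?c (- s) \<phi>)) = delta q r *c ?c (- s) \<phi> - ?c r (?c (- q) (?c (- s) \<phi>))"
    using cliff_anticomm[of "- q" r "?c (- s) \<phi>"] assms by (simp add: delta_def)
  have 2: "?c p (?c r (?c (- q) (?c (- s) \<phi>))) =
      delta (- p) r *c ?c (- q) (?c (- s) \<phi>) - ?c r (?c p (?c (- q) (?c (- s) \<phi>)))"
    using cliff_anticomm[of p r "?c (- q) (?c (- s) \<phi>)"] assms by (auto simp: delta_def)
  have 3: "?c (- q) (?c (- s) \<phi>) = delta (- q) s *c \<phi> - ?c (- s) (?c (- q) \<phi>)"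
    using cliff_anticomm[of "- q" "- s" \<phi>] assms by (auto simp: delta_def)
  have 4: "?c p (?c (- s) (?c (- q) \<phi>)) = delta p s *c ?c (- q) \<phi> - ?c (- s) (?c p (?c (- q) \<phi>))"
    using cliff_anticomm[of p "- s" "?c (- q) \<phi>"] assms by (auto simp: delta_def)
  have 5: "?c r (?c p (?c (- q) (?c (- s) \<phi>))) = delta (- q) s *c ?c r (?c p \<phi>)
      - (delta p s *c ?c r (?c (- q) \<phi>) - ?c r (?c (- s) (?c p (?c (- q) \<phi>))))"
    unfolding 3 L 4 ..
  have 6: "?c p (?c (- q) (?c r (?c (- s) \<phi>))) - ?c r (?c (- s) (?c p (?c (- q) \<phi>))) =
    delta q r *c ?c p (?c (- s) \<phi>) - delta p s *c ?c r (?c (- q) \<phi>)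
    - delta (- p) r *c ?c (- q) (?c (- s) \<phi>) + delta (- q) s *c ?c r (?c p \<phi>)"
    unfolding 1 L 2 5 by simp
  have e: "spin p q (spin r s \<phi>) - spin r s (spin p q \<phi>) =
    ?c p (?c (- q) (?c r (?c (- s) \<phi>))) - ?c r (?c (- s) (?c p (?c (- q) \<phi>)))"
    using assms by (simp add: spin_eq L algebra_simps)
  show ?thesis unfolding e 6 using assms
    by (simp add: spin_eq) (auto simp: delta_def algebra_simps)
qed

lemma spin_skew: "spin (- q) (- p) \<phi> = - spin p q \<phi>"
  by (simp add: spin_def flip: cv.scale_minus_right)

text \<open>Dominance as natural-number pairings with the positive roots. In this form it passes to
  smaller \<open>k\<close>, and for \<open>k \<le> 1\<close>, where there are no roots, it is
  vacuous. The agreement with the entrywise definition is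
  \<open>dominant_weights_iff\<close>.\<close>

definition dominant :: "nat \<Rightarrow> (nat \<Rightarrow> real) \<Rightarrow> bool" where
  "dominant k l \<longleftrightarrow> (\<forall>i j. 1 \<le> i \<longrightarrow> i < j \<longrightarrow> j \<le> k \<longrightarrow> l j - l i \<in> \<nat> \<and> l j + l i \<in> \<nat>)"

lemma dominant_mono: "dominant l \<kappa> \<Longrightarrow> k \<le> l \<Longrightarrow> dominant k \<kappa>"
  by (auto simp: dominant_def)

lemma strictly_dom_shift:
  assumes "dominant k l"
  shows "strictly_dom k (\<lambda>i. l i + (real i - 1))"
  unfolding strictly_dom_def
proof (intro allI impI)
  fix i j :: nat assume ij: "1 \<le> i" "i < j" "j \<le> k"
  then have "l j - l i \<in> \<nat>" "l j + l i \<in> \<nat>" using assms by (auto simp: dominant_def)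
  then obtain a b where ab: "l j - l i = real a" "l j + l i = real b" by (auto elim!: Nats_cases)
  \<comment> \<open>As \<open>1 \<le> i < j\<close>, the contribution \<open>i + j - 2\<close> of
    \<rho> is at least 1, so the natural subtraction in \<open>i + j - 3\<close> is exact.\<close>
  have "l j + (real j - 1) - (l i + (real i - 1)) = real (Suc (a + (j - i - 1)))"
    "l j + (real j - 1) + (l i + (real i - 1)) = real (Suc (b + (i + j - 3)))"
    using ab ij by (auto simp: of_nat_diff)
  then show "(\<exists>m. l j + (real j - 1) - (l i + (real i - 1)) = real (Suc m)) \<and>
    (\<exists>m. l j + (real j - 1) + (l i + (real i - 1)) = real (Suc m))" by blast
qed

definition spin_wt :: "nat set \<Rightarrow> nat \<Rightarrow> real" where
  "spin_wt J i = (if i \<in> J then 1/2 else - 1/2)"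

definition deg :: "nat \<Rightarrow> (nat \<Rightarrow> real) \<Rightarrow> nat set \<Rightarrow> real" where
  "deg k r J = (\<Sum>i\<in>{1..k}. r i * spin_wt J i)"

lemma spin_wt_inj:
  assumes "J \<subseteq> {1..k}" "K \<subseteq> {1..k}" "\<And>i. i \<in> {1..k} \<Longrightarrow> spin_wt J i = spin_wt K i"
  shows "J = K"
proof -
  have "i \<in> J \<longleftrightarrow> i \<in> K" if "i \<in> {1..k}" for i
    using assms(3)[OF that] by (auto simp: spin_wt_def split: if_splits)
  then show ?thesis using assms(1,2) by blast
qed

lemma deg_insert:
  assumes "i \<in> {1..k}" "i \<notin> J"
  shows "deg k r (insert i J) = deg k r J + r i"
proof -
  have "deg k r (insert i J) - deg k r J = (\<Sum>j\<in>{1..k}. if j = i then r i else 0)"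
    unfolding deg_def sum_subtractf[symmetric] using assms(2)
    by (intro sum.cong) (auto simp: spin_wt_def)
  then show ?thesis using assms(1) by simp
qed

lemma deg_remove:
  assumes "i \<in> {1..k}" "i \<in> J"
  shows "deg k r (J - {i}) = deg k r J - r i"
  using deg_insert[OF assms(1), of "J - {i}" r] assms(2) by (simp add: insert_absorb)

text \<open>The tensor u \<otimes> e_J: an element of the tensor product is stored as the family of
  its coefficients at the basis vectors e_J.\<close>

definition pure :: "'v::complex_space \<Rightarrow> nat set \<Rightarrow> nat set \<Rightarrow> 'v" where
  "pure u J = (\<lambda>K. if K = J then u else 0)"

lemma pure_clin: "clin (\<lambda>u. pure u J)"
  by (auto simp: clin_def pure_def fun_eq_iff)

text \<open>The scalar and \<open>K\<close> are uniform in \<open>u\<close>. If the generator kills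
  e_J, the scalar is 0 and \<open>K\<close> is a dummy, hence the disjunction about degrees.\<close>

lemma cliff_pure:
  assumes "p \<in> index_set k" "J \<subseteq> {1..k}"
  shows "\<exists>K\<subseteq>{1..k}. \<exists>c. (\<forall>u::'v::complex_space. cliff p (pure u J) = c *c pure u K) \<and>
    (c = 0 \<or> deg k r K = deg k r J + odd_ext r p)"
  using assms(1)
proof (cases rule: index_set_cases)
  case (1 i)
  show ?thesis
  proof (cases "i \<in> J")
    case True
    have "cliff p (pure u J) = 0 *c pure u J" for u :: 'v
      using 1 True by (auto simp: fun_eq_iff cliff_neg pure_def)
    then show ?thesis using assms(2) by blast
  next
    case False
    have *: "cliff p (pure u J) = nsign i J *c pure u (insert i J)" for u :: 'v
      using 1 False by (auto simp: fun_eq_iff cliff_neg pure_def nsign_insert)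
    show ?thesis
      by (intro exI[of _ "insert i J"] conjI exI[of _ "nsign i J"] allI * disjI2)
        (use assms(2) 1 False in \<open>auto simp: deg_insert\<close>)
  qed
next
  case (2 i)
  show ?thesis
  proof (cases "i \<in> J")
    case False
    have "cliff p (pure u J) = 0 *c pure u J" for u :: 'v
      using 2 False by (auto simp: fun_eq_iff cliff_pos pure_def)
    then show ?thesis using assms(2) by blast
  next
    case True
    have *: "cliff p (pure u J) = nsign i J *c pure u (J - {i})" for u :: 'v
      using 2 True by (auto simp: fun_eq_iff cliff_pos pure_def nsign_remove nsign_insert)
    show ?thesis
      by (intro exI[of _ "J - {i}"] conjI exI[of _ "nsign i J"] allI * disjI2)
        (use assms(2) 2 True in \<open>auto simp: deg_remove\<close>)
  qed
qed

text \<open>The transposed view: the coefficient at \<open>J\<close> of the image comes from a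
  single coefficient of \<open>\<phi>\<close>, with the degree shifted in the opposite direction. It
  serves to examine extreme coefficients of a vector.\<close>

lemma cliff_at:
  assumes "p \<in> index_set k" "J \<subseteq> {1..k}"
  shows "\<exists>K\<subseteq>{1..k}. \<exists>c. (\<forall>\<phi>::nat set \<Rightarrow> 'v::complex_space. cliff p \<phi> J = c *c \<phi> K) \<and>
    (c = 0 \<or> deg k r K = deg k r J - odd_ext r p)"
  using assms(1)
proof (cases rule: index_set_cases)
  case (1 i)
  show ?thesis
  proof (cases "i \<in> J")
    case False
    have "cliff p \<phi> J = 0 *c \<phi> J" for \<phi> :: "nat set \<Rightarrow> 'v"
      using 1 False by (auto simp: cliff_neg)
    then show ?thesis using assms(2) by blast
  next
    case True
    have *: "cliff p \<phi> J = nsign i J *c \<phi> (J - {i})" for \<phi> :: "nat set \<Rightarrow> 'v"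
      using 1 True by (auto simp: cliff_neg)
    show ?thesis
      by (intro exI[of _ "J - {i}"] conjI exI[of _ "nsign i J"] allI * disjI2)
        (use assms(2) 1 True in \<open>auto simp: deg_remove\<close>)
  qed
next
  case (2 i)
  show ?thesis
  proof (cases "i \<in> J")
    case True
    have "cliff p \<phi> J = 0 *c \<phi> J" for \<phi> :: "nat set \<Rightarrow> 'v"
      using 2 True by (auto simp: cliff_pos)
    then show ?thesis using assms(2) by blast
  next
    case False
    have *: "cliff p \<phi> J = nsign i J *c \<phi> (insert i J)" for \<phi> :: "nat set \<Rightarrow> 'v"
      using 2 False by (auto simp: cliff_pos)
    show ?thesis
      by (intro exI[of _ "insert i J"] conjI exI[of _ "nsign i J"] allI * disjI2)
        (use assms(2) 2 False in \<open>auto simp: deg_insert\<close>)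
  qed
qed

lemma index_set_nonzero: "p \<in> index_set k \<Longrightarrow> p \<noteq> 0"
  by (simp add: index_set_def)

lemma spin_off_diag:
  "p \<in> index_set k \<Longrightarrow> q \<in> index_set k \<Longrightarrow> p \<noteq> q \<Longrightarrow> spin p q \<phi> = cliff p (cliff (- q) \<phi>)"
  by (simp add: spin_eq index_set_nonzero delta_def)

lemma spin_pure:
  assumes p: "p \<in> index_set k" and q: "q \<in> index_set k" and "p \<noteq> q" "J \<subseteq> {1..k}"
  shows "\<exists>K\<subseteq>{1..k}. \<exists>c. (\<forall>u::'v::complex_space. spin p q (pure u J) = c *c pure u K) \<and>
    (c = 0 \<or> deg k r K = deg k r J + (odd_ext r p - odd_ext r q))"
proof -
  obtain K c where K: "K \<subseteq> {1..k}" "\<And>u::'v. cliff (- q) (pure u J) = c *c pure u K"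
    "c = 0 \<or> deg k r K = deg k r J - odd_ext r q"
    using cliff_pure[of "- q" k J r, where 'v = 'v] q assms(4) by (auto simp: odd_ext_uminus[OF q])
  obtain L b where L: "L \<subseteq> {1..k}" "\<And>u::'v. cliff p (pure u K) = b *c pure u L"
    "b = 0 \<or> deg k r L = deg k r K + odd_ext r p"
    using cliff_pure[OF p K(1), of r, where 'v = 'v] by auto
  have "spin p q (pure u J) = (b * c) *c pure u L" for u :: 'v
    by (simp add: spin_off_diag[OF p q assms(3)] K(2) L(2) clin_scale[OF cliff_clin] mult.commute)
  moreover have "b * c = 0 \<or> deg k r L = deg k r J + (odd_ext r p - odd_ext r q)"
    using K(3) L(3) by auto
  ultimately show ?thesis using L(1) by blast
qed

lemma spin_at:
  assumes p: "p \<in> index_set k" and q: "q \<in> index_set k" and "p \<noteq> q" "J \<subseteq> {1..k}"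
  shows "\<exists>K\<subseteq>{1..k}. \<exists>c. (\<forall>\<phi>::nat set \<Rightarrow> 'v::complex_space. spin p q \<phi> J = c *c \<phi> K) \<and>
    (c = 0 \<or> deg k r K = deg k r J - (odd_ext r p - odd_ext r q))"
proof -
  obtain K c where K: "K \<subseteq> {1..k}" "\<And>\<phi>::nat set \<Rightarrow> 'v. cliff p \<phi> J = c *c \<phi> K"
    "c = 0 \<or> deg k r K = deg k r J - odd_ext r p"
    using cliff_at[OF p assms(4), of r, where 'v = 'v] by auto
  obtain L b where L: "L \<subseteq> {1..k}" "\<And>\<phi>::nat set \<Rightarrow> 'v. cliff (- q) \<phi> K = b *c \<phi> L"
    "b = 0 \<or> deg k r L = deg k r K + odd_ext r q"
    using cliff_at[of "- q" k K r, where 'v = 'v] q K(1) by (auto simp: odd_ext_uminus[OF q])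
  have "spin p q \<phi> J = (c * b) *c \<phi> L" for \<phi> :: "nat set \<Rightarrow> 'v"
    by (simp add: spin_off_diag[OF p q assms(3)] K(2) L(2))
  moreover have "c * b = 0 \<or> deg k r L = deg k r J - (odd_ext r p - odd_ext r q)"
    using K(3) L(3) by auto
  ultimately show ?thesis using L(1) by blast
qed

lemma spin_diag:
  assumes "0 < i"
  shows "spin (- int i) (- int i) \<phi> J = complex_of_real (spin_wt J i) *c \<phi> J"
proof -
  have "u - (1 / 2) *c u = (1 / 2) *c u" for u :: 'a
    using cv.scale_left_diff_distrib[of 1 "1 / 2" u] by simp
  then show ?thesis using assms
    by (auto simp: spin_eq cliff_neg cliff_pos delta_def spin_wt_def nsign_insert nsign_remove insert_absorb)
qed

section \<open>The tensor product with the spinor module\<close>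

definition tens :: "(int \<Rightarrow> int \<Rightarrow> 'v::complex_space \<Rightarrow> 'v) \<Rightarrow> int \<Rightarrow> int \<Rightarrow> (nat set \<Rightarrow> 'v) \<Rightarrow> nat set \<Rightarrow> 'v" where
  "tens F p q \<phi> = (\<lambda>J. F p q (\<phi> J)) + spin p q \<phi>"

text \<open>The function type has coefficients at arbitrary sets of naturals; the second condition
  discards those that index no basis vector of the spinor module.\<close>

definition tsp :: "nat \<Rightarrow> 'v::complex_space set \<Rightarrow> (nat set \<Rightarrow> 'v) set" where
  "tsp k N = {\<phi>. (\<forall>J. \<phi> J \<in> N) \<and> (\<forall>J. \<not> J \<subseteq> {1..k} \<longrightarrow> \<phi> J = 0)}"

text \<open>Clifford generators permute coefficients up to sign or drop them, so linear maps on
  coefficients commute with them. This says that operators on the two tensor factors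
  commute.\<close>

lemma cliff_pointwise: "clin f \<Longrightarrow> (\<lambda>J. f (cliff p \<phi> J)) = cliff p (\<lambda>J. f (\<phi> J))"
  by (auto simp: fun_eq_iff cliff_def Let_def clin_zero clin_scale)

lemma spin_pointwise: "clin f \<Longrightarrow> (\<lambda>J. f (spin p q \<phi> J)) = spin p q (\<lambda>J. f (\<phi> J))"
  unfolding spin_def by (simp add: clin_scale clin_diff fun_eq_iff flip: cliff_pointwise[of f])

lemma so_rep_tens:
  assumes "so_rep k F"
  shows "so_rep k (tens F)"
proof -
  interpret so_rep k F by fact
  show ?thesis
  proof
    show "clin (tens F p q)" if "p \<in> index_set k" "q \<in> index_set k" for p q
      using F_clin[OF that] spin_clin[of p q]
      by (auto simp: clin_def tens_def fun_eq_iff cscale_right_distrib add_ac)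
    show "tens F (- q) (- p) u = - tens F p q u" if "p \<in> index_set k" "q \<in> index_set k" for p q u
      using F_skew[OF that] by (simp add: tens_def spin_skew[of q p] fun_eq_iff)
    fix p q r s u
    assume i: "p \<in> index_set k" "q \<in> index_set k" "r \<in> index_set k" "s \<in> index_set k"
    \<comment> \<open>The two mixed terms are symmetric under exchanging the operators and drop out
      of the commutator.\<close>
    have e: "tens F a b (tens F c d u) = (\<lambda>J. F a b (F c d (u J))) + spin c d (\<lambda>J. F a b (u J))
        + spin a b (\<lambda>J. F c d (u J)) + spin a b (spin c d u)"
      if "a \<in> index_set k" "b \<in> index_set k" for a b c d
    proof -
      have "(\<lambda>J. F a b (F c d (u J) + spin c d u J)) = (\<lambda>J. F a b (F c d (u J))) + (\<lambda>J. F a b (spin c d u J))"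
        using F_clin[OF that] by (simp add: fun_eq_iff clin_add)
      then show ?thesis
        using spin_pointwise[OF F_clin[OF that], of c d u] clin_add[OF spin_clin, of a b "\<lambda>J. F c d (u J)" "spin c d u"]
        by (simp add: tens_def plus_fun_def fun_eq_iff add_ac)
    qed
    have "tens F p q (tens F r s u) - tens F r s (tens F p q u) =
      (\<lambda>J. F p q (F r s (u J)) - F r s (F p q (u J))) + (spin p q (spin r s u) - spin r s (spin p q u))"
      unfolding e[OF i(1,2)] e[OF i(3,4)] by (simp add: fun_eq_iff)
    also have "\<dots> = delta q r *c tens F p s u - delta p s *c tens F r q u
        - delta (- p) r *c tens F (- q) s u + delta (- q) s *c tens F r (- p) u"
      unfolding spin_comm[OF i[THEN index_set_nonzero]] F_comm[OF i]
      by (simp add: fun_eq_iff tens_def cscale_right_distrib)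
    finally show "tens F p q (tens F r s u) - tens F r s (tens F p q u) =
        delta q r *c tens F p s u - delta p s *c tens F r q u
        - delta (- p) r *c tens F (- q) s u + delta (- q) s *c tens F r (- p) u" .
  qed
qed

lemma tsp_subspace:
  assumes "cv.subspace N"
  shows "cv.subspace (tsp k N)"
  using assms unfolding cv.subspace_def tsp_def by auto

lemma cliff_mem_tsp:
  assumes "cv.subspace N" "p \<in> index_set k" "\<phi> \<in> tsp k N"
  shows "cliff p \<phi> \<in> tsp k N"
  using assms(2)
proof (cases rule: index_set_cases)
  case (1 i)
  have "\<not> J - {i} \<subseteq> {1..k}" if "\<not> J \<subseteq> {1..k}" for J using that 1 by auto
  then show ?thesis using 1 assms(1,3)
    by (auto simp: tsp_def cliff_neg cv.subspace_def)
next
  case (2 i)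
  have "\<not> insert i J \<subseteq> {1..k}" if "\<not> J \<subseteq> {1..k}" for J using that by auto
  then show ?thesis using 2 assms(1,3)
    by (auto simp: tsp_def cliff_pos cv.subspace_def)
qed

lemma inv_sub_tsp:
  assumes "so_rep k F" "inv_sub k F N"
  shows "inv_sub k (tens F) (tsp k N)"
  unfolding inv_sub_def
proof (intro conjI ballI)
  note s = inv_subD(1)[OF assms(2)]
  show t: "cv.subspace (tsp k N)" by (rule tsp_subspace[OF s])
  fix p q \<phi> assume pq: "p \<in> index_set k" "q \<in> index_set k" and \<phi>: "\<phi> \<in> tsp k N"
  have "(\<lambda>J. F p q (\<phi> J)) \<in> tsp k N"
    using \<phi> inv_subD(2)[OF assms(2) pq] clin_zero[OF so_rep.F_clin[OF assms(1) pq]] by (auto simp: tsp_def)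
  moreover have "spin p q \<phi> \<in> tsp k N"
    unfolding spin_def using pq \<phi> s
    by (intro cv.subspace_scale[OF t] cv.subspace_diff[OF t] cliff_mem_tsp) auto
  ultimately show "tens F p q \<phi> \<in> tsp k N"
    unfolding tens_def by (rule cv.subspace_add[OF t])
qed

lemma pure_mem_tsp: "cv.subspace N \<Longrightarrow> u \<in> N \<Longrightarrow> J \<subseteq> {1..k} \<Longrightarrow> pure u J \<in> tsp k N"
  by (auto simp: tsp_def pure_def cv.subspace_def)

lemma tsp_eq_sum_pure:
  assumes "\<phi> \<in> tsp k N"
  shows "\<phi> = (\<Sum>J\<in>Pow {1..k}. pure (\<phi> J) J)"
proof
  fix K
  have "(\<Sum>J\<in>Pow {1..k}. pure (\<phi> J) J) K = (\<Sum>J\<in>Pow {1..k}. if J = K then \<phi> K else 0)"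
    unfolding sum_fun_apply by (intro sum.cong) (auto simp: pure_def)
  also have "\<dots> = \<phi> K" using assms by (auto simp: tsp_def)
  finally show "\<phi> K = (\<Sum>J\<in>Pow {1..k}. pure (\<phi> J) J) K" ..
qed

lemma tens_diag:
  "0 < i \<Longrightarrow> tens F (- int i) (- int i) \<phi> J = F (- int i) (- int i) (\<phi> J) + complex_of_real (spin_wt J i) *c \<phi> J"
  by (simp add: tens_def spin_diag)

lemma has_wt_pure:
  assumes "has_wt k F l v" "so_rep k F"
  shows "has_wt k (tens F) (\<lambda>i. l i + spin_wt J i) (pure v J)"
  unfolding has_wt_def
proof (intro ballI)
  fix i assume i: "i \<in> {1..k}"
  have "F (- int i) (- int i) 0 = 0"
    using clin_zero[OF so_rep.F_diag_clin[OF assms(2) i]] .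
  then show "tens F (- int i) (- int i) (pure v J) = complex_of_real (l i + spin_wt J i) *c pure v J"
    using i assms(1) by (auto simp: fun_eq_iff tens_diag pure_def has_wt_def cscale_left_distrib)
qed

section \<open>Singular vectors in the tensor product\<close>

lemma gens_mono: "A \<subseteq> B \<Longrightarrow> gens k F A \<subseteq> gens k F B"
  by (auto simp: gens_def)

lemma inv_sub_zero:
  assumes "so_rep k F"
  shows "inv_sub k F {0}"
  using clin_zero[OF so_rep.F_clin[OF assms]] by (auto simp: inv_sub_def cv.subspace_def)

lemma inv_sub_kernel:
  assumes "clin f" "\<And>p q u. p \<in> index_set k \<Longrightarrow> q \<in> index_set k \<Longrightarrow> f u = 0 \<Longrightarrow> f (F p q u) = 0"
  shows "inv_sub k F {u. f u = 0}"
  using assms(2) by (auto simp: inv_sub_def cv.subspace_def clin_simps[OF assms(1)])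

lemma (in so_rep) sing_has_wt_lincomb:
  assumes "sing k F u" "sing k F w" "has_wt k F \<kappa> u" "has_wt k F \<kappa> w"
  shows "sing k F (u - c *c w)" "has_wt k F \<kappa> (u - c *c w)"
proof -
  show "sing k F (u - c *c w)"
    using assms(1,2) by (auto simp: sing_def clin_diff[OF F_clin] clin_scale[OF F_clin])
  show "has_wt k F \<kappa> (u - c *c w)"
    using assms(3,4)
    by (auto simp: has_wt_def clin_diff[OF F_diag_clin] clin_scale[OF F_diag_clin]
        cv.scale_right_diff_distrib mult.commute)
qed

section \<open>Casimir polynomials and generating singular vectors\<close>

locale spin_tensor = so_rep k F for k and F :: "int \<Rightarrow> int \<Rightarrow> 'v::complex_space \<Rightarrow> 'v" +
  fixes N :: "'v set" and l :: "nat \<Rightarrow> real" and v :: 'v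
  assumes hw: "hw_irred k F N l v" and dom: "dominant k l"
begin

sublocale t: so_rep k "tens F"
  by (rule so_rep_tens) (rule so_rep_axioms)

text \<open>This is \<lambda> + \<rho>. By \<open>sdom\<close> it pairs to positive integers with
  the positive roots, so it may grade the module through \<open>hop\<close>.\<close>

abbreviation "r \<equiv> (\<lambda>i. l i + (real i - 1))"
abbreviation "G \<equiv> tens F"
abbreviation "V \<equiv> tsp k N"
abbreviation "d \<equiv> deg k r"

lemmas sdom = strictly_dom_shift[OF dom]

lemma inv_V: "inv_sub k G V"
  by (rule inv_sub_tsp[OF so_rep_axioms hw_irredD(1)[OF hw]])

definition W :: "real \<Rightarrow> (nat set \<Rightarrow> 'v) set" where
  "W x = gens k G {pure v K | K. K \<subseteq> {1..k} \<and> x < d K}"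

lemma inv_W: "inv_sub k G (W x)"
  unfolding W_def by (rule inv_sub_gens)

lemma pure_in_W: "K \<subseteq> {1..k} \<Longrightarrow> x < d K \<Longrightarrow> pure v K \<in> W x"
  unfolding W_def by (intro gens_incl) auto

lemma pure_in_V: "K \<subseteq> {1..k} \<Longrightarrow> pure v K \<in> V"
  using hw_irredD(1,2)[OF hw] by (auto intro: pure_mem_tsp dest: inv_subD(1))

lemma wt_pure: "has_wt k G (\<lambda>i. l i + spin_wt J i) (pure v J)"
  by (rule has_wt_pure[OF hw_irredD(5)[OF hw] so_rep_axioms])

text \<open>Since \<open>v\<close> is singular, only the spinor factor is acted upon. The result is
  a multiple of v \<otimes> e_K where, if it is nonzero, \<open>d K - d J\<close> is the pairing of
  \<lambda> + \<rho> with a positive root.\<close>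

lemma raise_pure:
  assumes "J \<subseteq> {1..k}" "p \<in> index_set k" "q \<in> index_set k" "p < q"
  shows "G p q (pure v J) \<in> W (d J)"
proof (cases "q = - p")
  case True
  then show ?thesis using t.F_anti_diag assms(2) inv_subD(3)[OF inv_W] by simp
next
  case False
  obtain m where m: "odd_ext r p - odd_ext r q = real (Suc m)"
    using strictly_domD[OF sdom assms(3,2,4)] False by auto
  have "F p q v = 0" using hw_irredD(4)[OF hw] assms by (auto simp: sing_def)
  then have s: "G p q (pure v J) = spin p q (pure v J)"
    using clin_zero[OF F_clin[OF assms(2,3)]] by (auto simp: tens_def fun_eq_iff pure_def)
  obtain K c where K: "K \<subseteq> {1..k}" "spin p q (pure v J) = c *c pure v K"
    "c = 0 \<or> d K = d J + (odd_ext r p - odd_ext r q)"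
    using spin_pure[OF assms(2,3) _ assms(1), of r, where 'v = 'v] assms(4) by auto
  show ?thesis
  proof (cases "c = 0")
    case True
    then show ?thesis using s K(2) inv_subD(3)[OF inv_W] by simp
  next
    case False
    then have "d J < d K" using K(3) m by simp
    then show ?thesis unfolding s K(2) by (intro inv_subD(6)[OF inv_W] pure_in_W K(1))
  qed
qed

definition c0 :: real where
  "c0 = (\<Sum>i\<in>{1..k}. 2 * l i ^ 2 + 1/2 + 4 * (real i - 1) * l i)"

text \<open>Every entry of a spinor weight has square \<open>1/4\<close>, so the quadratic term
  contributes the constant \<open>1/2\<close> collected in \<open>c0\<close>, and \<open>J\<close>
  enters only through 4 (\<lambda> + \<rho>, \<mu>_J).\<close>

lemma casimir_value:
  "(\<Sum>i\<in>{1..k}. 2 * (l i + spin_wt J i) ^ 2 + 4 * (real i - 1) * (l i + spin_wt J i)) = c0 + 4 * d J"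
proof -
  have "2 * (l i + spin_wt J i) ^ 2 + 4 * (real i - 1) * (l i + spin_wt J i) =
    2 * l i ^ 2 + 1/2 + 4 * (real i - 1) * l i + 4 * (r i * spin_wt J i)" for i
    by (simp add: spin_wt_def power2_eq_square algebra_simps)
  then show ?thesis by (simp add: c0_def deg_def sum.distrib sum_distrib_left)
qed

lemma casimir_pure:
  assumes "J \<subseteq> {1..k}"
  shows "t.casimir (pure v J) - complex_of_real (c0 + 4 * d J) *c pure v J \<in> W (d J)"
  using t.casimir_wt_mod[OF inv_W raise_pure[OF assms] wt_pure] unfolding casimir_value .

text \<open>The polynomial in the Casimir operator with roots \<open>c0 + 4 * y\<close>, one for
  each degree \<open>y\<close> in the list.\<close>

definition cpoly :: "real list \<Rightarrow> (nat set \<Rightarrow> 'v) \<Rightarrow> nat set \<Rightarrow> 'v" where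
  "cpoly ys = foldr (\<lambda>y f \<phi>. t.casimir (f \<phi>) - complex_of_real (c0 + 4 * y) *c f \<phi>) ys (\<lambda>\<phi>. \<phi>)"

lemma cpoly_simps [simp]:
  "cpoly [] \<phi> = \<phi>"
  "cpoly (y # ys) \<phi> = t.casimir (cpoly ys \<phi>) - complex_of_real (c0 + 4 * y) *c cpoly ys \<phi>"
  by (simp_all add: cpoly_def)

lemma cpoly_clin: "clin (cpoly ys)"
proof (induction ys)
  case Nil
  then show ?case by (simp add: clin_def)
next
  case (Cons y ys)
  then show ?case
    by (auto simp: clin_def clin_add[OF t.casimir_clin] clin_scale[OF t.casimir_clin]
        cscale_right_distrib cv.scale_right_diff_distrib mult.commute)
qed

lemma cpoly_mem: "inv_sub k G U \<Longrightarrow> \<phi> \<in> U \<Longrightarrow> cpoly ys \<phi> \<in> U"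
proof (induction ys)
  case (Cons y ys)
  then have "cpoly ys \<phi> \<in> U" by blast
  then show ?case
    unfolding cpoly_simps
    by (intro inv_subD(5)[OF Cons.prems(1)] inv_subD(6)[OF Cons.prems(1)] t.casimir_mem[OF Cons.prems(1)])
qed simp

lemma cpoly_comm:
  assumes "p \<in> index_set k" "q \<in> index_set k"
  shows "cpoly ys (G p q \<phi>) = G p q (cpoly ys \<phi>)"
  by (induction ys)
    (simp_all only: cpoly_simps t.casimir_comm[OF assms] clin_diff[OF t.F_clin[OF assms]] clin_scale[OF t.F_clin[OF assms]])

lemma cpoly_casimir: "cpoly ys (t.casimir \<phi>) = t.casimir (cpoly ys \<phi>)"
  by (induction ys) (simp_all only: cpoly_simps clin_diff[OF t.casimir_clin] clin_scale[OF t.casimir_clin])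

text \<open>Modulo \<open>W (d J)\<close> the Casimir operator acts on v \<otimes> e_J by
  \<open>c0 + 4 * d J\<close>, so each factor contributes \<open>4 * (d J - y)\<close>.\<close>

lemma cpoly_pure:
  assumes "J \<subseteq> {1..k}"
  shows "cpoly ys (pure v J) - complex_of_real (\<Prod>y\<leftarrow>ys. 4 * (d J - y)) *c pure v J \<in> W (d J)"
proof (induction ys)
  case Nil
  have "cpoly [] (pure v J) - complex_of_real (\<Prod>y\<leftarrow>[]. 4 * (d J - y)) *c pure v J = 0"
    by (simp only: cpoly_simps) simp
  then show ?case using inv_subD(3)[OF inv_W] by (simp only:)
next
  case (Cons y ys)
  let ?z = "pure v J" and ?x = "cpoly ys (pure v J)"
  let ?a = "complex_of_real (\<Prod>y\<leftarrow>ys. 4 * (d J - y))"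
  let ?b = "complex_of_real (c0 + 4 * d J)" and ?c = "complex_of_real (c0 + 4 * y)"
  have 1: "t.casimir (?x - ?a *c ?z) - ?c *c (?x - ?a *c ?z) \<in> W (d J)"
    using inv_subD(5)[OF inv_W] inv_subD(6)[OF inv_W] t.casimir_mem[OF inv_W] Cons by blast
  have 2: "?a *c (t.casimir ?z - ?b *c ?z) \<in> W (d J)"
    using casimir_pure[OF assms] inv_subD(6)[OF inv_W] by blast
  have "cpoly (y # ys) ?z - complex_of_real (\<Prod>y\<leftarrow>y # ys. 4 * (d J - y)) *c ?z =
     (t.casimir (?x - ?a *c ?z) - ?c *c (?x - ?a *c ?z)) + ?a *c (t.casimir ?z - ?b *c ?z)"
    unfolding cpoly_simps clin_diff[OF t.casimir_clin] clin_scale[OF t.casimir_clin] cv.scale_right_diff_distrib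
    by (simp add: algebra_simps)
  then show ?case using inv_subD(4)[OF inv_W 1 2] by (simp only:)
qed

lemma finite_degs: "finite {d K | K. K \<subseteq> {1..k}}"
  by simp

text \<open>Let \<open>y\<close> be the smallest degree above \<open>x\<close>. The factor for
  \<open>y\<close> sends generators of degree \<open>y\<close> into \<open>W y\<close>, which the
  list obtained for \<open>y\<close> annihilates; all other generators lie in \<open>W y\<close>
  already. The induction is on the number of degrees above \<open>x\<close>.\<close>

lemma cpoly_kills: "\<exists>ys. (\<forall>y\<in>set ys. x < y) \<and> (\<forall>u\<in>W x. cpoly ys u = 0)"
proof (induction "card {y \<in> {d K | K. K \<subseteq> {1..k}}. x < y}" arbitrary: x rule: less_induct)
  case less
  let ?D = "{y \<in> {d K | K. K \<subseteq> {1..k}}. x < y}"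
  have fin: "finite ?D" using finite_degs by simp
  show ?case
  proof (cases "?D = {}")
    case True
    then have "W x \<subseteq> {0}" unfolding W_def by (intro gens_least inv_sub_zero[OF t.so_rep_axioms]) auto
    then have "\<forall>u\<in>W x. cpoly [] u = 0" by auto
    then show ?thesis by (intro exI[of _ "[]"]) auto
  next
    case False
    define y where "y = Min ?D"
    have y: "y \<in> ?D" unfolding y_def by (rule Min_in[OF fin False])
    have "{y' \<in> {d K | K. K \<subseteq> {1..k}}. y < y'} \<subset> ?D" using y by auto
    then have "card {y' \<in> {d K | K. K \<subseteq> {1..k}}. y < y'} < card ?D"
      by (rule psubset_card_mono[OF fin])
    from less[OF this] obtain ys where ys: "\<forall>y'\<in>set ys. y < y'" "\<And>u. u \<in> W y \<Longrightarrow> cpoly ys u = 0"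
      by blast
    have "inv_sub k G {u. cpoly (y # ys) u = 0}"
      by (rule inv_sub_kernel[OF cpoly_clin]) (simp only: cpoly_comm clin_zero[OF t.F_clin])
    moreover have "cpoly (y # ys) (pure v K) = 0" if K: "K \<subseteq> {1..k}" "x < d K" for K
    proof -
      have "y \<le> d K" unfolding y_def using K by (intro Min_le fin) auto
      then consider "y < d K" | "d K = y" by linarith
      then show ?thesis
      proof cases
        case 1
        then have "cpoly ys (pure v K) = 0" using ys(2) pure_in_W[OF K(1)] by blast
        then show ?thesis using clin_zero[OF t.casimir_clin] by simp
      next
        case 2
        \<comment> \<open>By definition the new factor acts last; as all factors commute it may be
          moved to act first.\<close>
        have "cpoly (y # ys) (pure v K) = cpoly ys (t.casimir (pure v K) - complex_of_real (c0 + 4 * y) *c pure v K)"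
          by (simp add: clin_diff[OF cpoly_clin] clin_scale[OF cpoly_clin] cpoly_casimir)
        then show ?thesis using casimir_pure[OF K(1)] ys(2) 2 by simp
      qed
    qed
    ultimately have "W x \<subseteq> {u. cpoly (y # ys) u = 0}"
      unfolding W_def by (intro gens_least) auto
    then have "\<forall>u\<in>W x. cpoly (y # ys) u = 0" by blast
    moreover have "\<forall>y'\<in>set (y # ys). x < y'" using ys(1) y by auto
    ultimately show ?thesis by blast
  qed
qed

lemma ex_singular:
  assumes "J \<subseteq> {1..k}"
  shows "\<exists>w\<in>V. sing k G w \<and> has_wt k G (\<lambda>i. l i + spin_wt J i) w \<and>
    (\<exists>a. a \<noteq> 0 \<and> w - a *c pure v J \<in> W (d J))"
proof -
  obtain ys where ys: "\<forall>y\<in>set ys. d J < y" "\<And>u. u \<in> W (d J) \<Longrightarrow> cpoly ys u = 0"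
    using cpoly_kills by blast
  let ?w = "cpoly ys (pure v J)"
  have "?w \<in> V" by (rule cpoly_mem[OF inv_V pure_in_V[OF assms]])
  moreover have "sing k G ?w"
    unfolding sing_def using ys(2) raise_pure[OF assms] by (simp flip: cpoly_comm)
  moreover have "has_wt k G (\<lambda>i. l i + spin_wt J i) ?w"
    unfolding has_wt_def
  proof
    fix i assume i: "i \<in> {1..k}"
    then have "- int i \<in> index_set k" by simp
    then have "G (- int i) (- int i) ?w = cpoly ys (G (- int i) (- int i) (pure v J))"
      by (simp only: cpoly_comm)
    also have "\<dots> = complex_of_real (l i + spin_wt J i) *c ?w"
      using wt_pure[of J] i by (simp add: has_wt_def clin_scale[OF cpoly_clin])
    finally show "G (- int i) (- int i) ?w = complex_of_real (l i + spin_wt J i) *c ?w" .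
  qed
  \<comment> \<open>All roots belong to degrees above \<open>d J\<close>, so the coefficient of v
    \<otimes> e_J is nonzero.\<close>
  moreover have "complex_of_real (\<Prod>y\<leftarrow>ys. 4 * (d J - y)) \<noteq> 0"
    using ys(1) by (induction ys) auto
  ultimately show ?thesis using cpoly_pure[OF assms, of ys] by blast
qed

text \<open>\<open>w J\<close> may be 0; the last condition then says that v \<otimes> e_J itself
  lies in \<open>W (d J)\<close>, so generation by the \<open>w J\<close> is unaffected.\<close>

definition w :: "nat set \<Rightarrow> nat set \<Rightarrow> 'v" where
  "w J = (SOME u. u \<in> V \<and> sing k G u \<and> has_wt k G (\<lambda>i. l i + spin_wt J i) u \<and>
    (\<exists>a. a \<noteq> 0 \<and> u - a *c pure v J \<in> W (d J)))"

lemma w: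
  assumes "J \<subseteq> {1..k}"
  shows "w J \<in> V" "sing k G (w J)" "has_wt k G (\<lambda>i. l i + spin_wt J i) (w J)"
    "\<exists>a. a \<noteq> 0 \<and> w J - a *c pure v J \<in> W (d J)"
proof -
  have "\<exists>u. u \<in> V \<and> sing k G u \<and> has_wt k G (\<lambda>i. l i + spin_wt J i) u \<and>
    (\<exists>a. a \<noteq> 0 \<and> u - a *c pure v J \<in> W (d J))" using ex_singular[OF assms] by blast
  from someI_ex[OF this, folded w_def]
  show "w J \<in> V" "sing k G (w J)" "has_wt k G (\<lambda>i. l i + spin_wt J i) (w J)"
    "\<exists>a. a \<noteq> 0 \<and> w J - a *c pure v J \<in> W (d J)" by blast+
qed

text \<open>Descending in degree, v \<otimes> e_J is recovered from \<open>w J\<close> and vectors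
  of higher degree. To pass from \<open>v\<close> to all of \<open>N\<close>, consider the
  \<open>u\<close> in \<open>N\<close> for which every u \<otimes> e_J is generated: they form a
  submodule containing \<open>v\<close>.\<close>

lemma V_eq_gens: "V = gens k G {w J | J. J \<subseteq> {1..k}}"
proof
  let ?U = "gens k G {w J | J. J \<subseteq> {1..k}}"
  have U: "inv_sub k G ?U" by (rule inv_sub_gens)
  show "?U \<subseteq> V" by (intro gens_least inv_V) (auto intro: w(1))
  have pure_U: "pure v J \<in> ?U" if "J \<subseteq> {1..k}" for J
    using that
  proof (induction "card {y \<in> {d K | K. K \<subseteq> {1..k}}. d J < y}" arbitrary: J rule: less_induct)
    case less
    have "W (d J) \<subseteq> ?U"
      unfolding W_def
    proof (intro gens_least U subsetI)
      fix z assume "z \<in> {pure v K |K. K \<subseteq> {1..k} \<and> d J < d K}"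
      then obtain K where K: "z = pure v K" "K \<subseteq> {1..k}" "d J < d K" by blast
      have "{y \<in> {d K | K. K \<subseteq> {1..k}}. d K < y} \<subset> {y \<in> {d K | K. K \<subseteq> {1..k}}. d J < y}"
        using K by auto
      then have "card {y \<in> {d K | K. K \<subseteq> {1..k}}. d K < y} < card {y \<in> {d K | K. K \<subseteq> {1..k}}. d J < y}"
        by (rule psubset_card_mono[rotated]) simp
      then show "z \<in> ?U" using less(1) K by blast
    qed
    moreover obtain a where a: "a \<noteq> 0" "w J - a *c pure v J \<in> W (d J)" using w(4)[OF less(2)] by blast
    moreover have "w J \<in> ?U" using less(2) by (intro gens_incl) auto
    ultimately have "inverse a *c (w J - (w J - a *c pure v J)) \<in> ?U"
      using inv_subD(5)[OF U] inv_subD(6)[OF U] by blast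
    then show ?case using a(1) by simp
  qed
  have "inv_sub k F {u \<in> N. \<forall>J. J \<subseteq> {1..k} \<longrightarrow> pure u J \<in> ?U}" (is "inv_sub k F ?M")
    unfolding inv_sub_def
  proof (intro conjI ballI)
    note s = inv_subD(1)[OF hw_irredD(1)[OF hw]]
    show "cv.subspace ?M"
      using s inv_subD(3)[OF U] inv_subD(4)[OF U] inv_subD(6)[OF U]
      by (auto simp: cv.subspace_def clin_simps[OF pure_clin])
    fix p q u assume pq: "p \<in> index_set k" "q \<in> index_set k" and u: "u \<in> ?M"
    have "pure (F p q u) J \<in> ?U" if J: "J \<subseteq> {1..k}" for J
    proof -
      \<comment> \<open>The Leibniz rule solved for the first factor. The spinor term is a multiple
        of some u \<otimes> e_K, which is why all \<open>J\<close> are treated together.\<close>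
      have "pure (F p q u) J = G p q (pure u J) - spin p q (pure u J)"
        using clin_zero[OF F_clin[OF pq]] by (auto simp: fun_eq_iff tens_def pure_def)
      moreover have "spin p q (pure u J) \<in> ?U"
      proof (cases "p = q")
        case False
        obtain K c where "K \<subseteq> {1..k}" "spin p q (pure u J) = c *c pure u K"
          using spin_pure[OF pq False J, where 'v = 'v] by blast
        then show ?thesis using u inv_subD(6)[OF U] by simp
      next
        case True
        have "\<exists>c. spin p p (pure u J) = c *c pure u J"
        proof -
          have n: "spin (- int i) (- int i) (pure u J) = complex_of_real (spin_wt J i) *c pure u J"
            if "i \<in> {1..k}" for i
            using that by (auto simp: fun_eq_iff spin_diag pure_def)
          from pq(1) show ?thesis
          proof (cases rule: index_set_cases)
            case (1 i)
            then show ?thesis using n[of i] by blast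
          next
            case (2 i)
            have "spin p p (pure u J) = (- complex_of_real (spin_wt J i)) *c pure u J"
              using 2 n[of i] spin_skew[of p p "pure u J"] by simp
            then show ?thesis ..
          qed
        qed
        then show ?thesis using True u J inv_subD(6)[OF U] by auto
      qed
      ultimately show ?thesis using u J inv_subD(5)[OF U] inv_subD(2)[OF U pq] by simp
    qed
    then show "F p q u \<in> ?M" using u inv_subD(2)[OF hw_irredD(1)[OF hw] pq] by simp
  qed
  then have M: "?M = N"
    using hw_irredD(6)[OF hw _ _ _ hw_irredD(3)[OF hw]] hw_irredD(2)[OF hw] pure_U by blast
  show "V \<subseteq> ?U"
  proof
    fix \<phi> assume \<phi>: "\<phi> \<in> V"
    have "pure (\<phi> J) J \<in> ?U" if "J \<in> Pow {1..k}" for J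
    proof -
      have "\<phi> J \<in> ?M" unfolding M using \<phi> by (simp add: tsp_def)
      then show ?thesis using that by blast
    qed
    then have "(\<Sum>J\<in>Pow {1..k}. pure (\<phi> J) J) \<in> ?U" by (rule inv_subD(7)[OF U])
    then show "\<phi> \<in> ?U" using tsp_eq_sum_pure[OF \<phi>] by (simp only:)
  qed
qed

text \<open>Take a nonzero coefficient of least degree. In the coefficient at \<open>J\<close> of
  \<open>G p q \<phi> = 0\<close> the spinor part comes from a smaller degree and vanishes, so
  \<open>\<phi> J\<close> is singular in \<open>N\<close>, hence a multiple of
  \<open>v\<close>.\<close>

lemma sing_lead:
  assumes "\<phi> \<in> V" "sing k G \<phi>" "\<phi> \<noteq> 0"
  shows "\<exists>J\<subseteq>{1..k}. \<exists>a. a \<noteq> 0 \<and> \<phi> J = a *c v"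
proof -
  let ?S = "{J. J \<subseteq> {1..k} \<and> \<phi> J \<noteq> 0}"
  have fin: "finite ?S" by simp
  have "?S \<noteq> {}" using assms(1,3) by (auto simp: tsp_def fun_eq_iff)
  then obtain J where J: "J \<in> ?S" "\<And>K. K \<in> ?S \<Longrightarrow> d J \<le> d K"
    using ex_is_arg_min_if_finite[OF fin, of d] by (auto simp: is_arg_min_linorder)
  have "sing k F (\<phi> J)"
    unfolding sing_def
  proof (intro ballI impI)
    fix p q assume pq: "p \<in> index_set k" "q \<in> index_set k" "p < q"
    show "F p q (\<phi> J) = 0"
    proof (cases "q = - p")
      case True
      then show ?thesis using F_anti_diag pq by simp
    next
      case False
      obtain m where m: "odd_ext r p - odd_ext r q = real (Suc m)"
        using strictly_domD[OF sdom pq(2,1,3)] False by auto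
      have "p \<noteq> q" "J \<subseteq> {1..k}" using pq(3) J(1) by auto
      then obtain K c where K: "K \<subseteq> {1..k}" "spin p q \<phi> J = c *c \<phi> K"
        "c = 0 \<or> d K = d J - (odd_ext r p - odd_ext r q)"
        using spin_at[OF pq(1,2), of J r, where 'v = 'v] by blast
      have "c = 0 \<or> \<phi> K = 0" using J(2)[of K] K m by auto
      then have "spin p q \<phi> J = 0" using K(2) by auto
      moreover have "G p q \<phi> J = 0" using assms(2) pq by (simp add: sing_def)
      ultimately show ?thesis by (simp add: tens_def)
    qed
  qed
  moreover have "\<phi> J \<in> N" using assms(1) by (simp add: tsp_def)
  ultimately obtain a where "\<phi> J = a *c v" using hw_irred_singular[OF hw] by blast
  then show ?thesis using J(1) by auto
qed

lemma sing_wt: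
  assumes "has_wt k G \<kappa> \<phi>" "\<phi> J = a *c v" "a \<noteq> 0" "i \<in> {1..k}"
  shows "\<kappa> i = l i + spin_wt J i"
proof -
  have "complex_of_real (\<kappa> i) *c \<phi> J = G (- int i) (- int i) \<phi> J"
    using assms(1,4) by (simp add: has_wt_def)
  also have "\<dots> = complex_of_real (l i + spin_wt J i) *c \<phi> J"
    using assms(2,4) hw_irredD(5)[OF hw]
    by (simp add: tens_diag has_wt_def clin_scale[OF F_diag_clin] cscale_left_distrib mult.commute algebra_simps)
  finally show ?thesis using assms(2,3) hw_irredD(3)[OF hw] by (simp flip: of_real_add)
qed

text \<open>A singular vector \<open>x\<close> of a nonzero submodule, at depth \<open>m\<close>,
  has a leading coefficient at some \<open>K\<close>, and its degree gives
  \<open>d K = d J - m\<close>. The Casimir operator is the scalar \<open>c0 + 4 * d J\<close> on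
  the whole module but acts on the leading coefficient by \<open>c0 + 4 * d K\<close>. Hence
  \<open>m = 0\<close>, and \<open>x\<close> is a multiple of \<open>\<phi>\<close>.\<close>

lemma gen_irred:
  assumes \<phi>: "\<phi> \<in> V" "sing k G \<phi>" "\<phi> \<noteq> 0" and wt: "has_wt k G (\<lambda>i. l i + spin_wt J i) \<phi>"
  shows "hw_irred k G (gen k G \<phi>) (\<lambda>i. l i + spin_wt J i) \<phi>"
  unfolding hw_irred_def
proof (intro conjI allI impI)
  show "inv_sub k G (gen k G \<phi>)" by (rule inv_sub_gens)
  fix U assume U: "inv_sub k G U" "U \<subseteq> gen k G \<phi>"
  have UV: "gen k G \<phi> \<subseteq> V" by (rule gens_least[OF inv_V]) (use \<phi> in auto)
  show "U = {0} \<or> U = gen k G \<phi>"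
  proof (rule ccontr)
    assume n: "\<not> (U = {0} \<or> U = gen k G \<phi>)"
    then obtain u where u: "u \<in> U" "u \<noteq> 0" using inv_subD(3)[OF U(1)] by blast
    let ?e = "\<Sum>i\<in>{1..k}. r i * (l i + spin_wt J i)"
    obtain x m where x: "x \<in> U" "x \<noteq> 0" "sing k G x"
      "t.hop r x = complex_of_real (?e - real m) *c x"
      using t.inv_sub_singular[OF \<phi>(2) wt sdom U u] by blast
    have xV: "x \<in> V" using x(1) U(2) UV by blast
    obtain K a where K: "K \<subseteq> {1..k}" "a \<noteq> 0" "x K = a *c v" using sing_lead[OF xV x(3,2)] by blast
    have xK: "x K \<noteq> 0" using K hw_irredD(3)[OF hw] by simp
    \<comment> \<open>\<open>x\<close> is not known to be a weight vector, so all eigenvalues are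
      read off in the single coefficient at \<open>K\<close>, a multiple of
      \<open>v\<close>.\<close>
    have diag': "G (- int i) (- int i) y K = complex_of_real (l i + spin_wt K i) *c y K"
      if "i \<in> {1..k}" "y K = b *c v" for i y b
      using that hw_irredD(5)[OF hw]
      by (simp add: tens_diag has_wt_def clin_scale[OF F_diag_clin] cscale_left_distrib algebra_simps)
    note diag = diag'[of _ x, OF _ K(3)]
    have diag2: "G (- int i) (- int i) (G (- int i) (- int i) x) K = complex_of_real ((l i + spin_wt K i)^2) *c x K"
      if i: "i \<in> {1..k}" for i
    proof -
      have "G (- int i) (- int i) x K = (complex_of_real (l i + spin_wt K i) * a) *c v"
        using diag[OF i] K(3) by simp
      from diag'[of i "G (- int i) (- int i) x", OF i this] show ?thesis using diag[OF i] by (simp add: power2_eq_square)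
    qed
    have "complex_of_real (?e - real m) *c x K = t.hop r x K" using x(4) by simp
    also have "\<dots> = complex_of_real (\<Sum>i\<in>{1..k}. r i * (l i + spin_wt K i)) *c x K"
      unfolding t.hop_def sum_fun_apply of_real_sum cv.scale_sum_left
      by (intro sum.cong refl) (simp add: diag)
    finally have e: "?e - real m = (\<Sum>i\<in>{1..k}. r i * (l i + spin_wt K i))"
      using xK by (simp only: cv.scale_cancel_right of_real_eq_iff) simp
    have em: "d J - real m = d K" using e by (simp add: deg_def distrib_left sum.distrib)
    have gen_scalar: "t.casimir y = complex_of_real (c0 + 4 * d J) *c y" if "y \<in> gen k G \<phi>" for y
    proof -
      let ?f = "\<lambda>y. t.casimir y - complex_of_real (c0 + 4 * d J) *c y"
      have "?f = cpoly [d J]" by (rule ext) (simp only: cpoly_simps)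
      then have f: "clin ?f" by (simp only: cpoly_clin)
      have "inv_sub k G {y. ?f y = 0}"
        by (rule inv_sub_kernel[OF f]) (simp add: t.casimir_comm clin_scale[OF t.F_clin])
      moreover have "?f \<phi> = 0"
        using t.casimir_wt_mod[OF inv_sub_zero[OF t.so_rep_axioms] _ wt, unfolded casimir_value] \<phi>(2)
        unfolding sing_def by blast
      ultimately have "gen k G \<phi> \<subseteq> {y. ?f y = 0}" by (intro gens_least) auto
      then show ?thesis using that by auto
    qed
    have "t.casimir x = (\<Sum>i\<in>{1..k}. 2 *c G (- int i) (- int i) (G (- int i) (- int i) x) +
      (4 * (of_nat i - 1)) *c G (- int i) (- int i) x)"
      using t.casimir_mod[OF inv_sub_zero[OF t.so_rep_axioms], of x] x(3) by (auto simp: sing_def)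
    then have "t.casimir x K = (\<Sum>i\<in>{1..k}. 2 *c G (- int i) (- int i) (G (- int i) (- int i) x) K +
      (4 * (of_nat i - 1)) *c G (- int i) (- int i) x K)" by (simp add: sum_fun_apply)
    also have "\<dots> = complex_of_real (c0 + 4 * d K) *c x K"
      unfolding casimir_value[symmetric] of_real_sum cv.scale_sum_left
      by (intro sum.cong refl) (simp add: diag diag2 flip: cscale_left_distrib)
    finally have "complex_of_real (c0 + 4 * d J) *c x K = complex_of_real (c0 + 4 * d K) *c x K"
      using gen_scalar[of x] x(1) U(2) by auto
    then have "d J = d K" using xK by (simp only: cv.scale_cancel_right of_real_eq_iff) simp
    then have "m = 0" using em by simp
    then obtain c where c: "x = c *c \<phi>"
      using t.gen_top[OF \<phi>(2) wt sdom, of x] x(1,4) U(2) by auto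
    then have "c \<noteq> 0" using x(2) by auto
    then have "\<phi> = inverse c *c x" using c by simp
    then have "\<phi> \<in> U" using inv_subD(6)[OF U(1) x(1)] by simp
    then have "gen k G \<phi> \<subseteq> U" by (intro gens_least[OF U(1)]) auto
    then show False using n U(2) by blast
  qed
qed (use assms in auto)

end

section \<open>Direct sum decomposition by the singular vectors\<close>

context spin_tensor
begin

text \<open>If the summand for \<open>J0\<close> meets the sum \<open>?S\<close> of the others,
  irreducibility puts \<open>w J0\<close> into \<open>?S\<close>. By induction its components there
  are unique, so they inherit singularity and weight from \<open>w J0\<close>. The component for
  \<open>K\<close> is then a multiple of \<open>w K\<close>, whose weight differs from that of
  \<open>w J0\<close>, and must vanish.\<close>

lemma components_independent:
  assumes "finite B" "\<And>J. J \<in> B \<Longrightarrow> J \<subseteq> {1..k} \<and> w J \<noteq> 0" "\<And>J. J \<in> B \<Longrightarrow> f J \<in> gen k G (w J)"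
    "(\<Sum>J\<in>B. f J) = 0" "J \<in> B"
  shows "f J = 0"
  using assms
proof (induction B arbitrary: f J rule: finite_induct)
  case empty
  then show ?case by simp
next
  case (insert J0 B)
  have irr: "hw_irred k G (gen k G (w K)) (\<lambda>i. l i + spin_wt K i) (w K)" if "K \<in> insert J0 B" for K
    using gen_irred w insert.prems(1)[OF that] by blast
  have IH: "g K = 0" if "\<And>K. K \<in> B \<Longrightarrow> g K \<in> gen k G (w K)" "(\<Sum>K\<in>B. g K) = 0" "K \<in> B" for g K
    using insert.IH[of g K] that insert.prems(1) by blast
  have f0: "f J0 = 0"
  proof (rule ccontr)
    assume nz: "f J0 \<noteq> 0"
    let ?S = "{\<Sum>K\<in>B. g K | g. \<forall>K\<in>B. g K \<in> gen k G (w K)}"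
    have gsub: "inv_sub k G (gen k G (w K))" for K by (rule inv_sub_gens)
    have S: "inv_sub k G ?S"
      unfolding inv_sub_def cv.subspace_def
    proof (intro conjI ballI allI)
      have "(\<Sum>K\<in>B. 0) \<in> ?S" using inv_subD(3)[OF gsub] by (intro CollectI exI[of _ "\<lambda>K. 0"]) auto
      then show "0 \<in> ?S" by simp
    next
      fix x y assume "x \<in> ?S" "y \<in> ?S"
      then obtain g h where g: "x = (\<Sum>K\<in>B. g K)" "\<forall>K\<in>B. g K \<in> gen k G (w K)"
        and h: "y = (\<Sum>K\<in>B. h K)" "\<forall>K\<in>B. h K \<in> gen k G (w K)" by blast
      have "x + y = (\<Sum>K\<in>B. g K + h K)" using g h by (simp only: sum.distrib)
      moreover have "\<forall>K\<in>B. g K + h K \<in> gen k G (w K)" using g h inv_subD(4)[OF gsub] by blast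
      ultimately show "x + y \<in> ?S" by (intro CollectI exI[of _ "\<lambda>K. g K + h K"] conjI)
    next
      fix c x assume "x \<in> ?S"
      then obtain g where g: "x = (\<Sum>K\<in>B. g K)" "\<forall>K\<in>B. g K \<in> gen k G (w K)" by blast
      have "c *c x = (\<Sum>K\<in>B. c *c g K)" using g by (simp only: cv.scale_sum_right)
      moreover have "\<forall>K\<in>B. c *c g K \<in> gen k G (w K)" using g inv_subD(6)[OF gsub] by blast
      ultimately show "c *c x \<in> ?S" by (intro CollectI exI[of _ "\<lambda>K. c *c g K"] conjI)
    next
      fix p q x assume pq: "p \<in> index_set k" "q \<in> index_set k" and "x \<in> ?S"
      then obtain g where g: "x = (\<Sum>K\<in>B. g K)" "\<forall>K\<in>B. g K \<in> gen k G (w K)" by blast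
      have "G p q x = (\<Sum>K\<in>B. G p q (g K))" unfolding g(1) clin_sum[OF t.F_clin[OF pq]] ..
      moreover have "\<forall>K\<in>B. G p q (g K) \<in> gen k G (w K)" using g inv_subD(2)[OF gsub pq] by blast
      ultimately show "G p q x \<in> ?S" by (intro CollectI exI[of _ "\<lambda>K. G p q (g K)"] conjI)
    qed
    have "f J0 = (\<Sum>K\<in>B. - f K)"
      using insert.prems(3) sum.insert[OF insert.hyps, of f] by (simp only: sum_negf eq_neg_iff_add_eq_0)
    moreover have "\<forall>K\<in>B. - f K \<in> gen k G (w K)"
      using insert.prems(2) cv.subspace_neg[OF inv_subD(1)[OF gsub]] by blast
    ultimately have "f J0 \<in> ?S" by (intro CollectI exI[of _ "\<lambda>K. - f K"] conjI)
    moreover have "f J0 \<in> gen k G (w J0)" using insert.prems(2) by blast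
    moreover have "inv_sub k G (?S \<inter> gen k G (w J0))"
      using S inv_sub_gens unfolding inv_sub_def by (auto intro: cv.subspace_inter)
    ultimately have "?S \<inter> gen k G (w J0) = gen k G (w J0)"
      by (intro hw_irredD(6)[OF irr, of J0 "?S \<inter> gen k G (w J0)" "f J0"]) (use nz in auto)
    then have "w J0 \<in> ?S" using gen_self by blast
    then obtain g where g: "w J0 = (\<Sum>K\<in>B. g K)" "\<And>K. K \<in> B \<Longrightarrow> g K \<in> gen k G (w K)" by blast
    have "\<exists>c. g K = c *c w K" if K: "K \<in> B" for K
    proof (rule t.hw_irred_singular[OF irr[of K] g(2)[OF K]])
      show "sing k G (g K)" unfolding sing_def
      proof (intro ballI impI)
        fix p q assume pq: "p \<in> index_set k" "q \<in> index_set k" "p < q"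
        show "G p q (g K) = 0"
        proof (rule IH[of "\<lambda>K. G p q (g K)"])
          show "G p q (g K) \<in> gen k G (w K)" if "K \<in> B" for K
            using inv_subD(2)[OF gsub pq(1,2)] g(2) that by blast
          have "(\<Sum>K\<in>B. G p q (g K)) = G p q (w J0)" unfolding g(1) clin_sum[OF t.F_clin[OF pq(1,2)]] ..
          also have "\<dots> = 0" using w(2)[of J0] insert.prems(1) pq unfolding sing_def by blast
          finally show "(\<Sum>K\<in>B. G p q (g K)) = 0" .
        qed (rule K)
      qed
    qed (use K in blast)
    then obtain c where c: "\<And>K. K \<in> B \<Longrightarrow> g K = c K *c w K" by metis
    have "g K = 0" if K: "K \<in> B" for K
    proof -
      have KJ: "K \<noteq> J0" using K insert.hyps by blast
      then obtain i where i: "i \<in> {1..k}" "spin_wt K i \<noteq> spin_wt J0 i"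
        using spin_wt_inj[of K k J0] insert.prems(1) K by blast
      let ?H = "G (- int i) (- int i)"
      have cl: "clin ?H" using i by (intro t.F_clin) auto
      have H: "?H (g L) = complex_of_real (l i + spin_wt L i) *c g L" if "L \<in> B" for L
      proof -
        have "?H (w L) = complex_of_real (l i + spin_wt L i) *c w L"
          using w(3)[of L] insert.prems(1) that i unfolding has_wt_def by blast
        then show ?thesis unfolding c[OF that] clin_scale[OF cl] by (simp only: cscale_cscale mult.commute)
      qed
      \<comment> \<open>The eigenvalue equation of \<open>w J0\<close> is applied to its
        decomposition, at an index \<open>i\<close> that distinguishes the weights of
        \<open>w K\<close> and \<open>w J0\<close>.\<close>
      have "(\<Sum>L\<in>B. complex_of_real (spin_wt L i - spin_wt J0 i) *c g L) =
         ?H (\<Sum>L\<in>B. g L) - complex_of_real (l i + spin_wt J0 i) *c (\<Sum>L\<in>B. g L)"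
        unfolding clin_sum[OF cl] cv.scale_sum_right sum_subtractf[symmetric]
        by (intro sum.cong refl, simp only: H)
          (simp add: cv.scale_left_diff_distrib cscale_left_distrib)
      also have "\<dots> = 0" using w(3)[of J0] insert.prems(1) i unfolding g(1)[symmetric] has_wt_def by simp
      finally have "complex_of_real (spin_wt K i - spin_wt J0 i) *c g K = 0"
        by (intro IH[of "\<lambda>L. complex_of_real (spin_wt L i - spin_wt J0 i) *c g L"] inv_subD(6)[OF gsub] g(2) K)
      then show ?thesis using i(2) by (simp add: cv.scale_eq_0_iff)
    qed
    then have "w J0 = 0" unfolding g(1) by (rule sum.neutral[OF ballI])
    then show False using insert.prems(1) by blast
  qed
  have "(\<Sum>K\<in>B. f K) = 0" 
    using insert.prems(3) sum.insert[OF insert.hyps, of f] by (simp only: f0 add_0_left)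
  then show ?case using IH[of f J] insert.prems(2,4) f0 by blast
qed

lemma components_span:
  assumes "\<phi> \<in> V"
  shows "\<exists>f. (\<forall>J. f J \<in> gen k G (w J)) \<and> \<phi> = (\<Sum>J | J \<subseteq> {1..k} \<and> w J \<noteq> 0. f J)"
proof -
  let ?A = "{J. J \<subseteq> {1..k} \<and> w J \<noteq> 0}"
  let ?S = "{\<Sum>K\<in>?A. g K | g. \<forall>K. g K \<in> gen k G (w K)}"
  have gsub: "inv_sub k G (gen k G (w K))" for K by (rule inv_sub_gens)
  have fin: "finite ?A" by simp
  have S: "inv_sub k G ?S"
    unfolding inv_sub_def cv.subspace_def
  proof (intro conjI ballI allI)
    have "(\<Sum>K\<in>?A. 0) \<in> ?S" using inv_subD(3)[OF gsub] by (intro CollectI exI[of _ "\<lambda>K. 0"]) auto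
    then show "0 \<in> ?S" by simp
  next
    fix x y assume "x \<in> ?S" "y \<in> ?S"
    then obtain g h where g: "x = (\<Sum>K\<in>?A. g K)" "\<forall>K. g K \<in> gen k G (w K)"
      and h: "y = (\<Sum>K\<in>?A. h K)" "\<forall>K. h K \<in> gen k G (w K)" by blast
    have "x + y = (\<Sum>K\<in>?A. g K + h K)" using g h by (simp only: sum.distrib)
    moreover have "\<forall>K. g K + h K \<in> gen k G (w K)" using g h inv_subD(4)[OF gsub] by blast
    ultimately show "x + y \<in> ?S" by (intro CollectI exI[of _ "\<lambda>K. g K + h K"] conjI)
  next
    fix c x assume "x \<in> ?S"
    then obtain g where g: "x = (\<Sum>K\<in>?A. g K)" "\<forall>K. g K \<in> gen k G (w K)" by blast
    have "c *c x = (\<Sum>K\<in>?A. c *c g K)" using g by (simp only: cv.scale_sum_right)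
    moreover have "\<forall>K. c *c g K \<in> gen k G (w K)" using g inv_subD(6)[OF gsub] by blast
    ultimately show "c *c x \<in> ?S" by (intro CollectI exI[of _ "\<lambda>K. c *c g K"] conjI)
  next
    fix p q x assume pq: "p \<in> index_set k" "q \<in> index_set k" and "x \<in> ?S"
    then obtain g where g: "x = (\<Sum>K\<in>?A. g K)" "\<forall>K. g K \<in> gen k G (w K)" by blast
    have "G p q x = (\<Sum>K\<in>?A. G p q (g K))" unfolding g(1) clin_sum[OF t.F_clin[OF pq]] ..
    moreover have "\<forall>K. G p q (g K) \<in> gen k G (w K)" using g inv_subD(2)[OF gsub pq] by blast
    ultimately show "G p q x \<in> ?S" by (intro CollectI exI[of _ "\<lambda>K. G p q (g K)"] conjI)
  qed
  have "w J \<in> ?S" if J: "J \<subseteq> {1..k}" for J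
  proof (cases "w J = 0")
    case True
    then show ?thesis using inv_subD(3)[OF S] by (simp only:)
  next
    case False
    have "w J = (\<Sum>K\<in>?A. if K = J then w J else 0)" using fin False J by simp
    moreover have "\<forall>K. (if K = J then w J else 0) \<in> gen k G (w K)"
      using inv_subD(3)[OF gsub] gen_self by simp
    ultimately show ?thesis by (intro CollectI exI[of _ "\<lambda>K. if K = J then w J else 0"] conjI)
  qed
  then have "V \<subseteq> ?S" unfolding V_eq_gens by (intro gens_least S) blast
  then show ?thesis using assms by blast
qed

end

text \<open>The vectors of \<open>N\<close> killed by the raising operators with first index
  \<open>- (k + 1)\<close> and sharing the eigenvalue of \<open>v\<close> at the new position form a
  module for the smaller algebra. Among them, vectors singular for the smaller algebra are singular
  for the larger one, hence multiples of \<open>v\<close>; this makes \<open>gen k F v\<close>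
  irreducible.\<close>

lemma levi_irred:
  assumes F: "so_rep (Suc k) F" and hw: "hw_irred (Suc k) F N l v"
  shows "hw_irred k F (gen k F v) l v" "gen k F v \<subseteq> N"
    "\<And>u q. u \<in> gen k F v \<Longrightarrow> q \<in> index_set (Suc k) \<Longrightarrow> q \<noteq> - int (Suc k) \<Longrightarrow> F (- int (Suc k)) q u = 0"
    "\<And>u. u \<in> gen k F v \<Longrightarrow> F (- int (Suc k)) (- int (Suc k)) u = complex_of_real (l (Suc k)) *c u"
proof -
  define m where "m = int (Suc k)"
  interpret so_rep "Suc k" F by fact
  interpret l: so_rep k F by (rule so_rep_mono[OF F]) simp
  note h = hw_irredD[OF hw]
  let ?Z = "{u \<in> N. (\<forall>q\<in>index_set (Suc k). q \<noteq> - m \<longrightarrow> F (- m) q u = 0) \<and>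
    F (- m) (- m) u = complex_of_real (l (Suc k)) *c u}"
  have mK: "- m \<in> index_set (Suc k)" "m \<in> index_set (Suc k)" by (auto simp: index_set_def m_def)
  have up: "p \<in> index_set (Suc k)" "p \<noteq> m" "p \<noteq> - m" "- p \<noteq> m" if "p \<in> index_set k" for p
    using that by (auto simp: index_set_def m_def)
  have Z: "inv_sub k F ?Z"
    unfolding inv_sub_def
  proof (intro conjI ballI)
    show "cv.subspace ?Z"
      using inv_subD(1)[OF h(1)]
      by (auto simp: cv.subspace_def clin_zero[OF F_clin] clin_add[OF F_clin] clin_scale[OF F_clin] mK
          cscale_right_distrib mult.commute)
    fix r s u assume r: "r \<in> index_set k" and s: "s \<in> index_set k" and u: "u \<in> ?Z"
    have c: "F (- m) q (F r s u) = F r s (F (- m) q u) +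
      (delta q r *c F (- m) s u + delta (- q) s *c F r m u)" if "q \<in> index_set (Suc k)" for q
      using F_comm[OF mK(1) that up(1)[OF r] up(1)[OF s], of u] up(2)[OF r] up(3)[OF s]
      by (simp add: delta_def algebra_simps)
    have 1: "F (- m) s u = 0" using u up[OF s] by blast
    have 2: "F r m u = 0"
      using F_skew[OF up(1)[OF r] mK(2), of u] u up[of "- r"] r by simp
    show "F r s u \<in> ?Z"
    proof (intro CollectI conjI ballI impI)
      show "F r s u \<in> N" using u inv_subD(2)[OF h(1) up(1)[OF r] up(1)[OF s]] by blast
      show "F (- m) q (F r s u) = 0" if "q \<in> index_set (Suc k)" "q \<noteq> - m" for q
        using c[OF that(1)] 1 2 u that clin_zero[OF l.F_clin[OF r s]] by simp
      show "F (- m) (- m) (F r s u) = complex_of_real (l (Suc k)) *c F r s u"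
        using c[OF mK(1)] 1 2 u clin_scale[OF l.F_clin[OF r s]] by simp
    qed
  qed
  have "v \<in> ?Z"
  proof (intro CollectI conjI ballI impI h(2))
    show "F (- m) q v = 0" if "q \<in> index_set (Suc k)" "q \<noteq> - m" for q
    proof -
      have "- m < q" using that by (auto simp: index_set_def m_def)
      then show ?thesis using h(4) that mK unfolding sing_def by blast
    qed
    show "F (- m) (- m) v = complex_of_real (l (Suc k)) *c v"
      using h(5) unfolding has_wt_def m_def by (rule bspec) simp
  qed
  then have genZ: "gen k F v \<subseteq> ?Z" by (intro gens_least Z) auto
  show "gen k F v \<subseteq> N" using genZ by blast
  show "F (- int (Suc k)) q u = 0" if "u \<in> gen k F v" "q \<in> index_set (Suc k)" "q \<noteq> - int (Suc k)" for u q
    using genZ that unfolding m_def by blast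
  show "F (- int (Suc k)) (- int (Suc k)) u = complex_of_real (l (Suc k)) *c u" if "u \<in> gen k F v" for u
    using genZ that unfolding m_def by blast
  have s: "sing k F v" using h(4) up(1) unfolding sing_def by blast
  have wt: "has_wt k F l v" using h(5) by (auto simp: has_wt_def)
  show "hw_irred k F (gen k F v) l v"
    unfolding hw_irred_def
  proof (intro conjI allI impI inv_sub_gens gen_self h(3) s wt)
    fix W assume W: "inv_sub k F W" "W \<subseteq> gen k F v"
    show "W = {0} \<or> W = gen k F v"
    proof (rule ccontr)
      assume n: "\<not> (W = {0} \<or> W = gen k F v)"
      then obtain u where u: "u \<in> W" "u \<noteq> 0" using inv_subD(3)[OF W(1)] by blast
      obtain x where x: "x \<in> W" "x \<noteq> 0" "sing k F x"
        using l.inv_sub_singular[OF s wt strictly_dom_of_nat W u] by blast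
      have xZ: "x \<in> ?Z" using x(1) W(2) genZ by blast
      have "sing (Suc k) F x"
        unfolding sing_def
      proof (intro ballI impI)
        fix p q assume pq: "p \<in> index_set (Suc k)" "q \<in> index_set (Suc k)" "p < q"
        \<comment> \<open>A raising operator outside the smaller algebra has first index
          \<open>- m\<close> or second index \<open>m\<close>, and \<open>F_skew\<close> turns the
          second kind into the first.\<close>
        consider "p = - m" | "q = m" "p \<noteq> - m" | "p \<in> index_set k" "q \<in> index_set k"
          using pq unfolding index_set_def m_def mem_Collect_eq of_nat_Suc by arith
        then show "F p q x = 0"
        proof cases
          case 1
          then show ?thesis using xZ pq by auto
        next
          case 2
          then have "F (- m) (- p) x = 0" using xZ pq by auto
          then show ?thesis using F_skew[OF pq(1,2), of x] 2 by simp
        next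
          case 3
          then show ?thesis using x(3) pq unfolding sing_def by blast
        qed
      qed
      then obtain c where c: "x = c *c v" using hw_irred_singular[OF hw, of x] xZ by blast
      then have "inverse c *c x = v" using x(2) by auto
      then have "v \<in> W" using inv_subD(6)[OF W(1) x(1)] by metis
      then have "gen k F v \<subseteq> W" by (intro gens_least[OF W(1)]) auto
      then show False using n W(2) by blast
    qed
  qed
qed

text \<open>Exterior product with the new basis vector, which commutes with all generators of index
  up to \<open>k\<close>. No sign appears, since \<open>nsign\<close> counts smaller positions and
  the new one is the largest.\<close>

definition add_top :: "nat \<Rightarrow> (nat set \<Rightarrow> 'v::complex_space) \<Rightarrow> nat set \<Rightarrow> 'v" where
  "add_top m \<phi> = (\<lambda>K. if m \<in> K then \<phi> (K - {m}) else 0)"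

lemma add_top_clin: "clin (add_top m)"
  by (auto simp: clin_def add_top_def fun_eq_iff)

lemma cliff_add_top:
  assumes "p \<in> index_set k"
  shows "cliff p (add_top (Suc k) \<phi>) = add_top (Suc k) (cliff p \<phi>)"
  using assms
proof (cases rule: index_set_cases)
  case (1 i)
  have "K - {i} - {Suc k} = K - {Suc k} - {i}" for K by blast
  then show ?thesis using 1 by (auto simp: fun_eq_iff cliff_neg add_top_def nsign_remove)
next
  case (2 i)
  have "insert i K - {Suc k} = insert i (K - {Suc k})" for K using 2 by auto
  then show ?thesis using 2 by (auto simp: fun_eq_iff cliff_pos add_top_def nsign_remove)
qed

lemma cliff_top_add_top: "cliff (- int (Suc k)) (add_top (Suc k) \<phi>) = 0"
  using cliff_neg[of "Suc k" "add_top (Suc k) \<phi>"] by (auto simp: fun_eq_iff add_top_def)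

lemma spin_add_top:
  assumes "p \<in> index_set k" "q \<in> index_set k"
  shows "spin p q (add_top (Suc k) \<phi>) = add_top (Suc k) (spin p q \<phi>)"
  using assms by (simp only: spin_def cliff_add_top uminus_in_index_set clin_diff[OF add_top_clin] clin_scale[OF add_top_clin])

lemma tens_add_top:
  assumes "p \<in> index_set k" "q \<in> index_set k" "clin (F p q)"
  shows "tens F p q (add_top (Suc k) \<phi>) = add_top (Suc k) (tens F p q \<phi>)"
proof -
  have "(\<lambda>J. F p q (add_top (Suc k) \<phi> J)) = add_top (Suc k) (\<lambda>J. F p q (\<phi> J))"
    using clin_zero[OF assms(3)] by (auto simp: add_top_def fun_eq_iff)
  then show ?thesis
    unfolding tens_def clin_add[OF add_top_clin] spin_add_top[OF assms(1,2)] by (rule arg_cong)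
qed

section \<open>Self-duality of the spinor module\<close>

definition parity :: "nat set \<Rightarrow> complex" where
  "parity K = (- 1) ^ (\<Sum>K)"

text \<open>The invariant pairing of two spinor factors, in which complementary basis vectors are
  dual up to sign; \<open>A K L\<close> is the coefficient at a pair of basis vectors.\<close>

definition contract :: "nat set \<Rightarrow> (nat set \<Rightarrow> nat set \<Rightarrow> 'w::complex_space) \<Rightarrow> 'w" where
  "contract S A = (\<Sum>K\<in>Pow S. parity K *c A K (S - K))"

lemma contract_clin: "clin (contract S)"
  by (auto simp: clin_def contract_def cscale_right_distrib sum.distrib cv.scale_sum_right mult.commute)

text \<open>The \<open>i - 1\<close> positions below \<open>i\<close> are divided between
  \<open>K\<close> and its complement, so the two signs differ by \<open>(- 1) ^ (i - 1)\<close>.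
  Inserting \<open>i\<close> changes \<open>parity\<close> by \<open>(- 1) ^ i\<close>, which leaves
  a single minus sign; \<open>parity\<close> is chosen for this.\<close>

lemma nsign_complement:
  assumes "i \<in> {1..k}" "i \<notin> K" "K \<subseteq> {1..k}"
  shows "parity (insert i K) * nsign i K = - (parity K * nsign i ({1..k} - K - {i}))"
    "parity K * nsign i K = - (parity (insert i K) * nsign i ({1..k} - insert i K))"
proof -
  have fin: "finite K" using assms(3) finite_subset by blast
  have "{j \<in> K. j < i} \<union> {j \<in> {1..k} - K - {i}. j < i} = {1..<i}" using assms by auto
  moreover have "{j \<in> K. j < i} \<inter> {j \<in> {1..k} - K - {i}. j < i} = {}" by auto
  ultimately have "card {j \<in> K. j < i} + card {j \<in> {1..k} - K - {i}. j < i} = i - 1"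
    using fin card_Un_disjoint[of "{j \<in> K. j < i}" "{j \<in> {1..k} - K - {i}. j < i}"] by simp
  then have n: "nsign i K * nsign i ({1..k} - K - {i}) = (- 1) ^ (i - 1)"
    by (simp add: nsign_def flip: power_add)
  have p: "parity (insert i K) = (- 1) ^ i * parity K"
    using fin assms(2) by (simp add: parity_def power_add)
  have i: "(- 1 :: complex) ^ i = - ((- 1) ^ (i - 1))"
    using assms(1) by (cases i) auto
  have pi: "(- 1 :: complex) ^ (i - 1) * (- 1) ^ (i - 1) = 1"
    by (simp flip: power_mult_distrib)
  have "nsign i ({1..k} - K - {i}) = nsign i K * (nsign i K * nsign i ({1..k} - K - {i}))"
    by (simp flip: mult.assoc)
  then have m: "nsign i ({1..k} - K - {i}) = nsign i K * (- 1) ^ (i - 1)" by (simp only: n)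
  show "parity (insert i K) * nsign i K = - (parity K * nsign i ({1..k} - K - {i}))"
    unfolding p m i by simp
  have e: "{1..k} - insert i K = {1..k} - K - {i}" by blast
  have "parity (insert i K) * nsign i ({1..k} - insert i K) =
    - (((- 1) ^ (i - 1) * (- 1) ^ (i - 1)) * (parity K * nsign i K))"
    unfolding p e m i by simp
  then show "parity K * nsign i K = - (parity (insert i K) * nsign i ({1..k} - insert i K))"
    unfolding pi by simp
qed

text \<open>The pairing of \<open>s\<^sub>K\<close> with the complementary basis vector makes the Clifford generators
  skew-adjoint; hence the spinor module is self-dual.\<close>

lemma contract_cliff:
  fixes A :: "nat set \<Rightarrow> nat set \<Rightarrow> 'w::complex_space"
  assumes "p \<in> index_set k"
  shows "contract {1..k} (cliff p A) = - contract {1..k} (\<lambda>K. cliff p (A K))"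
  using assms
proof (cases rule: index_set_cases)
  let ?S = "{1..k}"
  case (1 i)
  let ?P = "{K. K \<subseteq> ?S \<and> i \<notin> K}"
  have "contract ?S (cliff p A) = (\<Sum>K\<in>Pow ?S. if i \<in> K then (parity K * nsign i K) *c A (K - {i}) (?S - K) else 0)"
    unfolding contract_def using 1 by (intro sum.cong) (auto simp: cliff_neg)
  also have "\<dots> = (\<Sum>K\<in>{K \<in> Pow ?S. i \<in> K}. (parity K * nsign i K) *c A (K - {i}) (?S - K))"
    by (rule sum.inter_filter[symmetric]) simp
  also have "\<dots> = (\<Sum>K\<in>?P. (parity (insert i K) * nsign i K) *c A K (?S - K - {i}))"
  proof (rule sum.reindex_bij_witness[where i = "insert i" and j = "\<lambda>K. K - {i}"])
    fix K assume "K \<in> {K \<in> Pow ?S. i \<in> K}"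
    then have "insert i (K - {i}) = K" "?S - (K - {i}) - {i} = ?S - K" "nsign i (K - {i}) = nsign i K"
      by (auto simp: nsign_remove)
    then show "(parity (insert i (K - {i})) * nsign i (K - {i})) *c A (K - {i}) (?S - (K - {i}) - {i}) =
      (parity K * nsign i K) *c A (K - {i}) (?S - K)" by simp
  qed (use 1 in auto)
  also have "\<dots> = - (\<Sum>K\<in>?P. (parity K * nsign i (?S - K - {i})) *c A K (?S - K - {i}))"
    unfolding sum_negf[symmetric] using 1 by (intro sum.cong) (auto simp: nsign_complement(1))
  also have "(\<Sum>K\<in>?P. (parity K * nsign i (?S - K - {i})) *c A K (?S - K - {i})) =
      (\<Sum>K\<in>{K \<in> Pow ?S. i \<notin> K}. (parity K * nsign i (?S - K - {i})) *c A K (?S - K - {i}))"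
    by (rule sum.cong) auto
  also have "\<dots> = (\<Sum>K\<in>Pow ?S. if i \<notin> K then (parity K * nsign i (?S - K - {i})) *c A K (?S - K - {i}) else 0)"
    by (rule sum.inter_filter) simp
  also have "\<dots> = contract ?S (\<lambda>K. cliff p (A K))"
    unfolding contract_def using 1 by (intro sum.cong) (auto simp: cliff_neg nsign_remove)
  finally show ?thesis .
next
  let ?S = "{1..k}"
  case (2 i)
  let ?P = "{K. K \<subseteq> ?S \<and> i \<notin> K}"
  have "contract ?S (cliff p A) = (\<Sum>K\<in>Pow ?S. if i \<notin> K then (parity K * nsign i K) *c A (insert i K) (?S - K) else 0)"
    unfolding contract_def using 2 by (intro sum.cong) (auto simp: cliff_pos)
  also have "\<dots> = (\<Sum>K\<in>{K \<in> Pow ?S. i \<notin> K}. (parity K * nsign i K) *c A (insert i K) (?S - K))"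
    by (rule sum.inter_filter[symmetric]) simp
  also have "\<dots> = - (\<Sum>K\<in>{K \<in> Pow ?S. i \<notin> K}. (parity (insert i K) * nsign i (?S - insert i K)) *c A (insert i K) (?S - K))"
    unfolding sum_negf[symmetric] using 2 by (intro sum.cong) (auto simp: nsign_complement(2))
  also have "(\<Sum>K\<in>{K \<in> Pow ?S. i \<notin> K}. (parity (insert i K) * nsign i (?S - insert i K)) *c A (insert i K) (?S - K)) =
    (\<Sum>K\<in>{K \<in> Pow ?S. i \<in> K}. (parity K * nsign i (?S - K)) *c A K (insert i (?S - K)))"
  proof (rule sum.reindex_bij_witness[where i = "\<lambda>K. K - {i}" and j = "insert i"])
    fix K assume K: "K \<in> {K \<in> Pow ?S. i \<notin> K}"
    then have "insert i (?S - insert i K) = ?S - K" using 2 by auto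
    then show "(parity (insert i K) * nsign i (?S - insert i K)) *c A (insert i K) (insert i (?S - insert i K)) =
      (parity (insert i K) * nsign i (?S - insert i K)) *c A (insert i K) (?S - K)" by simp
  qed (use 2 in auto)
  also have "\<dots> = (\<Sum>K\<in>Pow ?S. if i \<in> K then (parity K * nsign i (?S - K)) *c A K (insert i (?S - K)) else 0)"
    by (rule sum.inter_filter) simp
  also have "\<dots> = contract ?S (\<lambda>K. cliff p (A K))"
    unfolding contract_def using 2 by (intro sum.cong) (auto simp: cliff_pos)
  finally show ?thesis .
qed

text \<open>Transposing a product of two skew generators reverses their order while the two signs
  cancel; the commutator therefore changes sign.\<close>

lemma contract_spin:
  fixes A :: "nat set \<Rightarrow> nat set \<Rightarrow> 'w::complex_space"
  assumes p: "p \<in> index_set k" and q: "q \<in> index_set k"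
  shows "contract {1..k} (spin p q A) = - contract {1..k} (\<lambda>K. spin p q (A K))"
proof -
  let ?c = "contract {1..k}"
  have q': "- q \<in> index_set k" using q by simp
  have cc: "?c (cliff a (cliff b A)) = ?c (\<lambda>K. cliff b (cliff a (A K)))"
    if "a \<in> index_set k" "b \<in> index_set k" for a b
  proof -
    have "?c (cliff a (cliff b A)) = - ?c (\<lambda>K. cliff a (cliff b A K))" by (rule contract_cliff[OF that(1)])
    also have "(\<lambda>K. cliff a (cliff b A K)) = cliff b (\<lambda>K. cliff a (A K))"
      by (rule cliff_pointwise[OF cliff_clin])
    also have "?c (cliff b (\<lambda>K. cliff a (A K))) = - ?c (\<lambda>K. cliff b (cliff a (A K)))"
      by (rule contract_cliff[OF that(2)])
    finally show ?thesis by simp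
  qed
  have "?c (spin p q A) = (1/2) *c (?c (\<lambda>K. cliff (- q) (cliff p (A K))) - ?c (\<lambda>K. cliff p (cliff (- q) (A K))))"
    unfolding spin_def clin_scale[OF contract_clin] clin_diff[OF contract_clin] cc[OF p q'] cc[OF q' p] ..
  moreover have "(\<lambda>K. spin p q (A K)) =
    (1/2) *c ((\<lambda>K. cliff p (cliff (- q) (A K))) - (\<lambda>K. cliff (- q) (cliff p (A K))))"
    by (simp add: spin_def fun_eq_iff)
  then have "?c (\<lambda>K. spin p q (A K)) =
    (1/2) *c (?c (\<lambda>K. cliff p (cliff (- q) (A K))) - ?c (\<lambda>K. cliff (- q) (cliff p (A K))))"
    by (simp only: clin_scale[OF contract_clin] clin_diff[OF contract_clin])
  ultimately show ?thesis by (simp add: cv.scale_right_diff_distrib)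
qed

section \<open>Existence of singular vectors of dominant weight\<close>

text \<open>\<open>T\<close> on the first factor followed by the pairing of the two spinor factors
  maps N \<otimes> S to N'. The actions on the paired spinor factors cancel, so only the action on
  N' remains.\<close>

lemma contract_hom:
  assumes F: "so_rep k F" and F': "so_rep k F'" and N: "inv_sub k F N"
    and T: "hom_on k F (tens F') N T" and \<phi>: "\<phi> \<in> tsp k N" and p: "p \<in> index_set k" and q: "q \<in> index_set k"
  shows "contract {1..k} (\<lambda>K. T (tens F p q \<phi> K)) = F' p q (contract {1..k} (\<lambda>K. T (\<phi> K)))"
proof -
  note sN = inv_subD(1)[OF N]
  note n = inv_subD(2)[OF N p q] inv_subD(3)[OF N] inv_subD(5)[OF N] inv_subD(6)[OF N]
  have add: "T (u + v) = T u + T v" if "u \<in> N" "v \<in> N" for u v using T that by (simp add: hom_on_def)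
  have sc: "T (c *c u) = c *c T u" if "u \<in> N" for c u using T that by (simp add: hom_on_def)
  have zero: "T 0 = 0" using sc[OF n(2), of 0] by simp
  have diff: "T (u - v) = T u - T v" if "u \<in> N" "v \<in> N" for u v
    using add[OF n(3)[OF that] that(2)] by (simp add: eq_diff_eq)
  have cl: "(\<lambda>K. T (cliff a \<psi> K)) = cliff a (\<lambda>K. T (\<psi> K))" if "\<psi> \<in> tsp k N" for a \<psi>
  proof
    fix K
    have "\<psi> L \<in> N" for L using that by (simp add: tsp_def)
    then show "T (cliff a \<psi> K) = cliff a (\<lambda>K. T (\<psi> K)) K" by (simp add: cliff_def Let_def sc zero)
  qed
  have q': "- q \<in> index_set k" using q by simp
  note m1 = cliff_mem_tsp[OF sN p cliff_mem_tsp[OF sN q' \<phi>]] and m2 = cliff_mem_tsp[OF sN q' cliff_mem_tsp[OF sN p \<phi>]]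
  have sp: "(\<lambda>K. T (spin p q \<phi> K)) = spin p q (\<lambda>K. T (\<phi> K))"
  proof
    fix K
    have "cliff p (cliff (- q) \<phi>) K \<in> N" "cliff (- q) (cliff p \<phi>) K \<in> N" using m1 m2 by (simp_all add: tsp_def)
    then have "T (spin p q \<phi> K) = (1/2) *c (T (cliff p (cliff (- q) \<phi>) K) - T (cliff (- q) (cliff p \<phi>) K))"
      by (simp add: spin_def sc diff n(3))
    also have "T (cliff p (cliff (- q) \<phi>) K) = cliff p (cliff (- q) (\<lambda>K. T (\<phi> K))) K"
      using fun_cong[OF cl[OF cliff_mem_tsp[OF sN q' \<phi>], of p], of K] by (simp only: cl[OF \<phi>])
    also have "T (cliff (- q) (cliff p \<phi>) K) = cliff (- q) (cliff p (\<lambda>K. T (\<phi> K))) K"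
      using fun_cong[OF cl[OF cliff_mem_tsp[OF sN p \<phi>], of "- q"], of K] by (simp only: cl[OF \<phi>])
    finally show "T (spin p q \<phi> K) = spin p q (\<lambda>K. T (\<phi> K)) K"
      by (simp add: spin_def fun_eq_iff)
  qed
  have spin_mem: "spin p q \<phi> K \<in> N" for K
    using m1 m2 n by (auto simp: spin_def tsp_def)
  have \<phi>N: "\<phi> K \<in> N" for K using \<phi> by (simp add: tsp_def)
  have "T (tens F p q \<phi> K) = (\<lambda>J. F' p q (T (\<phi> K) J)) + spin p q (T (\<phi> K)) + spin p q (\<lambda>K. T (\<phi> K)) K" for K
  proof -
    have "T (tens F p q \<phi> K) = T (F p q (\<phi> K)) + T (spin p q \<phi> K)"
      by (simp add: tens_def add n(1) \<phi>N spin_mem)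
    also have "T (F p q (\<phi> K)) = tens F' p q (T (\<phi> K))" using T p q \<phi>N by (simp add: hom_on_def)
    finally show ?thesis using fun_cong[OF sp, of K] by (simp only: tens_def)
  qed
  then have "(\<lambda>K. T (tens F p q \<phi> K)) =
     (\<lambda>K J. F' p q (T (\<phi> K) J)) + (\<lambda>K. spin p q (T (\<phi> K))) + spin p q (\<lambda>K. T (\<phi> K))"
    by (simp add: fun_eq_iff)
  then have "contract {1..k} (\<lambda>K. T (tens F p q \<phi> K)) = contract {1..k} (\<lambda>K J. F' p q (T (\<phi> K) J))"
    by (simp only: clin_add[OF contract_clin] contract_spin[OF p q]) simp
  also have "\<dots> = F' p q (contract {1..k} (\<lambda>K. T (\<phi> K)))"
    unfolding contract_def clin_sum[OF so_rep.F_clin[OF F' p q]] clin_scale[OF so_rep.F_clin[OF F' p q]] ..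
  finally show ?thesis .
qed

text \<open>If the last entry of the spinor weight is \<open>1/2\<close>, a singular vector for the Levi subalgebra
  \<open>o\<^sub>2\<^sub>k\<close> stays singular; otherwise self-duality of the spinor module exchanges the roles of the
  two irreducible modules and changes the sign of that entry.\<close>

lemma singular_vector_exists:
  fixes F F' :: "int \<Rightarrow> int \<Rightarrow> 'v::complex_space \<Rightarrow> 'v"
  assumes "so_rep k F" "so_rep k F'" "hw_irred k F N l v" "hw_irred k F' N' l' v'"
    "dominant k l" "dominant k l'" "J \<subseteq> {1..k}" "\<And>i. i \<in> {1..k} \<Longrightarrow> l' i = l i + spin_wt J i"
  shows "\<exists>u\<in>tsp k N. u \<noteq> 0 \<and> sing k (tens F) u \<and> has_wt k (tens F) l' u"
  using assms
proof (induction k arbitrary: F F' N N' l l' v v' J)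
  case 0
  have "pure v {} \<in> tsp 0 N"
    using hw_irredD(1,2)[OF "0.prems"(3)] by (intro pure_mem_tsp) (auto dest: inv_subD(1))
  moreover have "pure v {} \<noteq> 0"
    using hw_irredD(3)[OF "0.prems"(3)] by (auto simp: pure_def fun_eq_iff)
  moreover have "sing 0 (tens F) (pure v {})" "has_wt 0 (tens F) l' (pure v {})"
    by (auto simp: sing_def has_wt_def)
  ultimately show ?case by blast
next
  case (Suc k)
  define m where "m = int (Suc k)"
  have top: "\<exists>u\<in>tsp (Suc k) N. u \<noteq> 0 \<and> sing (Suc k) (tens F) u \<and> has_wt (Suc k) (tens F) l' u"
    if F: "so_rep (Suc k) F" and F': "so_rep (Suc k) F'" and hw: "hw_irred (Suc k) F N l v"
      and hw': "hw_irred (Suc k) F' N' l' v'"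
      and dom: "dominant (Suc k) l" "dominant (Suc k) l'" and J: "J \<subseteq> {1..Suc k}" "Suc k \<in> J"
      and wt: "\<And>i. i \<in> {1..Suc k} \<Longrightarrow> l' i = l i + spin_wt J i"
    for F F' :: "int \<Rightarrow> int \<Rightarrow> 'v \<Rightarrow> 'v" and N N' l l' v v' J
  proof -
    interpret so_rep "Suc k" F by fact
    interpret t: so_rep "Suc k" "tens F" by (rule so_rep_tens[OF F])
    note lev = levi_irred[OF F hw]
    have "\<exists>u\<in>tsp k (gen k F v). u \<noteq> 0 \<and> sing k (tens F) u \<and> has_wt k (tens F) l' u"
    proof (rule Suc.IH)
      show "so_rep k F" "so_rep k F'" using so_rep_mono[OF F] so_rep_mono[OF F'] by simp_all
      show "hw_irred k F (gen k F v) l v" by (rule lev(1))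
      show "hw_irred k F' (gen k F' v') l' v'" by (rule levi_irred(1)[OF F' hw'])
      show "dominant k l" "dominant k l'" using dom dominant_mono by (metis le_SucI order_refl)+
      show "J - {Suc k} \<subseteq> {1..k}" using J by force
      show "l' i = l i + spin_wt (J - {Suc k}) i" if "i \<in> {1..k}" for i
        using wt[of i] that by (simp add: spin_wt_def)
    qed
    then obtain u where u: "u \<in> tsp k (gen k F v)" "u \<noteq> 0" "sing k (tens F) u" "has_wt k (tens F) l' u"
      by blast
    have u0: "u K = 0" if "\<not> K \<subseteq> {1..k}" for K using u(1) that by (simp add: tsp_def)
    let ?u = "add_top (Suc k) u"
    have "?u \<in> tsp (Suc k) N"
    proof -
      have "?u K \<in> N" for K
        using u(1) lev(2) inv_subD(3)[OF hw_irredD(1)[OF hw]] by (auto simp: tsp_def add_top_def)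
      moreover have "?u K = 0" if "\<not> K \<subseteq> {1..Suc k}" for K
      proof -
        have "\<not> K - {Suc k} \<subseteq> {1..k}" if "Suc k \<in> K" using that \<open>\<not> K \<subseteq> {1..Suc k}\<close> by force
        then show ?thesis using u0 by (simp add: add_top_def)
      qed
      ultimately show ?thesis by (simp add: tsp_def)
    qed
    moreover have "?u \<noteq> 0"
    proof
      assume "?u = 0"
      have "u K = 0" for K
      proof (cases "K \<subseteq> {1..k}")
        case True
        have "?u (insert (Suc k) K) = 0" using \<open>?u = 0\<close> by simp
        moreover have "insert (Suc k) K - {Suc k} = K" using True by force
        ultimately show ?thesis by (simp add: add_top_def)
      qed (rule u0)
      then show False using u(2) by (simp add: fun_eq_iff)
    qed
    \<comment> \<open>The coefficients come from \<open>gen k F v\<close> and are killed by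
      \<open>F (- m) q\<close>; on the spinor side \<open>spin (- m) q\<close> multiplies once more
      by the top basis vector.\<close>
    moreover have lowest: "tens F (- m) q ?u = 0" if q: "q \<in> index_set (Suc k)" "q \<noteq> - m" for q
    proof (cases "q = m")
      case True
      then show ?thesis using t.F_anti_diag[of "- m"] q by simp
    next
      case False
      have qk: "- q \<in> index_set k" using q False unfolding index_set_def m_def by auto
      have mK: "- m \<in> index_set (Suc k)" by (simp add: index_set_def m_def)
      have "F (- m) q (?u K) = 0" for K
        using lev(3)[of "u (K - {Suc k})" q] u(1) q clin_zero[OF F_clin[OF mK q(1)]]
        by (simp add: add_top_def m_def tsp_def)
      moreover have "spin (- m) q ?u = 0"
      proof -
        have "spin (- m) q ?u = cliff (- m) (cliff (- q) ?u)"
          using q(2) by (intro spin_off_diag[OF mK q(1)]) simp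
        also have "cliff (- q) ?u = add_top (Suc k) (cliff (- q) u)" by (rule cliff_add_top[OF qk])
        finally show ?thesis unfolding m_def cliff_top_add_top .
      qed
      ultimately show ?thesis by (simp add: tens_def fun_eq_iff)
    qed
    moreover have "sing (Suc k) (tens F) ?u"
      unfolding sing_def
    proof (intro ballI impI)
      fix p q assume pq: "p \<in> index_set (Suc k)" "q \<in> index_set (Suc k)" "p < q"
      consider "p = - m" | "q = m" "p \<noteq> - m" "p \<noteq> m" | "p \<in> index_set k" "q \<in> index_set k"
        using pq unfolding index_set_def m_def mem_Collect_eq of_nat_Suc by arith
      then show "tens F p q ?u = 0"
      proof cases
        case 1
        then show ?thesis using lowest pq by auto
      next
        case 2
        then have "tens F (- m) (- p) ?u = 0" using lowest[of "- p"] pq by auto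
        then show ?thesis using t.F_skew[OF pq(1,2), of ?u] 2 by simp
      next
        case 3
        have "clin (F p q)" by (rule F_clin[OF pq(1,2)])
        then show ?thesis
          using u(3) 3 pq(3) tens_add_top[OF 3, of F u] clin_zero[OF add_top_clin] by (simp add: sing_def)
      qed
    qed
    moreover have "has_wt (Suc k) (tens F) l' ?u"
      unfolding has_wt_def
    proof
      fix i assume i: "i \<in> {1..Suc k}"
      show "tens F (- int i) (- int i) ?u = complex_of_real (l' i) *c ?u"
      proof (cases "i = Suc k")
        case True
        show ?thesis
        proof
          fix K
          have "F (- int (Suc k)) (- int (Suc k)) (?u K) = complex_of_real (l (Suc k)) *c ?u K"
            using lev(4)[of "u (K - {Suc k})"] u(1) clin_zero[OF F_diag_clin[of "Suc k"]]
            by (auto simp: add_top_def tsp_def simp del: of_nat_Suc)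
          moreover have "l' (Suc k) = l (Suc k) + 1/2" using wt[of "Suc k"] J(2) by (simp add: spin_wt_def)
          moreover have "complex_of_real (spin_wt K (Suc k)) = 1/2 \<or> ?u K = 0" by (simp add: spin_wt_def add_top_def)
          ultimately show "tens F (- int i) (- int i) ?u K = (complex_of_real (l' i) *c ?u) K"
            using True by (auto simp: tens_diag cscale_left_distrib simp del: of_nat_Suc)
        qed
      next
        case False
        then have ik: "i \<in> {1..k}" using i by auto
        then have K: "- int i \<in> index_set k" by simp
        show ?thesis
          using tens_add_top[of _ _ _ F, OF K K F_diag_clin[OF i], of u] u(4) ik
          by (simp add: has_wt_def clin_scale[OF add_top_clin])
      qed
    qed
    ultimately show ?thesis by blast
  qed
  show ?case
  proof (cases "Suc k \<in> J")
    case True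
    show ?thesis by (rule top[OF Suc.prems(1-7) True Suc.prems(8)])
  next
    case False
    let ?S = "{1..Suc k}"
    note F = Suc.prems(1) and F' = Suc.prems(2) and hw = Suc.prems(3) and hw' = Suc.prems(4)
    \<comment> \<open>Complementing \<open>J\<close> negates the spinor weight, so \<open>l\<close>
      arises from \<open>l'\<close> by adding the weight of \<open>?J\<close>. As \<open>?J\<close>
      contains \<open>Suc k\<close>, the case already settled applies with the modules
      exchanged.\<close>
    let ?J = "?S - J"
    have wt': "l i = l' i + spin_wt ?J i" if "i \<in> ?S" for i
      using Suc.prems(8)[OF that] that by (simp add: spin_wt_def)
    obtain u where u: "u \<in> tsp (Suc k) N'" "u \<noteq> 0" "sing (Suc k) (tens F') u" "has_wt (Suc k) (tens F') l u"
      using top[OF F' F hw' hw Suc.prems(6,5) _ _ wt'] False by auto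
    interpret N': spin_tensor "Suc k" F' N' l' v'
      using F' hw' Suc.prems(6) by (intro spin_tensor.intro spin_tensor_axioms.intro)
    interpret N: spin_tensor "Suc k" F N l v
      using F hw Suc.prems(5) by (intro spin_tensor.intro spin_tensor_axioms.intro)
    have wtu: "has_wt (Suc k) (tens F') (\<lambda>i. l' i + spin_wt ?J i) u"
      using u(4) wt' has_wt_cong[of "Suc k" l "\<lambda>i. l' i + spin_wt ?J i"] by blast
    have "hw_irred (Suc k) (tens F') (gen (Suc k) (tens F') u) (\<lambda>i. l' i + spin_wt ?J i) u"
      by (rule N'.gen_irred[OF u(1,3,2) wtu])
    then have "hw_irred (Suc k) (tens F') (gen (Suc k) (tens F') u) l u"
      using u(4) unfolding hw_irred_def by blast
    from hw_irred_iso[OF F so_rep_tens[OF F'] hw this] obtain T where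
      T: "hom_on (Suc k) F (tens F') N T" "bij_betw T N (gen (Suc k) (tens F') u)" "T v = u" by blast
    have genu: "gen (Suc k) (tens F') u \<subseteq> tsp (Suc k) N'"
      using u(1) by (intro gens_least N'.inv_V) auto
    have TN: "T x \<in> tsp (Suc k) N'" if "x \<in> N" for x
      using T(2) that genu by (auto simp: bij_betw_def)
    have TN': "T x L \<in> N'" if "x \<in> N" for x L using TN[OF that] by (simp add: tsp_def)
    \<comment> \<open>\<open>T\<close> embeds \<open>N\<close> into N' \<otimes> S; pairing the
      spinor factors turns it into a homomorphism \<open>P\<close> from N \<otimes> S to N'.\<close>
    define P where "P \<phi> = contract ?S (\<lambda>K. T (\<phi> K))" for \<phi>
    have P_hom: "P (tens F p q \<phi>) = F' p q (P \<phi>)"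
      if "\<phi> \<in> tsp (Suc k) N" "p \<in> index_set (Suc k)" "q \<in> index_set (Suc k)" for p q \<phi>
      unfolding P_def by (rule contract_hom[OF F F' hw_irredD(1)[OF hw] T(1) that])
    note n = inv_subD[OF hw_irredD(1)[OF hw]] and n' = inv_subD[OF hw_irredD(1)[OF hw']]
    have Tadd: "T (x + y) = T x + T y" if "x \<in> N" "y \<in> N" for x y using T(1) that by (simp add: hom_on_def)
    have Tsc: "T (c *c x) = c *c T x" if "x \<in> N" for x c using T(1) that by (simp add: hom_on_def)
    have T0: "T 0 = 0" using Tsc[OF n(3), of 0] by simp
    have Padd: "P (\<phi> + \<psi>) = P \<phi> + P \<psi>" if "\<phi> \<in> tsp (Suc k) N" "\<psi> \<in> tsp (Suc k) N" for \<phi> \<psi>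
    proof -
      have "(\<lambda>K. T ((\<phi> + \<psi>) K)) = (\<lambda>K. T (\<phi> K)) + (\<lambda>K. T (\<psi> K))"
        using that by (simp add: tsp_def fun_eq_iff Tadd)
      then show ?thesis by (simp only: P_def clin_add[OF contract_clin])
    qed
    have Psc: "P (c *c \<phi>) = c *c P \<phi>" if "\<phi> \<in> tsp (Suc k) N" for \<phi> c
    proof -
      have "(\<lambda>K. T ((c *c \<phi>) K)) = c *c (\<lambda>K. T (\<phi> K))"
        using that by (simp add: tsp_def fun_eq_iff Tsc)
      then show ?thesis by (simp only: P_def clin_scale[OF contract_clin])
    qed
    have "\<exists>K\<in>Pow ?S. N.w K \<notin> {\<phi> \<in> tsp (Suc k) N. P \<phi> = 0}"
    proof (rule ccontr)
      assume a: "\<not> ?thesis"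
      note iV = inv_subD[OF N.inv_V]
      have P0: "P 0 = 0" using Psc[OF iV(3), of 0] by simp
      have "inv_sub (Suc k) (tens F) {\<phi> \<in> tsp (Suc k) N. P \<phi> = 0}"
        unfolding inv_sub_def cv.subspace_def
        using iV(2,3,4,6) P0 clin_zero[OF N'.F_clin] by (auto simp: Padd Psc P_hom)
      then have V: "tsp (Suc k) N \<subseteq> {\<phi> \<in> tsp (Suc k) N. P \<phi> = 0}"
        unfolding N.V_eq_gens[symmetric] by (subst (1) N.V_eq_gens, intro gens_least) (use a in auto)
      obtain L where L: "u L \<noteq> 0" using u(2) by (auto simp: fun_eq_iff)
      then have LS: "L \<subseteq> ?S" using u(1) by (auto simp: tsp_def)
      \<comment> \<open>The complement of \<open>L\<close> picks out one term of the pairing: as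
        \<open>T v = u\<close>, the value \<open>P (pure v ?K)\<close> is up to sign the nonzero
        coefficient \<open>u L\<close>.\<close>
      let ?K = "?S - L"
      have "pure v ?K \<in> tsp (Suc k) N" by (intro N.pure_in_V) auto
      then have "P (pure v ?K) = 0" using V by blast
      moreover have "P (pure v ?K) = (\<Sum>K\<in>Pow ?S. if K = ?K then parity K *c u L else 0)"
        unfolding P_def contract_def using LS T(3) T0
        by (intro sum.cong) (auto simp: pure_def double_diff)
      ultimately have "parity ?K *c u L = 0" by simp
      then show False using L by (simp add: parity_def)
    qed
    then obtain K where K: "K \<subseteq> ?S" "P (N.w K) \<noteq> 0" using N.w(1) by blast
    note w = N.w[OF K(1)]
    have PN: "P (N.w K) \<in> N'"
      unfolding P_def contract_def using w(1) TN' by (intro n'(7) n'(6)) (simp add: tsp_def)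
    have "sing (Suc k) F' (P (N.w K))"
    proof -
      have P0: "P 0 = 0" using Psc[OF inv_subD(3)[OF N.inv_V], of 0] by simp
      show ?thesis
        using w(2) P0 unfolding sing_def by (simp flip: P_hom[OF w(1)])
    qed
    then obtain c where c: "P (N.w K) = c *c v'" using N'.hw_irred_singular[OF hw' PN] by blast
    \<comment> \<open>\<open>P (N.w K)\<close> is a nonzero multiple of \<open>v'\<close>, and
      \<open>P\<close> preserves weights; this identifies the weight of
      \<open>N.w K\<close>.\<close>
    have "l' i = l i + spin_wt K i" if i: "i \<in> ?S" for i
    proof -
      have ii: "- int i \<in> index_set (Suc k)" using i by auto
      have "F' (- int i) (- int i) (P (N.w K)) = P (tens F (- int i) (- int i) (N.w K))"
        by (rule P_hom[OF w(1) ii ii, symmetric])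
      also have "\<dots> = complex_of_real (l i + spin_wt K i) *c P (N.w K)"
        using w(3) i Psc[OF w(1)] unfolding has_wt_def by simp
      also have "F' (- int i) (- int i) (P (N.w K)) = complex_of_real (l' i) *c P (N.w K)"
        using c i hw_irredD(5)[OF hw'] by (simp add: has_wt_def clin_scale[OF N'.F_diag_clin] mult.commute)
      finally show ?thesis using K(2) by (simp flip: of_real_add)
    qed
    then have "has_wt (Suc k) (tens F) l' (N.w K)"
      using w(3) has_wt_cong[of "Suc k" l' "\<lambda>i. l i + spin_wt K i"] by blast
    moreover have "N.w K \<noteq> 0"
      using K(2) Psc[OF inv_subD(3)[OF N.inv_V], of 0] by auto
    ultimately show ?thesis using w(1,2) by blast
  qed
qed

section \<open>Operators and matrices\<close>

text \<open>Eigenvectors for distinct eigenvalues are independent, and \<open>card S + 1\<close> of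
  them do not fit into the span of \<open>S\<close>.\<close>

lemma eigenvectors_bound:
  fixes H :: "'v::complex_space \<Rightarrow> 'v"
  assumes "clin H" "finite S" "U \<subseteq> cv.span S" "inj a"
    "\<And>n::nat. x n \<in> U" "\<And>n. x n \<noteq> 0" "\<And>n. H (x n) = a n *c x n"
  shows False
proof -
  have inj: "inj x"
  proof (rule injI)
    fix m n assume "x m = x n"
    then have "a m *c x n = a n *c x n" using assms(7)[of m] assms(7)[of n] by metis
    then have "a m = a n" using assms(6)[of n] by simp
    then show "m = n" using assms(4) by (simp add: inj_eq)
  qed
  let ?A = "x ` {..card S}"
  have "cv.independent ?A"
  proof (rule cv.independent_if_scalars_zero)
    fix f y assume s: "(\<Sum>z\<in>?A. f z *c z) = 0" and y: "y \<in> ?A"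
    then obtain n where n: "n \<in> {..card S}" "y = x n" by blast
    have "(\<Sum>m\<in>{..card S}. f (x m) *c x m) = (\<Sum>z\<in>?A. f z *c z)"
      by (simp add: sum.reindex[OF inj_on_subset[OF inj subset_UNIV]])
    then have s0: "(\<Sum>m\<in>{..card S}. f (x m) *c x m) \<in> {0}" using s by simp
    have "f (x n) *c x n \<in> {0}"
    proof (rule eigen_sum_mem[where f = "\<lambda>m. f (x m) *c x m", OF _ assms(1) _ _ _ _ s0 n(1)])
      show "inj_on a {..card S}" by (rule inj_on_subset[OF assms(4) subset_UNIV])
      show "H (f (x m) *c x m) = a m *c f (x m) *c x m" for m
        by (simp add: clin_scale[OF assms(1)] assms(7) mult.commute)
    qed (use clin_zero[OF assms(1)] in \<open>auto simp: cv.subspace_def\<close>)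
    then show "f y = 0" using assms(6) n by simp
  qed simp
  then have "card ?A \<le> card S"
    using cv.independent_span_bound[OF assms(2), of ?A] assms(3,5) by blast
  moreover have "card ?A = Suc (card S)"
    by (subst card_image) (simp_all add: inj_on_subset[OF inj subset_UNIV])
  ultimately show False by simp
qed

section \<open>Root \<open>sl_2\<close> triples and dominance of singular weights\<close>

context so_rep
begin

text \<open>The commutation relations of the \<open>sl_2\<close> triple \<open>F p q\<close>,
  \<open>F q p\<close>, \<open>F p p - F q q\<close> of a root.\<close>

lemma root_sl2:
  assumes p: "p \<in> index_set k" and q: "q \<in> index_set k" and "p \<noteq> q" "q \<noteq> - p"
  shows "F p q (F q p u) = F q p (F p q u) + (F p p u - F q q u)"
    "F p p (F q p u) - F q q (F q p u) = F q p (F p p u - F q q u) - 2 *c F q p u"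
proof -
  have pq: "p \<noteq> - q" "- p \<noteq> q" "- q \<noteq> p" using assms(4) by auto
  have nz: "p \<noteq> - p" "q \<noteq> - q" using p q by (auto simp: index_set_def)
  show "F p q (F q p u) = F q p (F p q u) + (F p p u - F q q u)"
    using F_comm[OF p q q p, of u] assms(3,4) pq by (auto simp: delta_def algebra_simps)
  have "F p p (F q p u) = F q p (F p p u) - F q p u"
    using F_comm[OF p p q p, of u] assms(3) pq nz by (auto simp: delta_def algebra_simps)
  moreover have "F q q (F q p u) = F q p (F q q u) + F q p u"
    using F_comm[OF q q q p, of u] assms(3) pq nz by (auto simp: delta_def algebra_simps)
  ultimately show "F p p (F q p u) - F q q (F q p u) = F q p (F p p u - F q q u) - 2 *c F q p u"
    by (simp add: clin_diff[OF F_clin[OF q p]] cscale_two)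
qed

text \<open>In the \<open>sl_2\<close> of the root, a highest weight vector of weight
  \<open>- 1\<close> generates an infinite string: raising its vector number \<open>n + 1\<close>
  gives \<open>- (n + 1)^2\<close> times vector number \<open>n\<close>, so none is 0, and the
  \<open>h\<close>-eigenvalues \<open>- 1 - 2 * n\<close> are all different.\<close>

lemma singular_wt_ne_minus_one:
  assumes "sing k F w" "has_wt k F \<kappa> w" "w \<noteq> 0" "w \<in> U" "inv_sub k F U" "finite S" "U \<subseteq> cv.span S"
    and p: "p \<in> index_set k" and q: "q \<in> index_set k" and "p < q" "q \<noteq> - p"
  shows "odd_ext \<kappa> p - odd_ext \<kappa> q \<noteq> - 1"
proof
  assume m1: "odd_ext \<kappa> p - odd_ext \<kappa> q = - 1"
  define h where "h u = F p p u - F q q u" for u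
  define x where "x n = (F q p ^^ n) w" for n
  have pq: "p \<noteq> q" using assms(10) by simp
  note sl2 = root_sl2[OF p q pq assms(11), folded h_def]
  have xS: "x (Suc n) = F q p (x n)" for n by (simp add: x_def)
  have xU: "x n \<in> U" for n
    by (induction n) (use assms(4) inv_subD(2)[OF assms(5) q p] in \<open>auto simp: x_def\<close>)
  have hcl: "clin h"
    unfolding h_def clin_def
    by (auto simp: clin_add[OF F_clin] clin_scale[OF F_clin] p q cv.scale_right_diff_distrib)
  have hx: "h (x n) = (- 1 - 2 * of_nat n) *c x n" for n
  proof (induction n)
    case 0
    have "h w = complex_of_real (odd_ext \<kappa> p - odd_ext \<kappa> q) *c w"
      using has_wt_diag[OF assms(2)] p q by (simp add: h_def cv.scale_left_diff_distrib)
    then show ?case using m1 by (simp add: x_def)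
  next
    case (Suc n)
    have "h (x (Suc n)) = (- 1 - 2 * of_nat n) *c x (Suc n) - 2 *c x (Suc n)"
      unfolding xS sl2(2) Suc by (simp add: clin_scale[OF F_clin[OF q p]] clin_diff[OF F_clin[OF q p]]
          cv.scale_left_diff_distrib clin_minus[OF F_clin[OF q p]])
    also have "\<dots> = (- 1 - 2 * of_nat (Suc n)) *c x (Suc n)"
      by (simp add: algebra_simps flip: cv.scale_left_diff_distrib)
    finally show ?case .
  qed
  have e0: "F p q (x 0) = 0" using assms(1,8,9,10) by (simp add: sing_def x_def)
  have ex: "F p q (x (Suc n)) = (- (of_nat (Suc n) ^ 2)) *c x n" for n
  proof (induction n)
    case 0
    show ?case unfolding xS[of 0] sl2(1) e0 hx using clin_zero[OF F_clin[OF q p]] by simp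
  next
    case (Suc n)
    have "F p q (x (Suc (Suc n))) = (- (of_nat (Suc n) ^ 2)) *c x (Suc n) + (- 1 - 2 * of_nat (Suc n)) *c x (Suc n)"
      unfolding xS[of "Suc n"] sl2(1) Suc hx clin_scale[OF F_clin[OF q p]] by (simp only: xS)
    also have "\<dots> = (- (of_nat (Suc (Suc n)) ^ 2)) *c x (Suc n)"
      unfolding cscale_left_distrib[symmetric] by (simp add: power2_eq_square algebra_simps)
    finally show ?case .
  qed
  have xn: "x n \<noteq> 0" for n
  proof (induction n)
    case 0
    then show ?case using assms(3) by (simp add: x_def)
  next
    case (Suc n)
    show ?case
    proof
      assume "x (Suc n) = 0"
      then have "(- (of_nat (Suc n) ^ 2)) *c x n = 0" using ex[of n] clin_zero[OF F_clin[OF p q]] by simp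
      then show False using Suc by (simp del: of_nat_Suc)
    qed
  qed
  show False
    by (rule eigenvectors_bound[OF hcl assms(6,7) _ xU xn hx]) (auto simp: inj_def)
qed

end

text \<open>A positive root pairs with \<lambda> to a natural number and with \<mu>_J to -1, 0 or 1.
  So -1 is the only value of the sum to be excluded, which is what the \<open>sl_2\<close> argument
  does.\<close>

lemma (in spin_tensor) singular_dominant:
  assumes "J \<subseteq> {1..k}" "w J \<noteq> 0" "finite S" "V \<subseteq> cv.span S"
  shows "dominant k (\<lambda>i. l i + spin_wt J i)"
  unfolding dominant_def
proof (intro allI impI)
  fix i j :: nat assume ij: "1 \<le> i" "i < j" "j \<le> k"
  let ?\<kappa> = "\<lambda>i. l i + spin_wt J i"
  note ne = t.singular_wt_ne_minus_one[OF w(2,3)[OF assms(1)] assms(2) w(1)[OF assms(1)] inv_V assms(3,4)]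
  have "- int j \<in> index_set k" "- int i \<in> index_set k" "int i \<in> index_set k" using ij by auto
  then have "?\<kappa> j - ?\<kappa> i \<noteq> - 1" "?\<kappa> j + ?\<kappa> i \<noteq> - 1"
    using ne[of "- int j" "- int i"] ne[of "- int j" "int i"] ij by auto
  moreover have "l j - l i \<in> \<nat>" "l j + l i \<in> \<nat>" using dom ij by (auto simp: dominant_def)
  then obtain a b where ab: "l j - l i = real a" "l j + l i = real b" by (auto elim!: Nats_cases)
  moreover have nat: "real a + x \<in> \<nat>" if "real a + x \<noteq> - 1" "x \<in> {- 1, 0, 1}" for a x
  proof -
    consider "x = 0" | "x = 1" | "x = - 1" "a \<noteq> 0" using \<open>real a + x \<noteq> - 1\<close> \<open>x \<in> {- 1, 0, 1}\<close> by auto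
    then show ?thesis
    proof cases
      case 2
      then have "real a + x = real (a + 1)" by simp
      then show ?thesis by (simp only: of_nat_in_Nats)
    next
      case 3
      then have "real a + x = real (a - 1)" by (simp add: of_nat_diff)
      then show ?thesis by (simp only: of_nat_in_Nats)
    qed simp
  qed
  moreover have "spin_wt J j - spin_wt J i \<in> {- 1, 0, 1}" "spin_wt J j + spin_wt J i \<in> {- 1, 0, 1}"
    by (auto simp: spin_wt_def)
  moreover have "?\<kappa> j - ?\<kappa> i = real a + (spin_wt J j - spin_wt J i)"
    "?\<kappa> j + ?\<kappa> i = real b + (spin_wt J j + spin_wt J i)" using ab by simp_all
  ultimately show "?\<kappa> j - ?\<kappa> i \<in> \<nat> \<and> ?\<kappa> j + ?\<kappa> i \<in> \<nat>" by metis
qed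

section \<open>Vectors of all lengths as functions with bounded support, and matrices as operators
  on them\<close>

definition supp_fun :: "nat \<Rightarrow> (nat \<Rightarrow> complex) set" where
  "supp_fun d = {f. \<forall>i. d \<le> i \<longrightarrow> f i = 0}"

definition mop :: "complex mat \<Rightarrow> (nat \<Rightarrow> complex) \<Rightarrow> nat \<Rightarrow> complex" where
  "mop A f = (\<lambda>i. if i < dim_row A then \<Sum>j<dim_col A. A $$ (i, j) * f j else 0)"

definition unit_fun :: "nat \<Rightarrow> nat \<Rightarrow> complex" where
  "unit_fun j = (\<lambda>i. if i = j then 1 else 0)"

definition mat_of :: "nat \<Rightarrow> nat \<Rightarrow> ((nat \<Rightarrow> complex) \<Rightarrow> nat \<Rightarrow> complex) \<Rightarrow> complex mat" where
  "mat_of a b g = mat a b (\<lambda>(i, j). g (unit_fun j) i)"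

lemma supp_fun_subspace: "cv.subspace (supp_fun d)"
  by (auto simp: cv.subspace_def supp_fun_def cscale_complex_def)

lemma unit_fun_mem: "j < d \<Longrightarrow> unit_fun j \<in> supp_fun d"
  by (auto simp: supp_fun_def unit_fun_def)

lemma supp_fun_eq_sum:
  assumes "f \<in> supp_fun d"
  shows "f = (\<Sum>j<d. f j *c unit_fun j)"
proof
  fix i
  have "(\<Sum>j<d. f j *c unit_fun j) i = (\<Sum>j<d. if j = i then f i else 0)"
    unfolding sum_fun_apply by (intro sum.cong) (auto simp: unit_fun_def cscale_complex_def)
  also have "\<dots> = f i" using assms by (auto simp: supp_fun_def)
  finally show "f i = (\<Sum>j<d. f j *c unit_fun j) i" ..
qed

lemma mop_clin: "clin (mop A)"
  by (auto simp: clin_def mop_def fun_eq_iff cscale_complex_def algebra_simps sum.distrib sum_distrib_left)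

lemma mop_mem: "A \<in> carrier_mat a b \<Longrightarrow> mop A f \<in> supp_fun a"
  by (auto simp: mop_def supp_fun_def)

lemma mop_add: "A \<in> carrier_mat a b \<Longrightarrow> B \<in> carrier_mat a b \<Longrightarrow> mop (A + B) f = mop A f + mop B f"
  by (auto simp: mop_def fun_eq_iff algebra_simps sum.distrib)

lemma mop_smult: "mop (c \<cdot>\<^sub>m A) f = c *c mop A f"
  by (auto simp: mop_def fun_eq_iff cscale_complex_def sum_distrib_left algebra_simps)

lemma mop_minus: "A \<in> carrier_mat a b \<Longrightarrow> B \<in> carrier_mat a b \<Longrightarrow> mop (A - B) f = mop A f - mop B f"
  by (auto simp: mop_def fun_eq_iff algebra_simps sum_subtractf)

lemma mop_mult:
  assumes "A \<in> carrier_mat a b" "B \<in> carrier_mat b c"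
  shows "mop (A * B) f = mop A (mop B f)"
proof
  fix i
  show "mop (A * B) f i = mop A (mop B f) i"
  proof (cases "i < a")
    case True
    have "mop (A * B) f i = (\<Sum>j<c. \<Sum>m<b. A $$ (i, m) * B $$ (m, j) * f j)"
      using assms True by (auto simp: mop_def scalar_prod_def sum_distrib_right atLeast0LessThan intro!: sum.cong)
    also have "\<dots> = (\<Sum>m<b. \<Sum>j<c. A $$ (i, m) * B $$ (m, j) * f j)" by (rule sum.swap)
    also have "\<dots> = mop A (mop B f) i"
      using assms True by (auto simp: mop_def sum_distrib_left mult.assoc intro!: sum.cong)
    finally show ?thesis .
  qed (use assms in \<open>auto simp: mop_def\<close>)
qed

lemma mop_unit: "A \<in> carrier_mat a b \<Longrightarrow> j < b \<Longrightarrow> i < a \<Longrightarrow> mop A (unit_fun j) i = A $$ (i, j)"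
proof -
  assume a: "A \<in> carrier_mat a b" "j < b" "i < a"
  have "mop A (unit_fun j) i = (\<Sum>m<b. A $$ (i, m) * unit_fun j m)"
    using a by (simp add: mop_def)
  also have "\<dots> = (\<Sum>m<b. if m = j then A $$ (i, j) else 0)"
    by (intro sum.cong) (auto simp: unit_fun_def)
  finally show ?thesis using a by simp
qed

lemma mop_eqI:
  assumes "A \<in> carrier_mat a b" "B \<in> carrier_mat a b" "\<And>f. f \<in> supp_fun b \<Longrightarrow> mop A f = mop B f"
  shows "A = B"
proof (rule eq_matI)
  fix i j assume "i < dim_row B" "j < dim_col B"
  then have "i < a" "j < b" using assms(2) by auto
  then show "A $$ (i, j) = B $$ (i, j)"
    using mop_unit[OF assms(1)] mop_unit[OF assms(2)] assms(3)[OF unit_fun_mem] by metis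
qed (use assms in auto)

lemma mop_one: "f \<in> supp_fun d \<Longrightarrow> mop (1\<^sub>m d) f = f"
proof
  fix i assume f: "f \<in> supp_fun d"
  have "(\<Sum>j<d. 1\<^sub>m d $$ (i, j) * f j) = (\<Sum>j<d. if j = i then f i else 0)" if "i < d"
    using that by (intro sum.cong) auto
  then show "mop (1\<^sub>m d) f i = f i" using f by (auto simp: mop_def supp_fun_def)
qed

lemma mop_mat_of:
  assumes "f \<in> supp_fun b" "\<And>x y. x \<in> supp_fun b \<Longrightarrow> y \<in> supp_fun b \<Longrightarrow> g (x + y) = g x + g y"
    "\<And>c x. x \<in> supp_fun b \<Longrightarrow> g (c *c x) = c *c g x" "\<And>x. x \<in> supp_fun b \<Longrightarrow> g x \<in> supp_fun a"
  shows "mop (mat_of a b g) f = g f"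
proof -
  have z: "g 0 = 0"
    using assms(3)[OF assms(1), of 0] by simp
  have "g (\<Sum>j\<in>A. f j *c unit_fun j) = (\<Sum>j\<in>A. f j *c g (unit_fun j))" if "A \<subseteq> {..<b}" for A
    using finite_subset[OF that finite_lessThan] that
  proof (induction A rule: finite_induct)
    case (insert j A)
    have m: "(\<Sum>j\<in>A. f j *c unit_fun j) \<in> supp_fun b"
      using insert.prems by (intro cv.subspace_sum[OF supp_fun_subspace] cv.subspace_scale[OF supp_fun_subspace] unit_fun_mem) auto
    have u: "unit_fun j \<in> supp_fun b" using insert.prems by (simp add: unit_fun_mem)
    then have cu: "f j *c unit_fun j \<in> supp_fun b" by (rule cv.subspace_scale[OF supp_fun_subspace])
    have IH: "g (\<Sum>j\<in>A. f j *c unit_fun j) = (\<Sum>j\<in>A. f j *c g (unit_fun j))"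
      using insert.IH insert.prems by blast
    show ?case
      unfolding sum.insert[OF insert.hyps] assms(2)[OF cu m] assms(3)[OF u] IH ..
  qed (simp add: z)
  from this[of "{..<b}"] have g: "g f = (\<Sum>j<b. f j *c g (unit_fun j))"
    using supp_fun_eq_sum[OF assms(1)] by (metis order_refl)
  show ?thesis
  proof
    fix i
    show "mop (mat_of a b g) f i = g f i"
    proof (cases "i < a")
      case True
      then show ?thesis
        unfolding g sum_fun_apply by (auto simp: mop_def mat_of_def cscale_complex_def mult.commute intro!: sum.cong)
    next
      case False
      then show ?thesis using assms(4)[OF assms(1)] by (simp add: mop_def mat_of_def supp_fun_def)
    qed
  qed
qed

text \<open>\<open>A * B\<close> and \<open>B * A\<close> have the same trace, and the traces of the
  two identity matrices are \<open>a\<close> and \<open>b\<close>.\<close>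

lemma inverse_mats_square:
  fixes A B :: "complex mat"
  assumes "A \<in> carrier_mat a b" "B \<in> carrier_mat b a" "A * B = 1\<^sub>m a" "B * A = 1\<^sub>m b"
  shows "a = b"
proof -
  have "of_nat a = (\<Sum>i<a. (A * B) $$ (i, i))" using assms(3) by simp
  also have "\<dots> = (\<Sum>i<a. \<Sum>j<b. A $$ (i, j) * B $$ (j, i))"
    using assms(1,2) by (intro sum.cong) (auto simp: scalar_prod_def atLeast0LessThan)
  also have "\<dots> = (\<Sum>j<b. \<Sum>i<a. A $$ (i, j) * B $$ (j, i))" by (rule sum.swap)
  also have "\<dots> = (\<Sum>j<b. (B * A) $$ (j, j))"
    using assms(1,2) by (intro sum.cong) (auto simp: scalar_prod_def atLeast0LessThan mult.commute)
  also have "\<dots> = of_nat b" using assms(4) by simp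
  finally show ?thesis by (simp only: of_nat_eq_iff)
qed

section \<open>Matrices of the orthogonal Lie algebra\<close>

text \<open>Positions are counted from the end: \<open>- i\<close> becomes coordinate
  \<open>n - i\<close>, in \<open>E\<close>, and \<open>i\<close> becomes \<open>n - i + n\<close>,
  in the dual, so negating a signed index exchanges dual basis vectors.\<close>

definition idx :: "nat \<Rightarrow> int \<Rightarrow> nat" where
  "idx n p = nat (if p < 0 then int n + p else 2 * int n - p)"

lemma idx_neg: "i \<le> n \<Longrightarrow> 0 < i \<Longrightarrow> idx n (- int i) = n - i"
  by (simp add: idx_def nat_diff_distrib flip: of_nat_diff)

lemma idx_pos: "i \<le> n \<Longrightarrow> idx n (int i) = n - i + n"
  by (simp add: idx_def)

lemma idx_bij: "bij_betw (idx n) (index_set n) {..<2 * n}"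
proof (rule bij_betw_byWitness[where f' = "\<lambda>a. if a < n then int a - int n else 2 * int n - int a"])
qed (auto simp: idx_def index_set_def nat_less_iff)

lemma idx_less: "p \<in> index_set n \<Longrightarrow> idx n p < 2 * n"
  using idx_bij by (auto simp: bij_betw_def)

lemma idx_eq_iff: "p \<in> index_set n \<Longrightarrow> q \<in> index_set n \<Longrightarrow> idx n p = idx n q \<longleftrightarrow> p = q"
  using idx_bij by (auto simp: bij_betw_def inj_on_def)

lemma sum_idx: "(\<Sum>a<2 * n. f a) = (\<Sum>p\<in>index_set n. f (idx n p))"
  by (rule sum.reindex_bij_betw[OF idx_bij, symmetric])

lemma mat_idx_eqI:
  assumes "A \<in> carrier_mat (2 * n) (2 * n)" "B \<in> carrier_mat (2 * n) (2 * n)"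
    "\<And>p q. p \<in> index_set n \<Longrightarrow> q \<in> index_set n \<Longrightarrow> A $$ (idx n p, idx n q) = B $$ (idx n p, idx n q)"
  shows "A = B"
proof (rule eq_matI)
  fix i j assume "i < dim_row B" "j < dim_col B"
  then have "i \<in> idx n ` index_set n" "j \<in> idx n ` index_set n"
    using assms(2) bij_betw_imp_surj_on[OF idx_bij, of n] by auto
  then show "A $$ (i, j) = B $$ (i, j)" using assms(3) by auto
qed (use assms in auto)

lemma sum_index_set_uminus: "(\<Sum>p\<in>index_set n. f (- p)) = (\<Sum>p\<in>index_set n. f p)"
  by (rule sum.reindex_bij_witness[where i = uminus and j = uminus]) auto

lemma sym_form_idx:
  assumes "x \<in> carrier_vec (2 * n)" "y \<in> carrier_vec (2 * n)"
  shows "sym_form n x y = (\<Sum>p\<in>index_set n. x $ idx n p * y $ idx n (- p))"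
proof -
  have "(\<Sum>p\<in>index_set n. x $ idx n p * y $ idx n (- p)) =
    (\<Sum>i\<in>{1..n}. x $ (n - i) * y $ (n - i + n) + x $ (n - i + n) * y $ (n - i))"
    unfolding sum_index_set by (intro sum.cong) (auto simp: idx_neg idx_pos)
  also have "\<dots> = (\<Sum>i<n. x $ i * y $ (i + n) + x $ (i + n) * y $ i)"
    by (rule sum.reindex_bij_witness[where i = "\<lambda>i. n - i" and j = "\<lambda>i. n - i"]) auto
  finally show ?thesis by (simp add: sym_form_def sum.distrib)
qed

lemma sym_form_action:
  assumes X: "X \<in> carrier_mat (2 * n) (2 * n)" and x: "x \<in> carrier_vec (2 * n)" and y: "y \<in> carrier_vec (2 * n)"
  shows "sym_form n (X *\<^sub>v x) y + sym_form n x (X *\<^sub>v y) =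
    (\<Sum>p\<in>index_set n. \<Sum>q\<in>index_set n. x $ idx n q * y $ idx n (- p) *
      (X $$ (idx n p, idx n q) + X $$ (idx n (- q), idx n (- p))))"
proof -
  let ?K = "index_set n"
  have e: "(X *\<^sub>v z) $ idx n p = (\<Sum>q\<in>?K. X $$ (idx n p, idx n q) * z $ idx n q)"
    if "z \<in> carrier_vec (2 * n)" "p \<in> ?K" for z p
    using X that idx_less[OF that(2)]
    by (simp add: mult_mat_vec_def scalar_prod_def atLeast0LessThan sum_idx idx_less cong: sum.cong)
  have m: "X *\<^sub>v z \<in> carrier_vec (2 * n)" if "z \<in> carrier_vec (2 * n)" for z
    using X that by simp
  have "sym_form n x (X *\<^sub>v y) = (\<Sum>p\<in>?K. \<Sum>q\<in>?K. x $ idx n p * (X $$ (idx n (- p), idx n q) * y $ idx n q))"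
    by (simp add: sym_form_idx x m y e sum_distrib_left)
  also have "\<dots> = (\<Sum>p\<in>?K. \<Sum>q\<in>?K. x $ idx n p * (X $$ (idx n (- p), idx n (- q)) * y $ idx n (- q)))"
    by (rule sum.cong[OF refl], rule sum_index_set_uminus[symmetric])
  also have "\<dots> = (\<Sum>q\<in>?K. \<Sum>p\<in>?K. x $ idx n p * (X $$ (idx n (- p), idx n (- q)) * y $ idx n (- q)))"
    by (rule sum.swap)
  finally have 2: "sym_form n x (X *\<^sub>v y) =
    (\<Sum>p\<in>?K. \<Sum>q\<in>?K. x $ idx n q * (X $$ (idx n (- q), idx n (- p)) * y $ idx n (- p)))" .
  have 1: "sym_form n (X *\<^sub>v x) y = (\<Sum>p\<in>?K. \<Sum>q\<in>?K. X $$ (idx n p, idx n q) * x $ idx n q * y $ idx n (- p))"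
    by (simp add: sym_form_idx x m y e sum_distrib_right)
  show ?thesis
    unfolding 1 2 sum.distrib[symmetric] by (intro sum.cong refl) (simp add: algebra_simps)
qed

text \<open>Testing the form on pairs of unit vectors shows that membership means skewness under the
  reflection exchanging \<open>(p, q)\<close> with \<open>(- q, - p)\<close>.\<close>

lemma orth_iff:
  "X \<in> orth n \<longleftrightarrow> X \<in> carrier_mat (2 * n) (2 * n) \<and>
    (\<forall>p\<in>index_set n. \<forall>q\<in>index_set n. X $$ (idx n (- q), idx n (- p)) = - X $$ (idx n p, idx n q))"
proof (cases "X \<in> carrier_mat (2 * n) (2 * n)")
  case True
  have "X $$ (idx n (- q), idx n (- p)) = - X $$ (idx n p, idx n q)"
    if o: "X \<in> orth n" and p: "p \<in> index_set n" and q: "q \<in> index_set n" for p q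
  proof -
    let ?x = "unit_vec (2 * n) (idx n q)" and ?y = "unit_vec (2 * n) (idx n (- p))"
    have u: "unit_vec (2 * n) (idx n a) $ idx n b = (if a = b then 1 else 0 :: complex)"
      if "a \<in> index_set n" "b \<in> index_set n" for a b
      using that idx_less by (auto simp: unit_vec_def idx_eq_iff)
    have "0 = (\<Sum>a\<in>index_set n. \<Sum>b\<in>index_set n. ?x $ idx n b * ?y $ idx n (- a) *
      (X $$ (idx n a, idx n b) + X $$ (idx n (- b), idx n (- a))))"
      using o sym_form_action[OF True, of ?x ?y] by (simp add: orth_def)
    also have "\<dots> = (\<Sum>a\<in>index_set n. \<Sum>b\<in>index_set n. if b = q then if a = p then
      (X $$ (idx n p, idx n q) + X $$ (idx n (- q), idx n (- p))) else 0 else 0)"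
      using p q by (intro sum.cong refl) (auto simp: u)
    also have "\<dots> = X $$ (idx n p, idx n q) + X $$ (idx n (- q), idx n (- p))"
      using p q by simp
    finally show ?thesis by (simp add: eq_neg_iff_add_eq_0 add.commute)
  qed
  moreover have "X \<in> orth n"
    if "\<forall>p\<in>index_set n. \<forall>q\<in>index_set n. X $$ (idx n (- q), idx n (- p)) = - X $$ (idx n p, idx n q)"
    using True that by (simp add: orth_def sym_form_action)
  ultimately show ?thesis using True by blast
qed (simp add: orth_def)

definition xmat :: "nat \<Rightarrow> int \<Rightarrow> int \<Rightarrow> complex mat" where
  "xmat n p q = elem_mat n (idx n p) (idx n q) - elem_mat n (idx n (- q)) (idx n (- p))"

lemma xmat_carrier [simp]: "xmat n p q \<in> carrier_mat (2 * n) (2 * n)"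
  by (auto simp: xmat_def elem_mat_def intro: minus_carrier_mat)

lemma xmat_dim [simp]: "dim_row (xmat n p q) = 2 * n" "dim_col (xmat n p q) = 2 * n"
  using carrier_matD[OF xmat_carrier[of n p q]] by simp_all

lemma xmat_entry:
  assumes "p \<in> index_set n" "q \<in> index_set n" "x \<in> index_set n" "y \<in> index_set n"
  shows "xmat n p q $$ (idx n x, idx n y) = delta p x * delta q y - delta (- q) x * delta (- p) y"
proof -
  have e: "elem_mat n (idx n a) (idx n b) $$ (idx n x, idx n y) = delta a x * delta b y"
    if "a \<in> index_set n" "b \<in> index_set n" for a b
  proof -
    have "idx n x = idx n a \<longleftrightarrow> a = x" "idx n y = idx n b \<longleftrightarrow> b = y"
      using idx_eq_iff that assms(3,4) by blast+
    then show ?thesis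
      using idx_less[OF assms(3)] idx_less[OF assms(4)] by (simp add: elem_mat_def delta_def)
  qed
  have "xmat n p q $$ (idx n x, idx n y) = elem_mat n (idx n p) (idx n q) $$ (idx n x, idx n y)
    - elem_mat n (idx n (- q)) (idx n (- p)) $$ (idx n x, idx n y)"
    unfolding xmat_def using idx_less[OF assms(3)] idx_less[OF assms(4)]
    by (intro index_minus_mat(1)) (simp_all add: elem_mat_def)
  then show ?thesis using assms by (simp add: e)
qed

lemma delta_uminus: "delta (- p) (- q) = delta p q"
  by (simp add: delta_def)

lemma delta_uminus_left: "delta (- p) q = delta p (- q)"
  by (auto simp: delta_def)

lemma delta_commute: "delta p q = delta q p"
  by (auto simp: delta_def)

lemma xmat_orth:
  assumes "p \<in> index_set n" "q \<in> index_set n"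
  shows "xmat n p q \<in> orth n"
  unfolding orth_iff using assms
  by (simp add: xmat_entry delta_uminus delta_uminus_left)

lemma mult_entry:
  assumes "A \<in> carrier_mat (2 * n) (2 * n)" "B \<in> carrier_mat (2 * n) (2 * n)" "x \<in> index_set n" "y \<in> index_set n"
  shows "(A * B) $$ (idx n x, idx n y) = (\<Sum>z\<in>index_set n. A $$ (idx n x, idx n z) * B $$ (idx n z, idx n y))"
  using assms idx_less[of x n] idx_less[of y n]
  by (simp add: scalar_prod_def atLeast0LessThan sum_idx idx_less cong: sum.cong)

lemma xmat_mult_entry:
  assumes "p \<in> index_set n" "q \<in> index_set n" "r \<in> index_set n" "s \<in> index_set n"
    "x \<in> index_set n" "y \<in> index_set n"
  shows "(xmat n p q * xmat n r s) $$ (idx n x, idx n y) =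
    delta p x * delta q r * delta s y - delta p x * delta (- q) s * delta (- r) y
    - delta (- q) x * delta (- p) r * delta s y + delta (- q) x * delta p s * delta (- r) y"
proof -
  let ?K = "index_set n"
  have d: "(\<Sum>z\<in>?K. delta a z * g z) = g a" if "a \<in> ?K" for a and g :: "int \<Rightarrow> complex"
  proof -
    have "(\<Sum>z\<in>?K. delta a z * g z) = (\<Sum>z\<in>?K. if z = a then g a else 0)"
      by (intro sum.cong) (auto simp: delta_def)
    then show ?thesis using that by simp
  qed
  have "(xmat n p q * xmat n r s) $$ (idx n x, idx n y) = (\<Sum>z\<in>?K.
    delta q z * (delta p x * (delta r z * delta s y - delta (- s) z * delta (- r) y)) -
    delta (- p) z * (delta (- q) x * (delta r z * delta s y - delta (- s) z * delta (- r) y)))"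
    unfolding mult_entry[OF xmat_carrier xmat_carrier assms(5,6)]
    using assms by (intro sum.cong refl) (simp add: xmat_entry algebra_simps)
  also have "\<dots> = delta p x * (delta r q * delta s y - delta (- s) q * delta (- r) y) -
     delta (- q) x * (delta r (- p) * delta s y - delta (- s) (- p) * delta (- r) y)"
    using assms by (simp only: sum_subtractf d uminus_in_index_set)
  finally show ?thesis
    by (simp add: algebra_simps delta_commute[of r q] delta_commute[of "- s" q] delta_commute[of r "- p"]
        delta_uminus delta_commute[of s p] delta_uminus_left[of q s] delta_commute[of "- s"])
qed

lemma bracket_xmat:
  assumes "p \<in> index_set n" "q \<in> index_set n" "r \<in> index_set n" "s \<in> index_set n"
  shows "bracket (xmat n p q) (xmat n r s) =
    delta q r \<cdot>\<^sub>m xmat n p s + (- delta p s) \<cdot>\<^sub>m xmat n r q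
    + (- delta (- p) r) \<cdot>\<^sub>m xmat n (- q) s + delta (- q) s \<cdot>\<^sub>m xmat n r (- p)"
proof (rule mat_idx_eqI)
  fix x y assume xy: "x \<in> index_set n" "y \<in> index_set n"
  have c: "xmat n a b * xmat n a' b' \<in> carrier_mat (2 * n) (2 * n)" for a b a' b'
    by (rule mult_carrier_mat[OF xmat_carrier xmat_carrier])
  show "bracket (xmat n p q) (xmat n r s) $$ (idx n x, idx n y) =
    (delta q r \<cdot>\<^sub>m xmat n p s + (- delta p s) \<cdot>\<^sub>m xmat n r q
    + (- delta (- p) r) \<cdot>\<^sub>m xmat n (- q) s + delta (- q) s \<cdot>\<^sub>m xmat n r (- p)) $$ (idx n x, idx n y)"
  proof -
    have dims: "idx n x < 2 * n" "idx n y < 2 * n" using xy idx_less by auto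
    have b: "bracket (xmat n p q) (xmat n r s) $$ (idx n x, idx n y) =
      (xmat n p q * xmat n r s) $$ (idx n x, idx n y) - (xmat n r s * xmat n p q) $$ (idx n x, idx n y)"
      unfolding bracket_def using dims c[of r s p q] by (intro index_minus_mat(1)) auto
    show ?thesis
      unfolding b xmat_mult_entry[OF assms xy] xmat_mult_entry[OF assms(3,4,1,2) xy]
      using dims assms xy
      by (simp add: xmat_entry)
        (simp add: algebra_simps delta_uminus delta_uminus_left delta_commute[of r q] delta_commute[of s p]
          delta_commute[of r "- p"] delta_commute[of s "- q"])
  qed
qed (auto simp: bracket_def intro!: add_carrier_mat minus_carrier_mat mult_carrier_mat[OF xmat_carrier xmat_carrier])

lemma orth_add: "X \<in> orth n \<Longrightarrow> Y \<in> orth n \<Longrightarrow> X + Y \<in> orth n"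
  unfolding orth_iff using idx_less by auto

lemma orth_smult: "X \<in> orth n \<Longrightarrow> c \<cdot>\<^sub>m X \<in> orth n"
  unfolding orth_iff using idx_less by auto

text \<open>By skewness \<open>X\<close> is half the sum of all \<open>e p q\<close> times
  \<open>xmat n p q\<close>, where every basis element occurs twice. Statements compatible with
  linear combinations thus reduce to the \<open>xmat\<close>.\<close>

lemma orth_induct [consumes 2, case_names xmat smult add]:
  assumes "1 \<le> n" "X \<in> orth n"
    and P: "\<And>p q. p \<in> index_set n \<Longrightarrow> q \<in> index_set n \<Longrightarrow> P (xmat n p q)"
    "\<And>c X. X \<in> orth n \<Longrightarrow> P X \<Longrightarrow> P (c \<cdot>\<^sub>m X)"
    "\<And>X Y. X \<in> orth n \<Longrightarrow> Y \<in> orth n \<Longrightarrow> P X \<Longrightarrow> P Y \<Longrightarrow> P (X + Y)"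
  shows "P X"
proof -
  let ?K = "index_set n"
  have one: "1 \<in> ?K" using assms(1) by (auto simp: index_set_def)
  define e where "e p q = X $$ (idx n p, idx n q)" for p q
  have "\<exists>M. M \<in> orth n \<and> P M \<and> (\<forall>x\<in>?K. \<forall>y\<in>?K. M $$ (idx n x, idx n y) =
    (\<Sum>(p, q)\<in>A. e p q / 2 * (delta p x * delta q y - delta (- q) x * delta (- p) y)))"
    if "finite A" "A \<subseteq> ?K \<times> ?K" for A
    using that
  proof (induction A rule: finite_induct)
    case empty
    \<comment> \<open>The empty sum is written as 0 times an \<open>xmat\<close>, for which
      \<open>1 \<le> n\<close> provides the index.\<close>
    have "0 \<cdot>\<^sub>m xmat n 1 1 \<in> orth n \<and> P (0 \<cdot>\<^sub>m xmat n 1 1) \<and>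
      (\<forall>x\<in>?K. \<forall>y\<in>?K. (0 \<cdot>\<^sub>m xmat n 1 1) $$ (idx n x, idx n y) = 0)"
      using one xmat_orth[OF one one] P(1)[OF one one] P(2) idx_less
      by (auto intro: orth_smult)
    then show ?case by auto
  next
    case (insert pq A)
    obtain p q where pq: "pq = (p, q)" "p \<in> ?K" "q \<in> ?K" using insert.prems by auto
    obtain M where M: "M \<in> orth n" "P M" "\<forall>x\<in>?K. \<forall>y\<in>?K. M $$ (idx n x, idx n y) =
      (\<Sum>(p, q)\<in>A. e p q / 2 * (delta p x * delta q y - delta (- q) x * delta (- p) y))"
      using insert by auto
    let ?Y = "(e p q / 2) \<cdot>\<^sub>m xmat n p q"
    have Y: "?Y \<in> orth n" "P ?Y" using xmat_orth[OF pq(2,3)] P(1)[OF pq(2,3)] P(2) by (auto intro: orth_smult)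
    have "(?Y + M) $$ (idx n x, idx n y) =
      (\<Sum>(p, q)\<in>insert pq A. e p q / 2 * (delta p x * delta q y - delta (- q) x * delta (- p) y))"
      if "x \<in> ?K" "y \<in> ?K" for x y
    proof -
      have "M \<in> carrier_mat (2 * n) (2 * n)" using M(1) by (simp add: orth_iff)
      then show ?thesis
        using that M(3) insert.hyps pq idx_less[OF that(1)] idx_less[OF that(2)]
        by (simp add: xmat_entry)
    qed
    then show ?case using P(3)[OF Y(1) M(1) Y(2) M(2)] orth_add[OF Y(1) M(1)] by blast
  qed
  from this[of "?K \<times> ?K"] obtain M where M: "M \<in> orth n" "P M"
    "\<And>x y. x \<in> ?K \<Longrightarrow> y \<in> ?K \<Longrightarrow> M $$ (idx n x, idx n y) =
    (\<Sum>(p, q)\<in>?K \<times> ?K. e p q / 2 * (delta p x * delta q y - delta (- q) x * delta (- p) y))"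
    by auto
  have "M = X"
  proof (rule mat_idx_eqI)
    show "M \<in> carrier_mat (2 * n) (2 * n)" "X \<in> carrier_mat (2 * n) (2 * n)"
      using M(1) assms(2) by (simp_all add: orth_iff)
    fix x y assume xy: "x \<in> ?K" "y \<in> ?K"
    have "M $$ (idx n x, idx n y) = (\<Sum>p\<in>?K. \<Sum>q\<in>?K. e p q / 2 * (delta p x * delta q y - delta (- q) x * delta (- p) y))"
      unfolding M(3)[OF xy] by (simp add: sum.cartesian_product)
    also have "\<dots> = (\<Sum>p\<in>?K. \<Sum>q\<in>?K. (if q = y then if p = x then e x y / 2 else 0 else 0) -
        (if q = - x then if p = - y then e (- y) (- x) / 2 else 0 else 0))"
      by (intro sum.cong refl) (auto simp: delta_def)
    also have "\<dots> = e x y / 2 - e (- y) (- x) / 2"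
      using xy by (simp add: sum_subtractf)
    also have "\<dots> = X $$ (idx n x, idx n y)"
      using assms(2) xy by (simp add: orth_iff e_def)
    finally show "M $$ (idx n x, idx n y) = X $$ (idx n x, idx n y)" .
  qed
  then show ?thesis using M(2) by simp
qed

section \<open>From matrix representations to \<open>so_rep\<close>\<close>

definition repF :: "nat \<Rightarrow> rep \<Rightarrow> int \<Rightarrow> int \<Rightarrow> (nat \<Rightarrow> complex) \<Rightarrow> nat \<Rightarrow> complex" where
  "repF n V p q = mop (act V (xmat n p q))"

definition fun_of :: "complex vec \<Rightarrow> nat \<Rightarrow> complex" where
  "fun_of v = (\<lambda>i. if i < dim_vec v then v $ i else 0)"

lemma fun_of_mem: "v \<in> carrier_vec d \<Longrightarrow> fun_of v \<in> supp_fun d"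
  by (auto simp: fun_of_def supp_fun_def)

lemma fun_of_vec: "f \<in> supp_fun d \<Longrightarrow> fun_of (vec d f) = f"
  by (auto simp: fun_of_def supp_fun_def fun_eq_iff)

lemma vec_fun_of: "v \<in> carrier_vec d \<Longrightarrow> vec d (fun_of v) = v"
  by (auto simp: fun_of_def)

lemma fun_of_inj: "v \<in> carrier_vec d \<Longrightarrow> w \<in> carrier_vec d \<Longrightarrow> fun_of v = fun_of w \<Longrightarrow> v = w"
  using vec_fun_of by metis

lemma fun_of_zero: "fun_of (0\<^sub>v d) = 0"
  by (auto simp: fun_of_def fun_eq_iff)

lemma fun_of_smult: "fun_of (c \<cdot>\<^sub>v v) = c *c fun_of v"
  by (auto simp: fun_of_def fun_eq_iff cscale_complex_def)

lemma fun_of_mult: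
  assumes "A \<in> carrier_mat a b" "v \<in> carrier_vec b"
  shows "fun_of (A *\<^sub>v v) = mop A (fun_of v)"
  using assms by (auto simp: fun_of_def mop_def fun_eq_iff scalar_prod_def atLeast0LessThan)

lemma so_rep_repF:
  assumes "is_rep n V"
  shows "so_rep n (repF n V)"
proof
  let ?d = "rdim V"
  have c: "act V X \<in> carrier_mat ?d ?d" if "X \<in> orth n" for X
    using assms that by (simp add: is_rep_def)
  have add: "act V (X + Y) = act V X + act V Y" if "X \<in> orth n" "Y \<in> orth n" for X Y
    using assms that by (simp add: is_rep_def)
  have sm: "act V (a \<cdot>\<^sub>m X) = a \<cdot>\<^sub>m act V X" if "X \<in> orth n" for a X
    using assms that by (simp add: is_rep_def)
  show "clin (repF n V p q)" for p q by (simp add: repF_def mop_clin)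
  fix p q u assume pq: "p \<in> index_set n" "q \<in> index_set n"
  have "xmat n (- q) (- p) = (- 1) \<cdot>\<^sub>m xmat n p q"
    by (rule mat_idx_eqI) (use pq idx_less in \<open>auto simp: xmat_entry delta_commute\<close>)
  then show "repF n V (- q) (- p) u = - repF n V p q u"
    using sm[OF xmat_orth[OF pq], of "- 1"] by (simp add: repF_def mop_smult)
next
  fix p q r s u
  assume i: "p \<in> index_set n" "q \<in> index_set n" "r \<in> index_set n" "s \<in> index_set n"
  let ?d = "rdim V"
  have c: "act V X \<in> carrier_mat ?d ?d" if "X \<in> orth n" for X
    using assms that by (simp add: is_rep_def)
  have add: "mop (act V (X + Y)) f = mop (act V X) f + mop (act V Y) f" if "X \<in> orth n" "Y \<in> orth n" for X Y f
    using assms that mop_add[OF c[OF that(1)] c[OF that(2)]] by (simp add: is_rep_def)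
  have sm: "mop (act V (a \<cdot>\<^sub>m X)) f = a *c mop (act V X) f" if "X \<in> orth n" for a X f
    using assms that by (simp add: is_rep_def mop_smult)
  have o: "xmat n a b \<in> orth n" if "a \<in> index_set n" "b \<in> index_set n" for a b
    by (rule xmat_orth[OF that])
  have oo: "xmat n p q \<in> orth n" "xmat n r s \<in> orth n" using o i by blast+
  have "repF n V p q (repF n V r s u) - repF n V r s (repF n V p q u) =
    mop (bracket (act V (xmat n p q)) (act V (xmat n r s))) u"
    unfolding bracket_def repF_def
    using c[OF oo(1)] c[OF oo(2)] by (simp add: mop_minus[of _ ?d ?d] mop_mult[of _ ?d ?d _ ?d])
  also have "\<dots> = mop (act V (bracket (xmat n p q) (xmat n r s))) u"
    using assms oo by (simp add: is_rep_def)
  also have "\<dots> = delta q r *c repF n V p s u + (- delta p s) *c repF n V r q u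
    + (- delta (- p) r) *c repF n V (- q) s u + delta (- q) s *c repF n V r (- p) u"
    unfolding bracket_xmat[OF i] repF_def
    using i by (simp only: add sm o orth_add orth_smult uminus_in_index_set)
  finally show "repF n V p q (repF n V r s u) - repF n V r s (repF n V p q u) =
        delta q r *c repF n V p s u - delta p s *c repF n V r q u
        - delta (- p) r *c repF n V (- q) s u + delta (- q) s *c repF n V r (- p) u"
    by (simp only: cv.scale_minus_left add_uminus_conv_diff)
qed

lemma cartan_eq_xmat:
  assumes "i \<in> {1..n}"
  shows "cartan n (n - i) = xmat n (- int i) (- int i)"
  using assms by (auto simp: cartan_def xmat_def idx_neg idx_pos)

definition root_of :: "nat \<Rightarrow> int \<Rightarrow> int \<Rightarrow> complex vec" where
  "root_of n p q = vec n (\<lambda>i. (delta (- int (n - i)) p - delta (int (n - i)) p)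
     - (delta (- int (n - i)) q - delta (int (n - i)) q))"

lemma xmat_root_space:
  assumes p: "p \<in> index_set n" and q: "q \<in> index_set n"
  shows "xmat n p q \<in> root_space n (root_of n p q)"
  unfolding root_space_def
proof (intro CollectI conjI allI impI)
  show "xmat n p q \<in> orth n" by (rule xmat_orth[OF p q])
  fix i assume i: "i < n"
  define j where "j = n - i"
  have j: "j \<in> {1..n}" "n - j = i" using i by (auto simp: j_def)
  have K: "- int j \<in> index_set n" using j by simp
  have "bracket (cartan n i) (xmat n p q) = bracket (xmat n (- int j) (- int j)) (xmat n p q)"
    using cartan_eq_xmat[OF j(1)] j(2) by simp
  also have "\<dots> = root_of n p q $ i \<cdot>\<^sub>m xmat n p q"
    unfolding bracket_xmat[OF K K p q]
  proof (rule mat_idx_eqI)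
    fix x y assume "x \<in> index_set n" "y \<in> index_set n"
    then have d: "idx n x < 2 * n" "idx n y < 2 * n" using idx_less by auto
    have r: "root_of n p q $ i = (delta (- int j) p - delta (int j) p) - (delta (- int j) q - delta (int j) q)"
      using i by (simp add: root_of_def j_def)
    show "(delta (- int j) p \<cdot>\<^sub>m xmat n (- int j) q + (- delta (- int j) q) \<cdot>\<^sub>m xmat n p (- int j) +
         (- delta (- (- int j)) p) \<cdot>\<^sub>m xmat n (- (- int j)) q + delta (- (- int j)) q \<cdot>\<^sub>m xmat n p (- (- int j))) $$ (idx n x, idx n y) =
        (root_of n p q $ i \<cdot>\<^sub>m xmat n p q) $$ (idx n x, idx n y)"
      unfolding r using d by (auto simp: delta_def algebra_simps)
  qed (auto intro!: add_carrier_mat)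
  finally show "bracket (cartan n i) (xmat n p q) = root_of n p q $ i \<cdot>\<^sub>m xmat n p q" .
qed

text \<open>For \<open>q = - p\<close> the formula would give twice a unit vector, which is not a
  root of the even orthogonal algebra.\<close>

lemma root_of_positive:
  assumes p: "p \<in> index_set n" and q: "q \<in> index_set n" and "p < q" "q \<noteq> - p"
  shows "root_of n p q \<in> positive_roots n"
proof -
  have u: "unit_vec n (n - a) $ i = (if i = n - a then 1 else 0 :: complex)" if "i < n" for a i
    using that by (auto simp: unit_vec_def)
  from p show ?thesis
  proof (cases rule: index_set_cases)
    case a: (1 a)
    from q show ?thesis
    proof (cases rule: index_set_cases)
      case b: (1 b)
      have "root_of n p q = unit_vec n (n - a) - unit_vec n (n - b)"
        by (rule eq_vecI) (use a b in \<open>auto simp: root_of_def delta_def\<close>)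
      moreover have "n - a < n - b" "n - b < n" using a b assms(3) by auto
      ultimately show ?thesis unfolding positive_roots_def by blast
    next
      case b: (2 b)
      have ab: "a \<noteq> b" using assms(4) a b by auto
      have "root_of n p q = unit_vec n (n - a) + unit_vec n (n - b)"
        by (rule eq_vecI) (use a b ab in \<open>auto simp: root_of_def delta_def\<close>)
      moreover have "unit_vec n (n - a) + unit_vec n (n - b) = (unit_vec n (n - b) + unit_vec n (n - a) :: complex vec)"
        by (rule eq_vecI) auto
      moreover have "n - a < n - b \<and> n - b < n \<or> n - b < n - a \<and> n - a < n" using a b ab by auto
      ultimately show ?thesis unfolding positive_roots_def by auto
    qed
  next
    case a: (2 a)
    from q show ?thesis
    proof (cases rule: index_set_cases)
      case b: (1 b)
      then show ?thesis using a assms(3) by simp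
    next
      case b: (2 b)
      have "root_of n p q = unit_vec n (n - b) - unit_vec n (n - a)"
        by (rule eq_vecI) (use a b in \<open>auto simp: root_of_def delta_def\<close>)
      moreover have "n - b < n - a" "n - a < n" using a b assms(3) by auto
      ultimately show ?thesis unfolding positive_roots_def by blast
    qed
  qed
qed

lemma inv_sub_act:
  assumes V: "is_rep n V" and W: "inv_sub n (repF n V) W" and "1 \<le> n" "X \<in> orth n" "f \<in> W"
  shows "mop (act V X) f \<in> W"
  using assms(3,4)
proof (induction X rule: orth_induct)
  case (xmat p q)
  then show ?case using inv_subD(2)[OF W xmat assms(5)] by (simp add: repF_def)
next
  case (smult c X)
  have "act V (c \<cdot>\<^sub>m X) = c \<cdot>\<^sub>m act V X" using V smult(1) by (simp add: is_rep_def)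
  then show ?case using inv_subD(6)[OF W smult(2)] by (simp only: mop_smult)
next
  case (add X Y)
  have "act V X \<in> carrier_mat (rdim V) (rdim V)" "act V Y \<in> carrier_mat (rdim V) (rdim V)"
    using V add by (simp_all add: is_rep_def)
  moreover have "act V (X + Y) = act V X + act V Y" using V add(1,2) by (simp add: is_rep_def)
  ultimately show ?case using inv_subD(4)[OF W add(3,4)] by (simp only: mop_add)
qed

lemma vec_subspace:
  assumes "cv.subspace W" "W \<subseteq> supp_fun d"
  shows "VectorSpace.subspace class_ring (vec d ` W) (module_vec TYPE(complex) d)"
proof (rule VectorSpace.subspace.intro)
  interpret v: vec_space "TYPE(complex)" d .
  show "vectorspace class_ring (module_vec TYPE(complex) d)" by (rule v.vectorspace_axioms)
  show "submodule class_ring (vec d ` W) (module_vec TYPE(complex) d)"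
  proof (rule submodule.intro)
    show "Module.module class_ring (module_vec TYPE(complex) d)" by (rule v.module_axioms)
    show "vec d ` W \<subseteq> carrier (module_vec TYPE(complex) d)" by (auto simp: module_vec_simps)
    show "\<zero>\<^bsub>module_vec TYPE(complex) d\<^esub> \<in> vec d ` W"
    proof -
      have "0\<^sub>v d = vec d (0 :: nat \<Rightarrow> complex)" by auto
      then show ?thesis using cv.subspace_0[OF assms(1)] by (auto simp: module_vec_simps)
    qed
    show "x \<oplus>\<^bsub>module_vec TYPE(complex) d\<^esub> y \<in> vec d ` W" if xy: "x \<in> vec d ` W" "y \<in> vec d ` W" for x y
    proof -
      obtain f g where "x = vec d f" "f \<in> W" "y = vec d g" "g \<in> W" using xy by blast
      moreover from this have "x + y = vec d (f + g)" by auto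
      ultimately show ?thesis using cv.subspace_add[OF assms(1)] by (auto simp: module_vec_simps)
    qed
    show "c \<odot>\<^bsub>module_vec TYPE(complex) d\<^esub> x \<in> vec d ` W"
      if cx: "c \<in> carrier class_ring" "x \<in> vec d ` W" for c x
    proof -
      obtain f where "x = vec d f" "f \<in> W" using cx(2) by blast
      moreover from this have "c \<cdot>\<^sub>v x = vec d (c *c f)" by (auto simp: cscale_complex_def)
      ultimately show ?thesis using cv.subspace_scale[OF assms(1)] by (auto simp: module_vec_simps)
    qed
  qed
qed

text \<open>The bridge from the matrix formulation. For irreducibility, a subspace stable under the
  \<open>F p q\<close> has to be stable under all of \<open>orth n\<close>, which is
  \<open>inv_sub_act\<close>.\<close>

lemma hw_irred_repF:
  assumes "irreducible_of_highest_weight n \<nu> V" "1 \<le> n" "\<And>i. i \<in> {1..n} \<Longrightarrow> \<nu> $ (n - i) = complex_of_real (l i)"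
  shows "\<exists>v. hw_irred n (repF n V) (supp_fun (rdim V)) l v"
proof -
  let ?d = "rdim V"
  have V: "is_rep n V" and irr: "\<And>W. invariant_subspace n V W \<Longrightarrow> W = {0\<^sub>v ?d} \<or> W = carrier_vec ?d"
    using assms(1) by (auto simp: irreducible_of_highest_weight_def irreducible_rep_def)
  obtain x where x: "x \<in> weight_space n V \<nu>" "x \<noteq> 0\<^sub>v ?d"
    "\<And>\<alpha> X. \<alpha> \<in> positive_roots n \<Longrightarrow> X \<in> root_space n \<alpha> \<Longrightarrow> act V X *\<^sub>v x = 0\<^sub>v ?d"
    using assms(1) unfolding irreducible_of_highest_weight_def by blast
  have xc: "x \<in> carrier_vec ?d" using x(1) by (simp add: weight_space_def)
  interpret so_rep n "repF n V" by (rule so_rep_repF[OF V])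
  have c: "act V X \<in> carrier_mat ?d ?d" if "X \<in> orth n" for X using V that by (simp add: is_rep_def)
  have cx: "act V (xmat n p q) \<in> carrier_mat ?d ?d" if "p \<in> index_set n" "q \<in> index_set n" for p q
    using c xmat_orth[OF that] by blast
  have "hw_irred n (repF n V) (supp_fun ?d) l (fun_of x)"
    unfolding hw_irred_def
  proof (intro conjI allI impI)
    show "inv_sub n (repF n V) (supp_fun ?d)"
      using mop_mem[OF cx] by (auto simp: inv_sub_def supp_fun_subspace repF_def)
    show "fun_of x \<in> supp_fun ?d" by (rule fun_of_mem[OF xc])
    show "fun_of x \<noteq> 0" using fun_of_inj[OF xc zero_carrier_vec] x(2) by (auto simp: fun_of_zero)
    show "sing n (repF n V) (fun_of x)"
      unfolding sing_def
    proof (intro ballI impI)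
      fix p q assume pq: "p \<in> index_set n" "q \<in> index_set n" "p < q"
      show "repF n V p q (fun_of x) = 0"
      proof (cases "q = - p")
        case True
        then show ?thesis using F_anti_diag pq by simp
      next
        case False
        have "act V (xmat n p q) *\<^sub>v x = 0\<^sub>v ?d"
          by (rule x(3)[OF root_of_positive[OF pq False] xmat_root_space[OF pq(1,2)]])
        then show ?thesis using fun_of_mult[OF cx[OF pq(1,2)] xc] by (simp add: repF_def fun_of_zero)
      qed
    qed
    show "has_wt n (repF n V) l (fun_of x)"
      unfolding has_wt_def
    proof
      fix i assume i: "i \<in> {1..n}"
      then have ii: "- int i \<in> index_set n" by simp
      have "n - i < n" using i by auto
      then have "act V (cartan n (n - i)) *\<^sub>v x = \<nu> $ (n - i) \<cdot>\<^sub>v x" using x(1) by (simp add: weight_space_def)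
      then have "act V (xmat n (- int i) (- int i)) *\<^sub>v x = complex_of_real (l i) \<cdot>\<^sub>v x"
        using assms(3)[OF i] cartan_eq_xmat[OF i] by simp
      then show "repF n V (- int i) (- int i) (fun_of x) = complex_of_real (l i) *c fun_of x"
        using fun_of_mult[OF cx[OF ii ii] xc] by (simp add: repF_def fun_of_smult)
    qed
    fix W assume W: "inv_sub n (repF n V) W" "W \<subseteq> supp_fun ?d"
    have "invariant_subspace n V (vec ?d ` W)"
      unfolding invariant_subspace_def
    proof (intro conjI ballI)
      show "VectorSpace.subspace class_ring (vec ?d ` W) (module_vec TYPE(complex) ?d)"
        by (rule vec_subspace[OF inv_subD(1)[OF W(1)] W(2)])
      fix X y assume X: "X \<in> orth n" and "y \<in> vec ?d ` W"
      then obtain f where f: "y = vec ?d f" "f \<in> W" by blast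
      have "fun_of (act V X *\<^sub>v y) = mop (act V X) f"
        using fun_of_mult[OF c[OF X], of y] f fun_of_vec[of f ?d] W(2) by auto
      moreover have "act V X *\<^sub>v y \<in> carrier_vec ?d" using c[OF X] f by simp
      ultimately have "act V X *\<^sub>v y = vec ?d (mop (act V X) f)" using vec_fun_of by metis
      then show "act V X *\<^sub>v y \<in> vec ?d ` W" using inv_sub_act[OF V W(1) assms(2) X f(2)] by blast
    qed
    from irr[OF this] show "W = {0} \<or> W = supp_fun ?d"
    proof
      assume z: "vec ?d ` W = {0\<^sub>v ?d}"
      have "f = 0" if "f \<in> W" for f
      proof -
        have "vec ?d f = 0\<^sub>v ?d" using z that by blast
        then have "fun_of (vec ?d f) = 0" by (simp only: fun_of_zero)
        then show ?thesis using fun_of_vec[of f ?d] that W(2) by auto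
      qed
      then show ?thesis using inv_subD(3)[OF W(1)] by blast
    next
      assume z: "vec ?d ` W = carrier_vec ?d"
      have "f \<in> W" if f: "f \<in> supp_fun ?d" for f
      proof -
        have "vec ?d f \<in> vec ?d ` W" unfolding z by simp
        then obtain g where "g \<in> W" "vec ?d f = vec ?d g" by blast
        then show ?thesis using fun_of_vec[OF f] fun_of_vec[of g ?d] W(2) by auto
      qed
      then show ?thesis using W(2) by blast
    qed
  qed
  then show ?thesis by (rule exI[of "hw_irred n (repF n V) (supp_fun ?d) l"])
qed

section \<open>The spinor module in coordinates\<close>

text \<open>Binary digit \<open>j\<close> of a basis index stands for position \<open>n - j\<close>,
  in agreement with \<open>idx\<close>.\<close>

definition dec :: "nat \<Rightarrow> nat \<Rightarrow> nat set" where
  "dec n c = (\<lambda>j. n - j) ` set_decode c"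

text \<open>The sign by which the ordering of wedge products by increasing position in the definition of
  the spinor module differs from the ordering by decreasing position used for \<open>cliff\<close>.\<close>

definition reorder :: "nat set \<Rightarrow> complex" where
  "reorder J = (- 1) ^ (card J choose 2)"

lemma reorder_sq [simp]: "reorder J * reorder J = 1"
  by (simp add: reorder_def flip: power_mult_distrib)

lemma reorder_insert:
  assumes "finite J" "i \<notin> J"
  shows "reorder (insert i J) = reorder J * (- 1) ^ card J"
  using assms by (simp add: reorder_def numeral_2_eq_2 One_nat_def power_add)

lemma set_decode_subset: "c < 2 ^ n \<Longrightarrow> set_decode c \<subseteq> {..<n}"
proof
  fix j assume c: "c < 2 ^ n" and j: "j \<in> set_decode c"
  show "j \<in> {..<n}"
  proof (rule ccontr)
    assume "j \<notin> {..<n}"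
    then have "(2::nat) ^ n \<le> 2 ^ j" by (simp add: power_increasing)
    then have "c < 2 ^ j" using c by linarith
    then have "c div 2 ^ j = 0" by simp
    then show False using j by (simp add: set_decode_def)
  qed
qed

lemma set_encode_less:
  assumes "A \<subseteq> {..<n}"
  shows "set_encode A < 2 ^ n"
proof -
  have "set_encode A \<le> set_encode {..<n}"
    unfolding set_encode_def using assms by (intro sum_mono2) auto
  also have "\<dots> < 2 ^ n"
    by (induction n) (auto simp: set_encode_def lessThan_Suc)
  finally show ?thesis .
qed

lemma dec_bij: "bij_betw (dec n) {..<2 ^ n} (Pow {1..n})"
proof (rule bij_betw_byWitness[where f' = "\<lambda>J. set_encode ((\<lambda>j. n - j) ` J)"])
  show "\<forall>c\<in>{..<2 ^ n}. set_encode ((\<lambda>j. n - j) ` dec n c) = c"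
  proof
    fix c :: nat assume "c \<in> {..<2 ^ n}"
    then have "(\<lambda>j. n - j) ` dec n c = set_decode c"
      using set_decode_subset[of c n] by (force simp: dec_def image_image)
    then show "set_encode ((\<lambda>j. n - j) ` dec n c) = c" by simp
  qed
  show "\<forall>J\<in>Pow {1..n}. dec n (set_encode ((\<lambda>j. n - j) ` J)) = J"
  proof
    fix J assume J: "J \<in> Pow {1..n}"
    then have "finite J" using finite_subset by blast
    then show "dec n (set_encode ((\<lambda>j. n - j) ` J)) = J"
      using J by (force simp: dec_def image_image)
  qed
  show "dec n ` {..<2 ^ n} \<subseteq> Pow {1..n}"
    using set_decode_subset[of _ n] by (force simp: dec_def)
  show "(\<lambda>J. set_encode ((\<lambda>j. n - j) ` J)) ` Pow {1..n} \<subseteq> {..<2 ^ n}"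
    by (auto intro!: set_encode_less)
qed

lemma dec_subset: "c < 2 ^ n \<Longrightarrow> dec n c \<subseteq> {1..n}"
  using bij_betw_apply[OF dec_bij, of c n] by auto

lemma set_decode_dec: "c < 2 ^ n \<Longrightarrow> set_decode c = (\<lambda>j. n - j) ` dec n c"
  using set_decode_subset[of c n] by (force simp: dec_def image_image)

lemma dec_mem_iff:
  assumes "c < 2 ^ n" "i \<in> {1..n}"
  shows "n - i \<in> set_decode c \<longleftrightarrow> i \<in> dec n c"
  unfolding set_decode_dec[OF assms(1)]
proof
  assume "n - i \<in> (\<lambda>j. n - j) ` dec n c"
  then obtain j where j: "j \<in> dec n c" "n - i = n - j" by blast
  then have "j \<le> n" "i \<le> n" using dec_subset[OF assms(1)] assms(2) by auto
  then have "i = j" using j(2) by linarith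
  then show "i \<in> dec n c" using j(1) by simp
qed blast

lemma decode_eq_iff:
  fixes J K :: "nat set"
  assumes "J \<subseteq> {1..n}" "K \<subseteq> {1..n}"
  shows "(\<lambda>j. n - j) ` J = (\<lambda>j. n - j) ` K \<longleftrightarrow> J = K"
proof -
  have "inj_on (\<lambda>j. n - j) {1..n}"
  proof (rule inj_onI)
    fix x y assume "x \<in> {1..n}" "y \<in> {1..n}" "n - x = n - y"
    moreover from this have "x \<le> n" "y \<le> n" by auto
    ultimately show "x = y" by linarith
  qed
  then show ?thesis using assms by (simp add: inj_on_image_eq_iff)
qed

lemma wedge_sign_dec:
  assumes "c < 2 ^ n" "i \<in> {1..n}"
  shows "wedge_sign (n - i) (set_decode c) = (- 1) ^ card {j \<in> dec n c. i < j}"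
proof -
  have "{j \<in> set_decode c. j < n - i} = (\<lambda>j. n - j) ` {j \<in> dec n c. i < j}"
  proof -
    have "n - j < n - i \<longleftrightarrow> i < j" if "j \<in> dec n c" for j
    proof -
      have "1 \<le> j" "j \<le> n" using that dec_subset[OF assms(1)] by auto
      then show ?thesis using assms(2) by auto
    qed
    then show ?thesis unfolding set_decode_dec[OF assms(1)] by blast
  qed
  moreover have "inj_on (\<lambda>j. n - j) {j \<in> dec n c. i < j}"
  proof (rule inj_onI)
    fix x y assume "x \<in> {j \<in> dec n c. i < j}" "y \<in> {j \<in> dec n c. i < j}" "n - x = n - y"
    moreover from this have "x \<le> n" "y \<le> n" using dec_subset[OF assms(1)] by auto
    ultimately show "x = y" by linarith
  qed
  ultimately show ?thesis by (simp add: wedge_sign_def card_image)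
qed

text \<open>The given spinor action counts, in terms of positions, the larger ones and
  \<open>nsign\<close> the smaller ones. The discrepancy \<open>(- 1) ^ card K\<close> is what
  \<open>reorder\<close> gains when an element is inserted.\<close>

lemma sign_split:
  assumes "finite K" "i \<notin> K"
  shows "(- 1) ^ card {j \<in> K. i < j} = (- 1) ^ card K * nsign i K"
proof -
  have "K = {j \<in> K. i < j} \<union> {j \<in> K. j < i}" using assms(2) by (auto simp: not_less_iff_gr_or_eq)
  then have "card K = card {j \<in> K. i < j} + card {j \<in> K. j < i}"
    using assms(1) card_Un_disjoint[of "{j \<in> K. i < j}" "{j \<in> K. j < i}"] by fastforce
  then have "(- 1) ^ card K * nsign i K = (- 1) ^ card {j \<in> K. i < j} * (nsign i K * nsign i K)"
    by (simp add: nsign_def power_add)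
  then show ?thesis by simp
qed

section \<open>Clifford and spinor operators as matrices in the binary basis\<close>

lemma mop_cong:
  assumes "A \<in> carrier_mat a b" "\<And>j. j < b \<Longrightarrow> f j = g j"
  shows "mop A f = mop A g"
  using assms by (auto simp: mop_def fun_eq_iff)

text \<open>\<open>B\<close> is the matrix of \<open>T\<close> in the basis indexed by binary codes,
  rescaled by \<open>reorder\<close>; \<open>\<chi>\<close> is a function on all sets, but only
  values at decoded sets are compared.\<close>

definition represents :: "nat \<Rightarrow> complex mat \<Rightarrow> ((nat set \<Rightarrow> complex) \<Rightarrow> nat set \<Rightarrow> complex) \<Rightarrow> bool" where
  "represents n B T \<longleftrightarrow> B \<in> carrier_mat (2 ^ n) (2 ^ n) \<and>
    (\<forall>\<chi>. \<forall>c<2 ^ n. mop B (\<lambda>c. reorder (dec n c) * \<chi> (dec n c)) c = reorder (dec n c) * T \<chi> (dec n c))"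

lemma representsD:
  assumes "represents n B T"
  shows "B \<in> carrier_mat (2 ^ n) (2 ^ n)"
    "c < 2 ^ n \<Longrightarrow> mop B (\<lambda>c. reorder (dec n c) * \<chi> (dec n c)) c = reorder (dec n c) * T \<chi> (dec n c)"
  using assms by (auto simp: represents_def)

lemma represents_mult:
  assumes "represents n A S" "represents n B T"
  shows "represents n (A * B) (\<lambda>\<chi>. S (T \<chi>))"
  unfolding represents_def
proof (intro conjI allI impI)
  show "A * B \<in> carrier_mat (2 ^ n) (2 ^ n)" 
    by (rule mult_carrier_mat[OF representsD(1)[OF assms(1)] representsD(1)[OF assms(2)]])
  fix \<chi> c assume c: "c < (2::nat) ^ n"
  have "mop (A * B) (\<lambda>c. reorder (dec n c) * \<chi> (dec n c)) = mop A (mop B (\<lambda>c. reorder (dec n c) * \<chi> (dec n c)))"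
    by (rule mop_mult[OF representsD(1)[OF assms(1)] representsD(1)[OF assms(2)]])
  also have "\<dots> = mop A (\<lambda>c. reorder (dec n c) * T \<chi> (dec n c))"
    by (rule mop_cong[OF representsD(1)[OF assms(1)]]) (rule representsD(2)[OF assms(2)])
  finally show "mop (A * B) (\<lambda>c. reorder (dec n c) * \<chi> (dec n c)) c = reorder (dec n c) * S (T \<chi>) (dec n c)"
    using representsD(2)[OF assms(1) c] by simp
qed

lemma represents_diff:
  assumes "represents n A S" "represents n B T"
  shows "represents n (A - B) (\<lambda>\<chi>. S \<chi> - T \<chi>)"
  using representsD[OF assms(1)] representsD[OF assms(2)]
  by (auto simp: represents_def mop_minus algebra_simps intro: minus_carrier_mat)

lemma represents_smult:
  assumes "represents n A S"
  shows "represents n (a \<cdot>\<^sub>m A) (\<lambda>\<chi>. a *c S \<chi>)"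
  using representsD[OF assms]
  by (auto simp: represents_def mop_smult cscale_complex_def)

lemma represents_cong: "represents n A S \<Longrightarrow> (\<And>\<chi>. S \<chi> = T \<chi>) \<Longrightarrow> represents n A T"
  by (simp add: represents_def)

lemma mop_dec:
  assumes "B \<in> carrier_mat (2 ^ n) (2 ^ n)" "c < 2 ^ n"
    and "\<And>c'. c' < 2 ^ n \<Longrightarrow> B $$ (c, c') = b (dec n c')"
  shows "mop B (\<lambda>c. u (dec n c)) c = (\<Sum>K\<in>Pow {1..n}. b K * u K)"
proof -
  have "mop B (\<lambda>c. u (dec n c)) c = (\<Sum>c'<2 ^ n. b (dec n c') * u (dec n c'))"
    using assms by (simp add: mop_def)
  then show ?thesis by (simp add: sum.reindex_bij_betw[OF dec_bij, where g = "\<lambda>K. b K * u K"])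
qed

lemma represents_ext_mult:
  assumes i: "i \<in> {1..n}"
  shows "represents n (ext_mult n (n - i)) (cliff (- int i))"
  unfolding represents_def
proof (intro conjI allI impI)
  show c0: "ext_mult n (n - i) \<in> carrier_mat (2 ^ n) (2 ^ n)" by (simp add: ext_mult_def)
  fix \<chi> and c :: nat assume c: "c < 2 ^ n"
  define J where "J = dec n c"
  have J: "J \<subseteq> {1..n}" "finite J" using dec_subset[OF c] finite_subset by (auto simp: J_def)
  have e: "ext_mult n (n - i) $$ (c, c') = (if i \<notin> dec n c' \<and> J = insert i (dec n c')
      then (- 1) ^ card {j \<in> dec n c'. i < j} else 0)" if c': "c' < 2 ^ n" for c'
  proof -
    have "set_decode c = insert (n - i) (set_decode c') \<longleftrightarrow> J = insert i (dec n c')"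
      using decode_eq_iff[OF J(1), of "insert i (dec n c')"] dec_subset[OF c'] i
      by (simp add: set_decode_dec[OF c] set_decode_dec[OF c'] J_def)
    then show ?thesis
      using c c' dec_mem_iff[OF c' i] wedge_sign_dec[OF c' i] by (simp add: ext_mult_def)
  qed
  have "mop (ext_mult n (n - i)) (\<lambda>c. reorder (dec n c) * \<chi> (dec n c)) c =
    (\<Sum>K\<in>Pow {1..n}. (if i \<notin> K \<and> J = insert i K then (- 1) ^ card {j \<in> K. i < j} else 0) * (reorder K * \<chi> K))"
    by (rule mop_dec[OF c0 c e, where u = "\<lambda>K. reorder K * \<chi> K"])
  also have "\<dots> = (\<Sum>K\<in>Pow {1..n}. if K = J - {i} then
      (if i \<in> J then (- 1) ^ card {j \<in> J - {i}. i < j} * (reorder (J - {i}) * \<chi> (J - {i})) else 0) else 0)"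
    by (intro sum.cong refl) (auto simp: insert_absorb)
  also have "\<dots> = (if i \<in> J then (- 1) ^ card {j \<in> J - {i}. i < j} * (reorder (J - {i}) * \<chi> (J - {i})) else 0)"
    using J(1) by (subst sum.delta) auto
  also have "\<dots> = reorder J * cliff (- int i) \<chi> J"
  proof (cases "i \<in> J")
    case True
    have "reorder J = reorder (J - {i}) * (- 1) ^ card (J - {i})"
      using reorder_insert[of "J - {i}" i] J(2) True by (simp add: insert_absorb)
    moreover have "(- 1) ^ card {j \<in> J - {i}. i < j} = (- 1) ^ card (J - {i}) * nsign i (J - {i})"
      using J(2) by (intro sign_split) auto
    ultimately show ?thesis
      using True i by (simp add: cliff_neg cscale_complex_def nsign_remove)
  qed (use i in \<open>simp add: cliff_neg\<close>)
  finally show "mop (ext_mult n (n - i)) (\<lambda>c. reorder (dec n c) * \<chi> (dec n c)) c =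
    reorder (dec n c) * cliff (- int i) \<chi> (dec n c)" by (simp add: J_def)
qed

lemma represents_contraction:
  assumes i: "i \<in> {1..n}"
  shows "represents n (contraction n (n - i)) (cliff (int i))"
  unfolding represents_def
proof (intro conjI allI impI)
  show c0: "contraction n (n - i) \<in> carrier_mat (2 ^ n) (2 ^ n)" by (simp add: contraction_def)
  fix \<chi> and c :: nat assume c: "c < 2 ^ n"
  define J where "J = dec n c"
  have J: "J \<subseteq> {1..n}" "finite J" using dec_subset[OF c] finite_subset by (auto simp: J_def)
  have e: "contraction n (n - i) $$ (c, c') = (if i \<in> dec n c' \<and> J = dec n c' - {i}
      then (- 1) ^ card {j \<in> dec n c'. i < j} else 0)" if c': "c' < 2 ^ n" for c'
  proof -
    have "set_decode c' - {n - i} = (\<lambda>j. n - j) ` (dec n c' - {i})"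
      unfolding set_decode_dec[OF c'] using dec_subset[OF c'] i by force
    then have "set_decode c = set_decode c' - {n - i} \<longleftrightarrow> J = dec n c' - {i}"
      using decode_eq_iff[OF J(1), of "dec n c' - {i}"] dec_subset[OF c']
      by (simp add: set_decode_dec[OF c] J_def subset_iff)
    then show ?thesis
      using c c' dec_mem_iff[OF c' i] wedge_sign_dec[OF c' i] by (simp add: contraction_def)
  qed
  have "mop (contraction n (n - i)) (\<lambda>c. reorder (dec n c) * \<chi> (dec n c)) c =
    (\<Sum>K\<in>Pow {1..n}. (if i \<in> K \<and> J = K - {i} then (- 1) ^ card {j \<in> K. i < j} else 0) * (reorder K * \<chi> K))"
    by (rule mop_dec[OF c0 c e, where u = "\<lambda>K. reorder K * \<chi> K"])
  also have "\<dots> = (\<Sum>K\<in>Pow {1..n}. if K = insert i J then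
      (if i \<in> J then 0 else (- 1) ^ card {j \<in> insert i J. i < j} * (reorder (insert i J) * \<chi> (insert i J))) else 0)"
    by (intro sum.cong refl) (auto simp: insert_absorb)
  also have "\<dots> = (if i \<in> J then 0 else (- 1) ^ card {j \<in> insert i J. i < j} * (reorder (insert i J) * \<chi> (insert i J)))"
    using J(1) i by (subst sum.delta) auto
  also have "\<dots> = reorder J * cliff (int i) \<chi> J"
  proof (cases "i \<in> J")
    case False
    have "{j \<in> insert i J. i < j} = {j \<in> J. i < j}" by auto
    moreover have "(- 1) ^ card {j \<in> J. i < j} = (- 1) ^ card J * nsign i J"
      using J(2) False by (intro sign_split) auto
    moreover have "(- 1 :: complex) ^ card J * (- 1) ^ card J = 1" by (simp flip: power_mult_distrib)
    ultimately show ?thesis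
      using False i reorder_insert[OF J(2) False] by (simp add: cliff_pos cscale_complex_def)
  qed (use i in \<open>simp add: cliff_pos\<close>)
  finally show "mop (contraction n (n - i)) (\<lambda>c. reorder (dec n c) * \<chi> (dec n c)) c =
    reorder (dec n c) * cliff (int i) \<chi> (dec n c)" by (simp add: J_def)
qed

lemma xmat_index:
  "r < 2 * n \<Longrightarrow> c < 2 * n \<Longrightarrow> xmat n p q $$ (r, c) =
    (if r = idx n p \<and> c = idx n q then 1 else 0) - (if r = idx n (- q) \<and> c = idx n (- p) then 1 else 0)"
  by (simp add: xmat_def elem_mat_def)

lemma sum_below_delta:
  fixes g :: "nat \<Rightarrow> nat \<Rightarrow> complex"
  assumes "b < n"
  shows "(\<Sum>j<n. \<Sum>i<j. (if i = a \<and> j = b then 1 else 0) * g i j) = (if a < b then g a b else 0)"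
proof -
  have "(\<Sum>i<j. (if i = a \<and> j = b then 1 else 0) * g i j) = (if j = b then if a < b then g a b else 0 else 0)" for j
  proof -
    have "(\<Sum>i<j. (if i = a \<and> j = b then 1 else 0) * g i j) = (\<Sum>i<j. if i = a then if j = b then g a b else 0 else 0)"
      by (intro sum.cong refl) auto
    then show ?thesis by auto
  qed
  then show ?thesis using assms by simp
qed

lemma sum_pair_delta:
  fixes g :: "nat \<Rightarrow> nat \<Rightarrow> complex"
  assumes "a < n" "b < n"
  shows "(\<Sum>i<n. \<Sum>j<n. (if i = a \<and> j = b then 1 else 0) * g i j) = g a b"
proof -
  have "(\<Sum>j<n. (if i = a \<and> j = b then 1 else 0) * g i j) = (if i = a then g a b else 0)" for i
  proof -
    have "(\<Sum>j<n. (if i = a \<and> j = b then 1 else 0) * g i j) = (\<Sum>j<n. if j = b then if i = a then g a b else 0 else 0)"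
      by (intro sum.cong refl) auto
    then show ?thesis using assms by auto
  qed
  then show ?thesis using assms by simp
qed

lemma ext_carrier [simp]: "ext_mult n i \<in> carrier_mat (2 ^ n) (2 ^ n)"
  "contraction n i \<in> carrier_mat (2 ^ n) (2 ^ n)"
  by (simp_all add: ext_mult_def contraction_def)

lemma spinor_act_carrier [simp]: "spinor_act n X \<in> carrier_mat (2 ^ n) (2 ^ n)"
  by (simp add: spinor_act_def Let_def)

lemma spinor_act_smult:
  assumes "X \<in> carrier_mat (2 * n) (2 * n)"
  shows "spinor_act n (a \<cdot>\<^sub>m X) = a \<cdot>\<^sub>m spinor_act n X"
  by (rule eq_matI) (use assms in \<open>auto simp: spinor_act_def Let_def sum_distrib_left algebra_simps intro!: arg_cong2[where f = "(+)"] sum.cong\<close>)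

lemma spinor_act_add:
  assumes "X \<in> carrier_mat (2 * n) (2 * n)" "Y \<in> carrier_mat (2 * n) (2 * n)"
  shows "spinor_act n (X + Y) = spinor_act n X + spinor_act n Y"
proof -
  note d = carrier_matD[OF assms(1)] carrier_matD[OF assms(2)]
  have e: "(X + Y) $$ (i, j) = X $$ (i, j) + Y $$ (i, j)" if "i < 2 * n" "j < 2 * n" for i j
    using that d by simp
  show ?thesis
  proof (rule eq_matI)
    fix r c assume "r < dim_row (spinor_act n X + spinor_act n Y)" "c < dim_col (spinor_act n X + spinor_act n Y)"
    then have rc: "r < 2 ^ n" "c < 2 ^ n" using carrier_matD[OF spinor_act_carrier[of n Y]] by simp_all
    have s1: "(\<Sum>i<n. \<Sum>j<n. (X + Y) $$ (i, j) * g i j) =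
      (\<Sum>i<n. \<Sum>j<n. X $$ (i, j) * g i j) + (\<Sum>i<n. \<Sum>j<n. Y $$ (i, j) * g i j)" for g
      unfolding sum.distrib[symmetric] by (intro sum.cong refl) (simp add: e distrib_right)
    have s2: "(\<Sum>j<n. \<Sum>i<j. (X + Y) $$ (i, j + n) * g i j) =
      (\<Sum>j<n. \<Sum>i<j. X $$ (i, j + n) * g i j) + (\<Sum>j<n. \<Sum>i<j. Y $$ (i, j + n) * g i j)" for g
      unfolding sum.distrib[symmetric] by (intro sum.cong refl) (simp add: e distrib_right)
    have s3: "(\<Sum>j<n. \<Sum>i<j. (X + Y) $$ (i + n, j) * g i j) =
      (\<Sum>j<n. \<Sum>i<j. X $$ (i + n, j) * g i j) + (\<Sum>j<n. \<Sum>i<j. Y $$ (i + n, j) * g i j)" for g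
      unfolding sum.distrib[symmetric] by (intro sum.cong refl) (simp add: e distrib_right)
    have "(spinor_act n X + spinor_act n Y) $$ (r, c) = spinor_act n X $$ (r, c) + spinor_act n Y $$ (r, c)"
      using rc carrier_matD[OF spinor_act_carrier[of n Y]] by simp
    then show "spinor_act n (X + Y) $$ (r, c) = (spinor_act n X + spinor_act n Y) $$ (r, c)"
      using rc by (simp only: spinor_act_def Let_def index_mat(1) prod.case s1 s2 s3 add_ac)
  qed (use carrier_matD[OF spinor_act_carrier[of n Y]] carrier_matD[OF spinor_act_carrier[of n "X + Y"]] in simp_all)
qed

lemma represents_zero: "represents n (0\<^sub>m (2 ^ n) (2 ^ n)) (\<lambda>\<chi>. 0)"
  by (auto simp: represents_def mop_def)

lemma spinor_act_diag:
  assumes "\<alpha> < n" "\<beta> < n"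
    and "\<And>i j. i < n \<Longrightarrow> j < n \<Longrightarrow> X $$ (i, j) = (if i = \<alpha> \<and> j = \<beta> then 1 else 0)"
    and "\<And>i j. i < n \<Longrightarrow> j < n \<Longrightarrow> X $$ (i, j + n) = 0"
    and "\<And>i j. i < n \<Longrightarrow> j < n \<Longrightarrow> X $$ (i + n, j) = 0"
  shows "spinor_act n X = (1 / 2) \<cdot>\<^sub>m (ext_mult n \<alpha> * contraction n \<beta> - contraction n \<beta> * ext_mult n \<alpha>)"
proof (rule eq_matI)
  note c = mult_carrier_mat[OF ext_carrier(1)[of n \<alpha>] ext_carrier(2)[of n \<beta>]] mult_carrier_mat[OF ext_carrier(2)[of n \<beta>] ext_carrier(1)[of n \<alpha>]]
  note d = minus_carrier_mat[OF c(2), of "ext_mult n \<alpha> * contraction n \<beta>"]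
  let ?g = "\<lambda>p i j. 1 / 2 * (ext_mult n i * contraction n j - contraction n j * ext_mult n i) $$ p"
  fix r c assume "r < dim_row ((1 / 2) \<cdot>\<^sub>m (ext_mult n \<alpha> * contraction n \<beta> - contraction n \<beta> * ext_mult n \<alpha>))"
    "c < dim_col ((1 / 2) \<cdot>\<^sub>m (ext_mult n \<alpha> * contraction n \<beta> - contraction n \<beta> * ext_mult n \<alpha>))"
  then have rc: "r < 2 ^ n" "c < 2 ^ n" using carrier_matD[OF d] by simp_all
  have "spinor_act n X $$ (r, c) = (\<Sum>i<n. \<Sum>j<n. X $$ (i, j) * ?g (r, c) i j) +
      (\<Sum>j<n. \<Sum>i<j. X $$ (i, j + n) * (ext_mult n i * ext_mult n j) $$ (r, c)) +
      (\<Sum>j<n. \<Sum>i<j. X $$ (i + n, j) * (contraction n i * contraction n j) $$ (r, c))"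
    using rc by (simp only: spinor_act_def Let_def index_mat(1) prod.case)
  also have "(\<Sum>i<n. \<Sum>j<n. X $$ (i, j) * ?g (r, c) i j) =
      (\<Sum>i<n. \<Sum>j<n. (if i = \<alpha> \<and> j = \<beta> then 1 else 0) * ?g (r, c) i j)"
    by (intro sum.cong refl) (simp only: assms(3) lessThan_iff)
  also have "\<dots> = ?g (r, c) \<alpha> \<beta>" by (rule sum_pair_delta[OF assms(1,2)])
  also have "(\<Sum>j<n. \<Sum>i<j. X $$ (i, j + n) * (ext_mult n i * ext_mult n j) $$ (r, c)) = 0"
    by (intro sum.neutral ballI) (simp add: assms(4))
  also have "(\<Sum>j<n. \<Sum>i<j. X $$ (i + n, j) * (contraction n i * contraction n j) $$ (r, c)) = 0"
    by (intro sum.neutral ballI) (simp add: assms(5))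
  also have "?g (r, c) \<alpha> \<beta> + 0 + 0 = ((1 / 2) \<cdot>\<^sub>m (ext_mult n \<alpha> * contraction n \<beta> - contraction n \<beta> * ext_mult n \<alpha>)) $$ (r, c)"
    using rc carrier_matD[OF d] by (simp only: index_smult_mat(1) add_0_right)
  finally show "spinor_act n X $$ (r, c) = ((1 / 2) \<cdot>\<^sub>m (ext_mult n \<alpha> * contraction n \<beta> - contraction n \<beta> * ext_mult n \<alpha>)) $$ (r, c)" .
qed (use carrier_matD[OF spinor_act_carrier[of n X]] in \<open>simp_all add: ext_mult_def contraction_def\<close>)

text \<open>With \<open>u = 1\<close> and \<open>v = 0\<close> this covers the upper right block,
  acting by exterior multiplications, with \<open>u = 0\<close> and \<open>v = 1\<close> the lower
  left block, acting by contractions. The action sums over \<open>i < j\<close>, so the sign depends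
  on the order of \<open>\<alpha>\<close> and \<open>\<beta>\<close>.\<close>

lemma spinor_act_off_diag:
  assumes "\<alpha> < n" "\<beta> < n"
    and "\<And>i j. i < n \<Longrightarrow> j < n \<Longrightarrow> X $$ (i, j) = 0"
    and "\<And>i j. i < n \<Longrightarrow> j < n \<Longrightarrow> X $$ (i, j + n) = u * ((if i = \<alpha> \<and> j = \<beta> then 1 else 0) - (if i = \<beta> \<and> j = \<alpha> then 1 else 0))"
    and "\<And>i j. i < n \<Longrightarrow> j < n \<Longrightarrow> X $$ (i + n, j) = v * ((if i = \<alpha> \<and> j = \<beta> then 1 else 0) - (if i = \<beta> \<and> j = \<alpha> then 1 else 0))"
    and "r < 2 ^ n" "c < 2 ^ n"
  shows "spinor_act n X $$ (r, c) =
    u * ((if \<alpha> < \<beta> then (ext_mult n \<alpha> * ext_mult n \<beta>) $$ (r, c) else 0) - (if \<beta> < \<alpha> then (ext_mult n \<beta> * ext_mult n \<alpha>) $$ (r, c) else 0)) +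
    v * ((if \<alpha> < \<beta> then (contraction n \<alpha> * contraction n \<beta>) $$ (r, c) else 0) - (if \<beta> < \<alpha> then (contraction n \<beta> * contraction n \<alpha>) $$ (r, c) else 0))"
proof -
  have s: "(\<Sum>j<n. \<Sum>i<j. Y i j * g i j) = t * ((if \<alpha> < \<beta> then g \<alpha> \<beta> else 0) - (if \<beta> < \<alpha> then g \<beta> \<alpha> else 0))"
    if "\<And>i j. i < n \<Longrightarrow> j < n \<Longrightarrow> Y i j = t * ((if i = \<alpha> \<and> j = \<beta> then 1 else 0) - (if i = \<beta> \<and> j = \<alpha> then 1 else 0))"
    for Y g and t :: complex
  proof -
    have "(\<Sum>j<n. \<Sum>i<j. Y i j * g i j) = (\<Sum>j<n. \<Sum>i<j. t * ((if i = \<alpha> \<and> j = \<beta> then 1 else 0) * g i j)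
        - t * ((if i = \<beta> \<and> j = \<alpha> then 1 else 0) * g i j))"
      by (intro sum.cong refl) (simp add: that)
    also have "\<dots> = t * (\<Sum>j<n. \<Sum>i<j. (if i = \<alpha> \<and> j = \<beta> then 1 else 0) * g i j)
        - t * (\<Sum>j<n. \<Sum>i<j. (if i = \<beta> \<and> j = \<alpha> then 1 else 0) * g i j)"
      unfolding sum_subtractf sum_distrib_left ..
    finally show ?thesis unfolding sum_below_delta[OF assms(1)] sum_below_delta[OF assms(2)]
      by (simp only: right_diff_distrib)
  qed
  have z: "(\<Sum>i<n. \<Sum>j<n. X $$ (i, j) * (1 / 2 * (ext_mult n i * contraction n j - contraction n j * ext_mult n i) $$ (r, c))) = 0"
    by (intro sum.neutral ballI) (simp add: assms(3))
  have "spinor_act n X $$ (r, c) = 0 +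
      (\<Sum>j<n. \<Sum>i<j. X $$ (i, j + n) * (ext_mult n i * ext_mult n j) $$ (r, c)) +
      (\<Sum>j<n. \<Sum>i<j. X $$ (i + n, j) * (contraction n i * contraction n j) $$ (r, c))"
    unfolding z[symmetric] using assms(6,7) by (simp only: spinor_act_def Let_def index_mat(1) prod.case)
  then show ?thesis
    using s[of "\<lambda>i j. X $$ (i, j + n)", OF assms(4)] s[of "\<lambda>i j. X $$ (i + n, j)", OF assms(5)]
    by (simp only: add_0_left)
qed

text \<open>The matrix holds the product in increasing order of indices, with a sign. By
  anticommutation this is the product of \<open>S\<close> and \<open>T\<close> in the desired order,
  and for equal indices both sides are 0.\<close>

lemma represents_off_diag:
  fixes \<alpha> \<beta> :: nat
  assumes M: "represents n A S" "represents n B T"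
    and anti: "\<And>\<chi>. S (T \<chi>) = - T (S \<chi>)"
    and Z: "Z \<in> carrier_mat (2 ^ n) (2 ^ n)"
    and e: "\<And>r c. r < 2 ^ n \<Longrightarrow> c < 2 ^ n \<Longrightarrow> Z $$ (r, c) =
      (if \<alpha> < \<beta> then (A * B) $$ (r, c) else 0) - (if \<beta> < \<alpha> then (B * A) $$ (r, c) else 0)"
    and eq: "\<alpha> = \<beta> \<Longrightarrow> S = T"
  shows "represents n Z (\<lambda>\<chi>. S (T \<chi>))"
proof (cases \<alpha> \<beta> rule: linorder_cases)
  case less
  have "Z = A * B" using less Z e representsD(1)[OF M(1)] representsD(1)[OF M(2)] by (intro eq_matI) auto
  then show ?thesis using represents_mult[OF M] by simp
next
  case equal
  have "Z = 0\<^sub>m (2 ^ n) (2 ^ n)" using equal Z e by (intro eq_matI) auto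
  moreover have "S (T \<chi>) = 0" for \<chi>
  proof -
    have "S (T \<chi>) + S (T \<chi>) = 0" using anti[of \<chi>] eq[OF equal] by simp
    then have "2 *c S (T \<chi>) = 0" by (simp only: cscale_two)
    then show ?thesis by simp
  qed
  ultimately show ?thesis using represents_zero[of n] by simp
next
  case greater
  have d: "dim_row A = 2 ^ n" "dim_col A = 2 ^ n" "dim_row B = 2 ^ n" "dim_col B = 2 ^ n"
    using representsD(1)[OF M(1)] representsD(1)[OF M(2)] by auto
  have "Z = (- 1) \<cdot>\<^sub>m (B * A)"
  proof (rule eq_matI)
    fix r c assume "r < dim_row ((- 1) \<cdot>\<^sub>m (B * A))" "c < dim_col ((- 1) \<cdot>\<^sub>m (B * A))"
    then have rc: "r < 2 ^ n" "c < 2 ^ n" using d by simp_all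
    then have "Z $$ (r, c) = - (B * A) $$ (r, c)" using e[OF rc] greater by (simp del: index_mult_mat)
    then show "Z $$ (r, c) = ((- 1) \<cdot>\<^sub>m (B * A)) $$ (r, c)" using rc d by simp
  qed (use Z d in auto)
  moreover have "(- 1) *c T (S \<chi>) = S (T \<chi>)" for \<chi> using anti[of \<chi>] by simp
  ultimately show ?thesis
    using represents_cong[OF represents_smult[OF represents_mult[OF M(2,1)], of "- 1"]] by simp
qed

lemma represents_spin:
  assumes p: "p \<in> index_set n" and q: "q \<in> index_set n"
  shows "represents n (spinor_act n (xmat n p q)) (spin p q)"
proof -
  have lower: "n - i < n" if "i \<in> {1..n}" for i using that by auto
  have neg: "represents n (spinor_act n (xmat n (- int a) (- int b))) (spin (- int a) (- int b))"
    if a: "a \<in> {1..n}" and b: "b \<in> {1..n}" for a b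
  proof -
    have "spinor_act n (xmat n (- int a) (- int b)) = (1 / 2) \<cdot>\<^sub>m
      (ext_mult n (n - a) * contraction n (n - b) - contraction n (n - b) * ext_mult n (n - a))"
      by (rule spinor_act_diag[OF lower[OF a] lower[OF b]]) (use a b in \<open>auto simp: xmat_index idx_neg idx_pos\<close>)
    moreover have "represents n ((1 / 2) \<cdot>\<^sub>m
      (ext_mult n (n - a) * contraction n (n - b) - contraction n (n - b) * ext_mult n (n - a)))
      (\<lambda>\<chi>. (1 / 2) *c (cliff (- int a) (cliff (int b) \<chi>) - cliff (int b) (cliff (- int a) \<chi>)))"
      using represents_smult[OF represents_diff[OF
        represents_mult[OF represents_ext_mult[OF a] represents_contraction[OF b]]
        represents_mult[OF represents_contraction[OF b] represents_ext_mult[OF a]]]] .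
    moreover have "(\<lambda>\<chi>. (1 / 2) *c (cliff (- int a) (cliff (int b) \<chi>) - cliff (int b) (cliff (- int a) \<chi>))) =
       (spin (- int a) (- int b) :: (nat set \<Rightarrow> complex) \<Rightarrow> _)"
      by (rule ext) (simp only: spin_def minus_minus)
    ultimately show ?thesis by (simp only:)
  qed
  have anti: "cliff x (cliff y \<chi>) = - cliff y (cliff x \<chi>)" if "x \<noteq> 0" "y \<noteq> 0" "x \<noteq> - y"
    for x y and \<chi> :: "nat set \<Rightarrow> complex"
    using cliff_anticomm[OF that(1,2), of \<chi>] that(3) by (simp add: delta_def)
  have up: "represents n (spinor_act n (xmat n (- int a) (int b))) (spin (- int a) (int b))"
    if a: "a \<in> {1..n}" and b: "b \<in> {1..n}" for a b
  proof -
    have "represents n (spinor_act n (xmat n (- int a) (int b))) (\<lambda>\<chi>. cliff (- int a) (cliff (- int b) \<chi>))"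
    proof (rule represents_off_diag[OF represents_ext_mult[OF a] represents_ext_mult[OF b], where \<alpha> = "n - a" and \<beta> = "n - b"])
      fix r c :: nat assume rc: "r < 2 ^ n" "c < 2 ^ n"
      show "spinor_act n (xmat n (- int a) (int b)) $$ (r, c) =
        (if n - a < n - b then (ext_mult n (n - a) * ext_mult n (n - b)) $$ (r, c) else 0) -
        (if n - b < n - a then (ext_mult n (n - b) * ext_mult n (n - a)) $$ (r, c) else 0)"
      proof -
        define \<alpha> where "\<alpha> = n - a"
        define \<beta> where "\<beta> = n - b"
        have ix: "idx n (- int a) = \<alpha>" "idx n (int a) = \<alpha> + n" "idx n (- int b) = \<beta>" "idx n (int b) = \<beta> + n"
          using a b idx_neg[of a n] idx_neg[of b n] idx_pos[of a n] idx_pos[of b n] by (simp_all add: \<alpha>_def \<beta>_def)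
        have lt: "\<alpha> < n" "\<beta> < n" using lower[OF a] lower[OF b] by (simp_all add: \<alpha>_def \<beta>_def)
        have ne: "i + n \<noteq> \<alpha>" "i + n \<noteq> \<beta>" for i using lt by auto
        have ne': "i \<noteq> \<alpha> + n" "i \<noteq> \<beta> + n" if "i < n" for i using that by auto
        let ?X = "xmat n (- int a) (int b)"
        have "spinor_act n ?X $$ (r, c) =
          1 * ((if \<alpha> < \<beta> then (ext_mult n \<alpha> * ext_mult n \<beta>) $$ (r, c) else 0) - (if \<beta> < \<alpha> then (ext_mult n \<beta> * ext_mult n \<alpha>) $$ (r, c) else 0)) +
          0 * ((if \<alpha> < \<beta> then (contraction n \<alpha> * contraction n \<beta>) $$ (r, c) else 0) - (if \<beta> < \<alpha> then (contraction n \<beta> * contraction n \<alpha>) $$ (r, c) else 0))"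
          by (rule spinor_act_off_diag[OF lt _ _ _ rc]) (use lt in \<open>simp_all add: xmat_index ix ne ne'\<close>)
        then show ?thesis unfolding \<alpha>_def \<beta>_def by (simp only: mult_1 mult_zero_left add_0_left add_0_right)
      qed
    next
      show "cliff (- int a) (cliff (- int b) \<chi>) = - cliff (- int b) (cliff (- int a) \<chi>)" for \<chi> :: "nat set \<Rightarrow> complex"
        using a b by (intro anti) auto
      have "a = b" if "n - a = n - b" using that a b by auto
      then show "(cliff (- int a) :: (nat set \<Rightarrow> complex) \<Rightarrow> _) = cliff (- int b)" if "n - a = n - b" using that by simp
    qed (rule spinor_act_carrier)
    moreover have "(\<lambda>\<chi>. cliff (- int a) (cliff (- int b) \<chi>)) = (spin (- int a) (int b) :: (nat set \<Rightarrow> complex) \<Rightarrow> _)"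
      using a b by (intro ext) (simp add: spin_off_diag[of _ n])
    ultimately show ?thesis by (simp only:)
  qed
  have down: "represents n (spinor_act n (xmat n (int a) (- int b))) (spin (int a) (- int b))"
    if a: "a \<in> {1..n}" and b: "b \<in> {1..n}" for a b
  proof -
    have "represents n (spinor_act n (xmat n (int a) (- int b))) (\<lambda>\<chi>. cliff (int a) (cliff (int b) \<chi>))"
    proof (rule represents_off_diag[OF represents_contraction[OF a] represents_contraction[OF b], where \<alpha> = "n - a" and \<beta> = "n - b"])
      fix r c :: nat assume rc: "r < 2 ^ n" "c < 2 ^ n"
      show "spinor_act n (xmat n (int a) (- int b)) $$ (r, c) =
        (if n - a < n - b then (contraction n (n - a) * contraction n (n - b)) $$ (r, c) else 0) -
        (if n - b < n - a then (contraction n (n - b) * contraction n (n - a)) $$ (r, c) else 0)"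
      proof -
        define \<alpha> where "\<alpha> = n - a"
        define \<beta> where "\<beta> = n - b"
        have ix: "idx n (- int a) = \<alpha>" "idx n (int a) = \<alpha> + n" "idx n (- int b) = \<beta>" "idx n (int b) = \<beta> + n"
          using a b idx_neg[of a n] idx_neg[of b n] idx_pos[of a n] idx_pos[of b n] by (simp_all add: \<alpha>_def \<beta>_def)
        have lt: "\<alpha> < n" "\<beta> < n" using lower[OF a] lower[OF b] by (simp_all add: \<alpha>_def \<beta>_def)
        have ne: "i + n \<noteq> \<alpha>" "i + n \<noteq> \<beta>" for i using lt by auto
        have ne': "i \<noteq> \<alpha> + n" "i \<noteq> \<beta> + n" if "i < n" for i using that by auto
        let ?X = "xmat n (int a) (- int b)"
        have "spinor_act n ?X $$ (r, c) =
          0 * ((if \<alpha> < \<beta> then (ext_mult n \<alpha> * ext_mult n \<beta>) $$ (r, c) else 0) - (if \<beta> < \<alpha> then (ext_mult n \<beta> * ext_mult n \<alpha>) $$ (r, c) else 0)) +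
          1 * ((if \<alpha> < \<beta> then (contraction n \<alpha> * contraction n \<beta>) $$ (r, c) else 0) - (if \<beta> < \<alpha> then (contraction n \<beta> * contraction n \<alpha>) $$ (r, c) else 0))"
          by (rule spinor_act_off_diag[OF lt _ _ _ rc]) (use lt in \<open>simp_all add: xmat_index ix ne ne'\<close>)
        then show ?thesis unfolding \<alpha>_def \<beta>_def by (simp only: mult_1 mult_zero_left add_0_left add_0_right)
      qed
    next
      show "cliff (int a) (cliff (int b) \<chi>) = - cliff (int b) (cliff (int a) \<chi>)" for \<chi> :: "nat set \<Rightarrow> complex"
        using a b by (intro anti) auto
      have "a = b" if "n - a = n - b" using that a b by auto
      then show "(cliff (int a) :: (nat set \<Rightarrow> complex) \<Rightarrow> _) = cliff (int b)" if "n - a = n - b" using that by simp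
    qed (rule spinor_act_carrier)
    moreover have "(\<lambda>\<chi>. cliff (int a) (cliff (int b) \<chi>)) = (spin (int a) (- int b) :: (nat set \<Rightarrow> complex) \<Rightarrow> _)"
      using a b by (intro ext) (simp add: spin_off_diag[of _ n])
    ultimately show ?thesis by (simp only:)
  qed
  from p show ?thesis
  proof (cases rule: index_set_cases)
    case a: (1 a)
    from q show ?thesis
      by (cases rule: index_set_cases) (use a neg up in auto)
  next
    case a: (2 a)
    from q show ?thesis
    proof (cases rule: index_set_cases)
      case (1 b)
      then show ?thesis using a down by simp
    next
      case b: (2 b)
      \<comment> \<open>With both indices positive the matrix is, by skewness, minus one with both
        indices negative, to which \<open>neg\<close> applies.\<close>
      have "xmat n p q = (- 1) \<cdot>\<^sub>m xmat n (- q) (- p)"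
        by (rule mat_idx_eqI) (use p q idx_less in \<open>auto simp: xmat_entry delta_commute\<close>)
      then have "spinor_act n (xmat n p q) = (- 1) \<cdot>\<^sub>m spinor_act n (xmat n (- q) (- p))"
        by (simp only: spinor_act_smult[OF xmat_carrier])
      moreover have "(- 1) *c spin (- q) (- p) \<chi> = spin p q \<chi>" for \<chi> :: "nat set \<Rightarrow> complex"
        by (simp add: spin_skew)
      moreover have "represents n (spinor_act n (xmat n (- q) (- p))) (spin (- q) (- p))"
        using a b neg by simp
      ultimately show ?thesis using represents_cong[OF represents_smult[of n _ "spin (- q) (- p)" "- 1"]] by simp
    qed
  qed
qed

lemma mop_spinor_cartan:
  assumes "i < n" "c < 2 ^ n"
  shows "mop (spinor_act n (cartan n i)) u c = complex_of_real (spin_wt (dec n c) (n - i)) * u c"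
proof -
  let ?inv = "inv_into {..<2 ^ n} (dec n)"
  \<comment> \<open>An arbitrary coordinate vector is brought into the form required by
    \<open>represents\<close>; the sign is its own inverse.\<close>
  define \<chi> where "\<chi> K = reorder K * u (?inv K)" for K
  have inv: "?inv (dec n c') = c'" if "c' < 2 ^ n" for c'
    using dec_bij that by (intro inv_into_f_f) (auto simp: bij_betw_def)
  have u: "reorder (dec n c') * \<chi> (dec n c') = u c'" if "c' < 2 ^ n" for c'
    by (simp add: \<chi>_def inv[OF that] flip: mult.assoc)
  have i: "n - i \<in> {1..n}" "n - (n - i) = i" using assms(1) by auto
  have "cartan n i = xmat n (- int (n - i)) (- int (n - i))"
    using cartan_eq_xmat[OF i(1)] i(2) by simp
  moreover have "- int (n - i) \<in> index_set n"
    using int_in_index_set[OF i(1)] by (simp only: uminus_in_index_set)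
  ultimately have r: "represents n (spinor_act n (cartan n i)) (spin (- int (n - i)) (- int (n - i)))"
    using represents_spin by (simp only:)
  have "mop (spinor_act n (cartan n i)) u c = mop (spinor_act n (cartan n i)) (\<lambda>c. reorder (dec n c) * \<chi> (dec n c)) c"
    using u by (intro fun_cong[OF mop_cong[OF representsD(1)[OF r]]]) simp
  also have "\<dots> = reorder (dec n c) * spin (- int (n - i)) (- int (n - i)) \<chi> (dec n c)"
    by (rule representsD(2)[OF r assms(2)])
  also have "\<dots> = complex_of_real (spin_wt (dec n c) (n - i)) * (reorder (dec n c) * \<chi> (dec n c))"
    using i(1) by (subst spin_diag) (auto simp: cscale_complex_def)
  finally show ?thesis unfolding u[OF assms(2)] .
qed

section \<open>Weights of the spinor module\<close>

definition spin_vec :: "nat \<Rightarrow> nat set \<Rightarrow> complex vec" where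
  "spin_vec n J = vec n (\<lambda>i. complex_of_real (spin_wt J (n - i)))"

text \<open>The Cartan subalgebra acts diagonally in the binary basis, so any nonzero coordinate
  \<open>c\<close> of a weight vector forces the weight to be that of \<open>dec n c\<close>;
  conversely unit vectors are weight vectors.\<close>

lemma weights_spinor: "weights n (spinor n) = spin_vec n ` Pow {1..n}"
proof
  have ev: "(act (spinor n) (cartan n i) *\<^sub>v v) $ c = complex_of_real (spin_wt (dec n c) (n - i)) * v $ c"
    if "v \<in> carrier_vec (2 ^ n)" "i < n" "c < 2 ^ n" for v i c
  proof -
    have c: "spinor_act n (cartan n i) *\<^sub>v v \<in> carrier_vec (2 ^ n)"
      by (rule mult_mat_vec_carrier[OF spinor_act_carrier that(1)])
    have "(spinor_act n (cartan n i) *\<^sub>v v) $ c = fun_of (spinor_act n (cartan n i) *\<^sub>v v) c"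
      using carrier_vecD[OF c] that(3) by (simp only: fun_of_def if_True)
    also have "\<dots> = mop (spinor_act n (cartan n i)) (fun_of v) c"
      by (simp only: fun_of_mult[OF spinor_act_carrier that(1)])
    also have "\<dots> = complex_of_real (spin_wt (dec n c) (n - i)) * v $ c"
      unfolding mop_spinor_cartan[OF that(2,3)] using that(1,3) by (simp add: fun_of_def)
    finally show ?thesis by (simp add: spinor_def)
  qed
  show "weights n (spinor n) \<subseteq> spin_vec n ` Pow {1..n}"
  proof
    fix \<nu> assume "\<nu> \<in> weights n (spinor n)"
    then obtain v where v: "\<nu> \<in> carrier_vec n" "v \<in> weight_space n (spinor n) \<nu>" "v \<noteq> 0\<^sub>v (2 ^ n)"
      by (auto simp: weights_def spinor_def)
    have vc: "v \<in> carrier_vec (2 ^ n)" using v(2) by (simp add: weight_space_def spinor_def)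
    obtain c where c: "c < 2 ^ n" "v $ c \<noteq> 0"
      using v(3) vc by (metis carrier_vecD eq_vecI index_zero_vec)
    have "\<nu> = spin_vec n (dec n c)"
    proof (rule eq_vecI)
      fix i assume "i < dim_vec (spin_vec n (dec n c))"
      then have i: "i < n" by (simp add: spin_vec_def)
      have h: "act (spinor n) (cartan n i) *\<^sub>v v = \<nu> $ i \<cdot>\<^sub>v v" using v(2) i by (simp add: weight_space_def)
      have "(\<nu> $ i \<cdot>\<^sub>v v) $ c = \<nu> $ i * v $ c" using vc c(1) by simp
      then have "\<nu> $ i * v $ c = complex_of_real (spin_wt (dec n c) (n - i)) * v $ c"
        using ev[OF vc i c(1)] by (simp only: h)
      then show "\<nu> $ i = spin_vec n (dec n c) $ i" using c(2) i by (simp add: spin_vec_def)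
    qed (use v(1) in \<open>simp add: spin_vec_def\<close>)
    then show "\<nu> \<in> spin_vec n ` Pow {1..n}" using dec_subset[OF c(1)] by blast
  qed
  show "spin_vec n ` Pow {1..n} \<subseteq> weights n (spinor n)"
  proof
    fix \<nu> assume "\<nu> \<in> spin_vec n ` Pow {1..n}"
    then obtain J where J: "\<nu> = spin_vec n J" "J \<in> Pow {1..n}" by blast
    then obtain c where c: "c < 2 ^ n" "J = dec n c"
      using bij_betw_imp_surj_on[OF dec_bij, of n] by blast
    let ?v = "unit_vec (2 ^ n) c :: complex vec"
    have "?v \<in> weight_space n (spinor n) \<nu>"
      unfolding weight_space_def
    proof (intro CollectI conjI allI impI)
      show "?v \<in> carrier_vec (rdim (spinor n))" by (simp add: spinor_def)
      fix i assume i: "i < n"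
      have cc: "act (spinor n) (cartan n i) *\<^sub>v ?v \<in> carrier_vec (2 ^ n)"
        by (simp add: spinor_def mult_mat_vec_carrier[OF spinor_act_carrier])
      show "act (spinor n) (cartan n i) *\<^sub>v ?v = \<nu> $ i \<cdot>\<^sub>v ?v"
      proof (rule eq_vecI)
        fix c' assume "c' < dim_vec (\<nu> $ i \<cdot>\<^sub>v ?v)"
        then have c': "c' < 2 ^ n" by simp
        show "(act (spinor n) (cartan n i) *\<^sub>v ?v) $ c' = (\<nu> $ i \<cdot>\<^sub>v ?v) $ c'"
          unfolding ev[OF unit_vec_carrier i c'] using i c c' J(1) by (auto simp: spin_vec_def)
      qed (use carrier_vecD[OF cc] in simp)
    qed
    moreover have "?v \<noteq> 0\<^sub>v (rdim (spinor n))"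
    proof
      assume "?v = 0\<^sub>v (rdim (spinor n))"
      then have "?v $ c = 0\<^sub>v (2 ^ n) $ c" by (simp add: spinor_def)
      then show False using c(1) by simp
    qed
    ultimately show "\<nu> \<in> weights n (spinor n)" using J(1) by (auto simp: weights_def spin_vec_def)
  qed
qed

section \<open>Tensor products and direct sums in coordinates\<close>

lemma sum_pairs:
  assumes "0 < (m::nat)"
  shows "(\<Sum>k<d * m. f k) = (\<Sum>j<d. \<Sum>c<m. f (j * m + c))"
proof -
  have "(\<Sum>k<d * m. f k) = (\<Sum>(j, c)\<in>{..<d} \<times> {..<m}. f (j * m + c))"
  proof (rule sum.reindex_bij_witness[where i = "\<lambda>(j, c). j * m + c" and j = "\<lambda>k. (k div m, k mod m)"])
    fix x assume "x \<in> {..<d} \<times> {..<m}"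
    then obtain j c where x: "x = (j, c)" "j < d" "c < m" by auto
    have "j * m + c < Suc j * m" using x(3) by simp
    also have "\<dots> \<le> d * m" using x(2) by (intro mult_le_mono1) simp
    finally show "(case x of (j, c) \<Rightarrow> j * m + c) \<in> {..<d * m}" using x(1) by simp
    show "((case x of (j, c) \<Rightarrow> j * m + c) div m, (case x of (j, c) \<Rightarrow> j * m + c) mod m) = x"
      using x by simp
  qed (use assms in \<open>auto simp: less_mult_imp_div_less\<close>)
  then show ?thesis by (simp add: sum.cartesian_product)
qed

text \<open>The index \<open>i * 2 ^ n + c\<close> is the one that \<open>kronecker\<close> uses
  when the spinor module is the second factor; \<open>reorder\<close> corrects the ordering of wedge
  products.\<close>

definition untensor :: "nat \<Rightarrow> nat \<Rightarrow> (nat set \<Rightarrow> nat \<Rightarrow> complex) \<Rightarrow> nat \<Rightarrow> complex" where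
  "untensor n d \<phi> = (\<lambda>r. if r < d * 2 ^ n then
     reorder (dec n (r mod 2 ^ n)) * \<phi> (dec n (r mod 2 ^ n)) (r div 2 ^ n) else 0)"

lemma untensor_clin: "clin (untensor n d)"
  by (auto simp: clin_def untensor_def fun_eq_iff cscale_complex_def algebra_simps)

lemma untensor_mem: "untensor n d \<phi> \<in> supp_fun (d * 2 ^ n)"
  by (auto simp: untensor_def supp_fun_def)

lemma untensor_at:
  assumes "i < d" "c < 2 ^ n"
  shows "untensor n d \<phi> (i * 2 ^ n + c) = reorder (dec n c) * \<phi> (dec n c) i"
proof -
  have "i * 2 ^ n + c < Suc i * 2 ^ n" using assms(2) by simp
  also have "\<dots> \<le> d * 2 ^ n" using assms(1) by (intro mult_le_mono1) simp
  finally show ?thesis using assms(2) by (simp add: untensor_def)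
qed

lemma untensor_inj:
  assumes "\<phi> \<in> tsp n (supp_fun d)" "untensor n d \<phi> = 0"
  shows "\<phi> = 0"
proof (intro ext)
  fix J i
  show "\<phi> J i = 0 J i"
  proof (cases "J \<subseteq> {1..n} \<and> i < d")
    case True
    then obtain c where c: "c < 2 ^ n" "J = dec n c"
      using bij_betw_imp_surj_on[OF dec_bij, of n] by blast
    have "reorder J * \<phi> J i = 0" using untensor_at[of i d c n \<phi>] True c assms(2) by simp
    then show ?thesis by (simp add: reorder_def)
  next
    case False
    then show ?thesis using assms(1) by (auto simp: tsp_def supp_fun_def)
  qed
qed

lemma untensor_surj:
  assumes "g \<in> supp_fun (d * 2 ^ n)"
  shows "\<exists>\<phi>\<in>tsp n (supp_fun d). untensor n d \<phi> = g"
proof -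
  let ?inv = "inv_into {..<2 ^ n} (dec n)"
  define \<phi> where "\<phi> J i = (if J \<subseteq> {1..n} \<and> i < d then reorder J * g (i * 2 ^ n + ?inv J) else 0)" for J i
  have inv: "?inv (dec n c) = c" if "c < 2 ^ n" for c
    using dec_bij that by (intro inv_into_f_f) (auto simp: bij_betw_def)
  have "\<phi> \<in> tsp n (supp_fun d)" by (auto simp: tsp_def supp_fun_def \<phi>_def fun_eq_iff)
  moreover have "untensor n d \<phi> = g"
  proof
    fix r
    show "untensor n d \<phi> r = g r"
    proof (cases "r < d * 2 ^ n")
      case True
      have m: "r mod 2 ^ n < 2 ^ n" "r div 2 ^ n < d" using True by (simp_all add: less_mult_imp_div_less)
      have "untensor n d \<phi> r = reorder (dec n (r mod 2 ^ n)) * (reorder (dec n (r mod 2 ^ n)) * g r)"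
        using True m dec_subset[OF m(1)] inv[OF m(1)] div_mult_mod_eq[of r "2 ^ n"] by (simp add: untensor_def \<phi>_def)
      then show ?thesis by (simp flip: mult.assoc)
    next
      case False
      then show ?thesis using assms by (simp add: untensor_def supp_fun_def)
    qed
  qed
  ultimately show ?thesis by blast
qed

definition tensor_act :: "nat \<Rightarrow> rep \<Rightarrow> complex mat \<Rightarrow> complex mat" where
  "tensor_act n V X = act (tensor_rep V (spinor n)) X"

lemma tensor_act_carrier:
  assumes "act V X \<in> carrier_mat (rdim V) (rdim V)"
  shows "tensor_act n V X \<in> carrier_mat (rdim V * 2 ^ n) (rdim V * 2 ^ n)"
  using assms carrier_matD[OF spinor_act_carrier[of n X]]
  by (auto simp: tensor_act_def tensor_rep_def spinor_def kronecker_def)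

lemma tensor_act_entry:
  assumes "act V X \<in> carrier_mat (rdim V) (rdim V)" "r < rdim V * 2 ^ n" "s < rdim V * 2 ^ n"
  shows "tensor_act n V X $$ (r, s) =
    act V X $$ (r div 2 ^ n, s div 2 ^ n) * (if r mod 2 ^ n = s mod 2 ^ n then 1 else 0) +
    (if r div 2 ^ n = s div 2 ^ n then 1 else 0) * spinor_act n X $$ (r mod 2 ^ n, s mod 2 ^ n)"
  using assms carrier_matD[OF spinor_act_carrier[of n X]]
  by (simp add: tensor_act_def tensor_rep_def spinor_def kronecker_def less_mult_imp_div_less)

text \<open>Linearity in \<open>X\<close> is what allows intertwining relations to be checked on the
  \<open>xmat\<close> alone.\<close>

lemma tensor_act_linear:
  assumes V: "is_rep n V" and X: "X \<in> orth n"
  shows "tensor_act n V (c \<cdot>\<^sub>m X) = c \<cdot>\<^sub>m tensor_act n V X"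
    and "Y \<in> orth n \<Longrightarrow> tensor_act n V (X + Y) = tensor_act n V X + tensor_act n V Y"
proof -
  have ca: "act V Z \<in> carrier_mat (rdim V) (rdim V)" if "Z \<in> orth n" for Z using V that by (simp add: is_rep_def)
  have cX: "Z \<in> carrier_mat (2 * n) (2 * n)" if "Z \<in> orth n" for Z using that by (simp add: orth_iff)
  note tc = carrier_matD[OF tensor_act_carrier[OF ca]]
  have bd: "r div 2 ^ n < rdim V" "r mod 2 ^ n < 2 ^ n" if "r < rdim V * 2 ^ n" for r
    using that by (simp_all add: less_mult_imp_div_less)
  have as: "act V (c \<cdot>\<^sub>m X) = c \<cdot>\<^sub>m act V X" using V X by (simp add: is_rep_def)
  show "tensor_act n V (c \<cdot>\<^sub>m X) = c \<cdot>\<^sub>m tensor_act n V X"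
  proof (rule eq_matI)
    fix r s assume "r < dim_row (c \<cdot>\<^sub>m tensor_act n V X)" "s < dim_col (c \<cdot>\<^sub>m tensor_act n V X)"
    then have rs: "r < rdim V * 2 ^ n" "s < rdim V * 2 ^ n" using tc[OF X] by simp_all
    have "(c \<cdot>\<^sub>m tensor_act n V X) $$ (r, s) = c * tensor_act n V X $$ (r, s)" using rs tc[OF X] by simp
    then show "tensor_act n V (c \<cdot>\<^sub>m X) $$ (r, s) = (c \<cdot>\<^sub>m tensor_act n V X) $$ (r, s)"
      using tensor_act_entry[OF ca[OF X] rs] tensor_act_entry[OF ca[OF orth_smult[OF X]] rs, of c]
        carrier_matD[OF ca[OF X]] carrier_matD[OF spinor_act_carrier[of n X]] bd[OF rs(1)] bd[OF rs(2)]
      by (simp add: as spinor_act_smult[OF cX[OF X]] algebra_simps)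
  qed (use tc[OF X] tc[OF orth_smult[OF X]] in simp_all)
  assume Y: "Y \<in> orth n"
  have aa: "act V (X + Y) = act V X + act V Y" using V X Y by (simp add: is_rep_def)
  show "tensor_act n V (X + Y) = tensor_act n V X + tensor_act n V Y"
  proof (rule eq_matI)
    fix r s assume "r < dim_row (tensor_act n V X + tensor_act n V Y)" "s < dim_col (tensor_act n V X + tensor_act n V Y)"
    then have rs: "r < rdim V * 2 ^ n" "s < rdim V * 2 ^ n" using tc[OF Y] by simp_all
    have "(tensor_act n V X + tensor_act n V Y) $$ (r, s) = tensor_act n V X $$ (r, s) + tensor_act n V Y $$ (r, s)"
      using rs tc[OF Y] by simp
    then show "tensor_act n V (X + Y) $$ (r, s) = (tensor_act n V X + tensor_act n V Y) $$ (r, s)"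
      using tensor_act_entry[OF ca[OF X] rs] tensor_act_entry[OF ca[OF Y] rs] tensor_act_entry[OF ca[OF orth_add[OF X Y]] rs]
        carrier_matD[OF ca[OF Y]] carrier_matD[OF spinor_act_carrier[of n Y]] bd[OF rs(1)] bd[OF rs(2)]
      by (simp add: aa spinor_act_add[OF cX[OF X] cX[OF Y]] algebra_simps)
  qed (use tc[OF Y] tc[OF orth_add[OF X Y]] in simp_all)
qed

lemma tensor_act_untensor:
  assumes V: "is_rep n V" and p: "p \<in> index_set n" and q: "q \<in> index_set n" and \<phi>: "\<phi> \<in> tsp n (supp_fun (rdim V))"
  shows "mop (tensor_act n V (xmat n p q)) (untensor n (rdim V) \<phi>) = untensor n (rdim V) (tens (repF n V) p q \<phi>)"
proof
  let ?d = "rdim V" and ?X = "xmat n p q" and ?m = "2 ^ n :: nat"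
  let ?A = "act V ?X" and ?S = "spinor_act n ?X" and ?u = "untensor n ?d \<phi>"
  have cA: "?A \<in> carrier_mat ?d ?d" using V xmat_orth[OF p q] by (simp add: is_rep_def)
  note tc = carrier_matD[OF tensor_act_carrier[OF cA, of n]]
  note rep = representsD[OF represents_spin[OF p q]]
  fix r
  show "mop (tensor_act n V ?X) ?u r = untensor n ?d (tens (repF n V) p q \<phi>) r"
  proof (cases "r < ?d * ?m")
    case False
    then show ?thesis using tc by (simp add: mop_def untensor_def)
  next
    case True
    define i where "i = r div ?m"
    define c where "c = r mod ?m"
    have ic: "i < ?d" "c < ?m" using True by (simp_all add: i_def c_def less_mult_imp_div_less)
    have r: "r = i * ?m + c" unfolding i_def c_def div_mult_mod_eq ..
    have "mop (tensor_act n V ?X) ?u r = (\<Sum>s<?d * ?m. tensor_act n V ?X $$ (r, s) * ?u s)"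
      using True tc by (simp add: mop_def)
    also have "\<dots> = (\<Sum>j<?d. \<Sum>c'<?m. tensor_act n V ?X $$ (r, j * ?m + c') * ?u (j * ?m + c'))"
      by (rule sum_pairs) simp
    also have "\<dots> = (\<Sum>j<?d. \<Sum>c'<?m. (if c' = c then ?A $$ (i, j) * (reorder (dec n c) * \<phi> (dec n c) j) else 0) +
       (if i = j then ?S $$ (c, c') * (reorder (dec n c') * \<phi> (dec n c') i) else 0))"
    proof (intro sum.cong refl)
      fix j c' assume "j \<in> {..<?d}" "c' \<in> {..<?m}"
      then have jc: "j < ?d" "c' < ?m" by auto
      have "j * ?m + c' < Suc j * ?m" using jc(2) by simp
      also have "\<dots> \<le> ?d * ?m" using jc(1) by (intro mult_le_mono1) simp
      finally have s: "j * ?m + c' < ?d * ?m" .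
      have "(j * ?m + c') div ?m = j" "(j * ?m + c') mod ?m = c'" using jc(2) by simp_all
      then show "tensor_act n V ?X $$ (r, j * ?m + c') * ?u (j * ?m + c') =
        (if c' = c then ?A $$ (i, j) * (reorder (dec n c) * \<phi> (dec n c) j) else 0) +
        (if i = j then ?S $$ (c, c') * (reorder (dec n c') * \<phi> (dec n c') i) else 0)"
        unfolding tensor_act_entry[OF cA True s] untensor_at[OF jc]
        by (auto simp: algebra_simps simp flip: i_def c_def)
    qed
    also have "\<dots> = (\<Sum>j<?d. ?A $$ (i, j) * (reorder (dec n c) * \<phi> (dec n c) j)) +
       (\<Sum>c'<?m. ?S $$ (c, c') * (reorder (dec n c') * \<phi> (dec n c') i))"
    proof -
      have "(\<Sum>c'<?m. if i = j then ?S $$ (c, c') * (reorder (dec n c') * \<phi> (dec n c') i) else 0) =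
        (if i = j then \<Sum>c'<?m. ?S $$ (c, c') * (reorder (dec n c') * \<phi> (dec n c') i) else 0)" for j by simp
      then show ?thesis using ic by (simp add: sum.distrib)
    qed
    also have "(\<Sum>j<?d. ?A $$ (i, j) * (reorder (dec n c) * \<phi> (dec n c) j)) = reorder (dec n c) * mop ?A (\<phi> (dec n c)) i"
      using ic cA by (simp add: mop_def sum_distrib_left mult_ac)
    also have "(\<Sum>c'<?m. ?S $$ (c, c') * (reorder (dec n c') * \<phi> (dec n c') i)) =
       mop ?S (\<lambda>c. reorder (dec n c) * \<phi> (dec n c) i) c"
      using ic carrier_matD[OF rep(1)] by (simp add: mop_def)
    also have "\<dots> = reorder (dec n c) * spin p q (\<lambda>J. \<phi> J i) (dec n c)"
      by (rule rep(2)[OF ic(2), of "\<lambda>J. \<phi> J i"])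
    \<comment> \<open>Evaluation at the coordinate \<open>i\<close> is linear, so it passes through
      the spinor action.\<close>
    also have "spin p q (\<lambda>J. \<phi> J i) (dec n c) = spin p q \<phi> (dec n c) i"
    proof -
      have "clin (\<lambda>u :: nat \<Rightarrow> complex. u i)" by (simp add: clin_def)
      from spin_pointwise[OF this, of p q \<phi>] show ?thesis by (rule fun_cong[OF sym])
    qed
    finally have "mop (tensor_act n V ?X) ?u r = reorder (dec n c) * tens (repF n V) p q \<phi> (dec n c) i"
      by (simp add: tens_def repF_def distrib_left)
    then show ?thesis using untensor_at[OF ic(1,2), of "tens (repF n V) p q \<phi>"] by (simp only: r)
  qed
qed

text \<open>A map out of a direct sum in coordinates: each block of the input is cut out, mapped by
  its own \<open>g\<close>, and the images are added. The blocks follow each other as in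
  \<open>diag_block_mat\<close>.\<close>

fun block_sum :: "(nat \<times> ((nat \<Rightarrow> complex) \<Rightarrow> nat \<Rightarrow> complex)) list \<Rightarrow> (nat \<Rightarrow> complex) \<Rightarrow> nat \<Rightarrow> complex" where
  "block_sum [] f = 0"
| "block_sum ((d, g) # xs) f = g (\<lambda>i. if i < d then f i else 0) + block_sum xs (\<lambda>i. f (i + d))"

declare block_sum.simps [simp del]

lemma block_sum_clin:
  assumes "\<And>d g. (d, g) \<in> set xs \<Longrightarrow> (\<forall>x\<in>supp_fun d. \<forall>y\<in>supp_fun d. g (x + y) = g x + g y) \<and>
      (\<forall>c. \<forall>x\<in>supp_fun d. g (c *c x) = c *c g x)"
  shows "clin (block_sum xs)"
  using assms
proof (induction xs)
  case Nil
  show ?case unfolding clin_def block_sum.simps by (simp add: fun_eq_iff cscale_apply cscale_complex_def)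
next
  case (Cons a xs)
  obtain d g where a: "a = (d, g)" by (cases a)
  have "(\<forall>x\<in>supp_fun d. \<forall>y\<in>supp_fun d. g (x + y) = g x + g y) \<and>
      (\<forall>c. \<forall>x\<in>supp_fun d. g (c *c x) = c *c g x)" if "(d, g) \<in> set xs" for d g
    by (rule Cons.prems[OF list.set_intros(2)[OF that]])
  then have IH: "clin (block_sum xs)" by (rule Cons.IH)
  define cut where "cut f = (\<lambda>i. if i < d then f i else 0)" for f :: "nat \<Rightarrow> complex"
  define sh where "sh f = (\<lambda>i. f (i + d))" for f :: "nat \<Rightarrow> complex"
  have c: "cut f \<in> supp_fun d" for f by (simp add: cut_def supp_fun_def)
  have ga: "(d, g) \<in> set (a # xs)" by (simp add: a)
  have e: "block_sum (a # xs) f = g (cut f) + block_sum xs (sh f)" for f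
    unfolding a block_sum.simps cut_def sh_def ..
  have "cut (x + y) = cut x + cut y" "cut (k *c x) = k *c cut x" "sh (x + y) = sh x + sh y" "sh (k *c x) = k *c sh x" for x y k
    by (auto simp: cut_def sh_def fun_eq_iff cscale_complex_def)
  moreover have "g (cut x + cut y) = g (cut x) + g (cut y)" "g (k *c cut x) = k *c g (cut x)" for x y k
    using Cons.prems[OF ga] c by blast+
  ultimately show ?case
    unfolding clin_def e by (simp only: clin_add[OF IH] clin_scale[OF IH] cscale_right_distrib add_ac) simp
qed

lemma block_sum_hom:
  assumes "\<And>V g. (V, g) \<in> set xs \<Longrightarrow> act V X \<in> carrier_mat (rdim V) (rdim V) \<and>
      (\<forall>f\<in>supp_fun (rdim V). g (mop (act V X) f) = mop A (g f))"
  shows "block_sum (map (\<lambda>(V, g). (rdim V, g)) xs) (mop (diag_block_mat (map (\<lambda>V. act V X) (map fst xs))) f) =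
    mop A (block_sum (map (\<lambda>(V, g). (rdim V, g)) xs) f)"
  using assms
proof (induction xs arbitrary: f)
  case Nil
  show ?case unfolding list.map block_sum.simps by (rule clin_zero[OF mop_clin, symmetric])
next
  case (Cons a xs)
  obtain V g where a: "a = (V, g)" by (cases a)
  let ?d = "rdim V" and ?B = "act V X" and ?D = "diag_block_mat (map (\<lambda>V. act V X) (map fst xs))"
  have B: "?B \<in> carrier_mat ?d ?d" and g: "\<And>f. f \<in> supp_fun ?d \<Longrightarrow> g (mop ?B f) = mop A (g f)"
    using Cons.prems[of V g] a by auto
  define cut where "cut f = (\<lambda>i. if i < ?d then f i else 0)" for f :: "nat \<Rightarrow> complex"
  define sh where "sh f = (\<lambda>i. f (i + ?d))" for f :: "nat \<Rightarrow> complex"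
  have c: "cut f \<in> supp_fun ?d" by (simp add: cut_def supp_fun_def)
  define F where "F = mop (diag_block_mat (map (\<lambda>V. act V X) (map fst (a # xs)))) f"
  have F: "F = mop (four_block_mat ?B (0\<^sub>m ?d (dim_col ?D)) (0\<^sub>m (dim_row ?D) ?d) ?D) f"
    using carrier_matD[OF B] by (simp add: F_def a Let_def)
  have s: "(\<Sum>j<?d + k. h j) = (\<Sum>j<?d. h j) + (\<Sum>j<k. h (j + ?d))" for h :: "nat \<Rightarrow> complex" and k
    by (induction k) (simp_all add: add.commute add.left_commute)
  have 1: "cut F = mop ?B (cut f)"
    unfolding F using carrier_matD[OF B] by (auto simp: cut_def mop_def s fun_eq_iff)
  have 2: "sh F = mop ?D (sh f)"
    unfolding F using carrier_matD[OF B] by (auto simp: sh_def mop_def s fun_eq_iff)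
  have IH: "block_sum (map (\<lambda>(V, g). (rdim V, g)) xs) (mop ?D (sh f)) = mop A (block_sum (map (\<lambda>(V, g). (rdim V, g)) xs) (sh f))"
    using Cons.prems by (intro Cons.IH) auto
  have e: "block_sum (map (\<lambda>(V, g). (rdim V, g)) (a # xs)) h = g (cut h) + block_sum (map (\<lambda>(V, g). (rdim V, g)) xs) (sh h)" for h
    unfolding a list.map prod.case block_sum.simps cut_def sh_def ..
  show ?case
    unfolding F_def[symmetric] e 1 2 IH g[OF c] by (rule clin_add[OF mop_clin, symmetric])
qed

text \<open>The images of the blocks are kept as an explicit list \<open>h\<close>, so that
  independence of the images can be applied to its sum; the last clause then gives
  injectivity.\<close>

lemma block_sum_components:
  assumes "\<And>d g. (d, g) \<in> set xs \<Longrightarrow> g 0 = 0 \<and> inj_on g (supp_fun d)" "f \<in> supp_fun (sum_list (map fst xs))"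
  shows "\<exists>h. length h = length xs \<and> (\<forall>i<length xs. h ! i \<in> snd (xs ! i) ` supp_fun (fst (xs ! i))) \<and>
    block_sum xs f = sum_list h \<and> ((\<forall>i<length xs. h ! i = 0) \<longrightarrow> f = 0)"
  using assms
proof (induction xs arbitrary: f)
  case Nil
  then show ?case by (auto simp: block_sum.simps supp_fun_def fun_eq_iff)
next
  case (Cons a xs)
  obtain d g where a: "a = (d, g)" by (cases a)
  define cut where "cut = (\<lambda>i. if i < d then f i else 0)"
  define sh where "sh = (\<lambda>i. f (i + d))"
  have c: "cut \<in> supp_fun d" by (simp add: cut_def supp_fun_def)
  have shm: "sh \<in> supp_fun (sum_list (map fst xs))" using Cons.prems(2) a by (auto simp: sh_def supp_fun_def)
  have IHa: "\<And>d g. (d, g) \<in> set xs \<Longrightarrow> g 0 = 0 \<and> inj_on g (supp_fun d)"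
    using Cons.prems(1) by (meson list.set_intros(2))
  obtain h where h: "length h = length xs" "\<forall>i<length xs. h ! i \<in> snd (xs ! i) ` supp_fun (fst (xs ! i))"
    "block_sum xs sh = sum_list h" "(\<forall>i<length xs. h ! i = 0) \<longrightarrow> sh = 0"
    using Cons.IH[OF IHa shm] by blast
  have e: "block_sum (a # xs) f = g cut + block_sum xs sh"
    unfolding a block_sum.simps cut_def sh_def ..
  have z: "f = 0" if "\<forall>i<length (a # xs). (g cut # h) ! i = 0"
  proof -
    have "g cut = 0" "\<forall>i<length xs. h ! i = 0" using that by (auto simp: nth_Cons split: nat.splits)
    moreover have "0 \<in> supp_fun d" by (simp add: supp_fun_def)
    moreover have "g 0 = 0" "inj_on g (supp_fun d)"
      using Cons.prems(1)[of d g] unfolding a by (meson list.set_intros(1))+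
    ultimately have "cut = 0" "sh = 0" using inj_onD[of g "supp_fun d" cut 0] c h(4) by metis+
    then have c0: "cut i = 0" and s0: "sh (i - d) = 0" for i by simp_all
    have "f i = 0" for i using c0[of i] s0[of i] by (cases "i < d") (simp_all add: cut_def sh_def)
    then show ?thesis by (simp add: fun_eq_iff)
  qed
  show ?case
  proof (intro exI[of _ "g cut # h"] conjI)
    show "(\<forall>i<length (a # xs). (g cut # h) ! i = 0) \<longrightarrow> f = 0" by (rule impI, rule z)
    show "length (g cut # h) = length (a # xs)" using h(1) by simp
    show "\<forall>i<length (a # xs). (g cut # h) ! i \<in> snd ((a # xs) ! i) ` supp_fun (fst ((a # xs) ! i))"
      using h(2) a c by (auto simp: nth_Cons split: nat.splits)
    show "block_sum (a # xs) f = sum_list (g cut # h)" unfolding e h(3) by simp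
  qed
qed

lemma block_sum_surj:
  assumes "length h = length xs" "\<And>i. i < length xs \<Longrightarrow> h ! i \<in> snd (xs ! i) ` supp_fun (fst (xs ! i))"
  shows "\<exists>f\<in>supp_fun (sum_list (map fst xs)). block_sum xs f = sum_list h"
  using assms
proof (induction xs arbitrary: h)
  case Nil
  then show ?case by (intro bexI[of _ 0]) (auto simp: block_sum.simps supp_fun_def)
next
  case (Cons a xs)
  obtain d g where a: "a = (d, g)" by (cases a)
  obtain x h' where h: "h = x # h'" using Cons.prems(1) by (cases h) auto
  obtain u where u: "x = g u" "u \<in> supp_fun d" using Cons.prems(2)[of 0] h a by auto
  have "h' ! i \<in> snd (xs ! i) ` supp_fun (fst (xs ! i))" if "i < length xs" for i
    using Cons.prems(2)[of "Suc i"] that h by simp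
  then obtain f where f: "f \<in> supp_fun (sum_list (map fst xs))" "block_sum xs f = sum_list h'"
    using Cons.IH[of h'] Cons.prems(1) h by auto
  define F where "F = (\<lambda>i. if i < d then u i else f (i - d))"
  have "(\<lambda>i. if i < d then F i else 0) = u" "(\<lambda>i. F (i + d)) = f"
    using u(2) by (auto simp: F_def supp_fun_def fun_eq_iff)
  then have "block_sum (a # xs) F = sum_list h"
    unfolding a block_sum.simps h sum_list.Cons by (simp only: u(1) f(2))
  moreover have "F \<in> supp_fun (sum_list (map fst (a # xs)))"
    using f(1) a by (auto simp: F_def supp_fun_def)
  ultimately show ?case by blast
qed

section \<open>Decomposition of the tensor product\<close>

text \<open>The components of \<open>u\<close> in the direct sum are again singular and of the same
  weight. A nonzero one, for \<open>K\<close>, is a multiple of \<open>w K\<close>, and comparing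
  weights gives \<open>K = J\<close>.\<close>

lemma (in spin_tensor) singular_component_nonzero:
  assumes u: "u \<in> V" "u \<noteq> 0" "sing k G u" "has_wt k G (\<lambda>i. l i + spin_wt J i) u" and J: "J \<subseteq> {1..k}"
  shows "w J \<noteq> 0"
proof -
  let ?A = "{K. K \<subseteq> {1..k} \<and> w K \<noteq> 0}"
  obtain f where f: "\<And>K. f K \<in> gen k G (w K)" and uf: "u = (\<Sum>K\<in>?A. f K)"
    using components_span[OF u(1)] by blast
  have fin: "finite ?A" by simp
  have zero: "H (f K) = 0" if H: "clin H" "H u = 0" "\<And>K. H (f K) \<in> gen k G (w K)" and K: "K \<in> ?A" for H K
  proof (rule components_independent[OF fin _ H(3) _ K])
    show "(\<Sum>K\<in>?A. H (f K)) = 0" using H(2) unfolding uf clin_sum[OF H(1)] .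
  qed auto
  obtain K where K: "K \<in> ?A" "f K \<noteq> 0"
    using u(2) uf by (metis (no_types, lifting) sum.neutral)
  have s: "sing k G (f K)" unfolding sing_def
  proof (intro ballI impI)
    fix p q assume pq: "p \<in> index_set k" "q \<in> index_set k" "p < q"
    have "G p q u = 0" using u(3) pq unfolding sing_def by blast
    then show "G p q (f K) = 0"
      by (rule zero[OF t.F_clin[OF pq(1,2)] _ inv_subD(2)[OF inv_sub_gens pq(1,2) f] K(1)])
  qed
  have h: "has_wt k G (\<lambda>i. l i + spin_wt J i) (f K)" unfolding has_wt_def
  proof
    fix i assume i: "i \<in> {1..k}"
    define c where "c = complex_of_real (l i + spin_wt J i)"
    let ?H = "\<lambda>x. G (- int i) (- int i) x - c *c x"
    have ii: "- int i \<in> index_set k" using i by simp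
    have "clin ?H" unfolding clin_def
      by (simp add: clin_add[OF t.F_clin[OF ii ii]] clin_scale[OF t.F_clin[OF ii ii]] cscale_right_distrib
          cv.scale_right_diff_distrib mult.commute)
    moreover have "?H u = 0" using u(4) i by (simp add: has_wt_def c_def)
    moreover have "?H (f K) \<in> gen k G (w K)" for K
      by (rule inv_subD(5)[OF inv_sub_gens inv_subD(2)[OF inv_sub_gens ii ii f] inv_subD(6)[OF inv_sub_gens f]])
    ultimately have "?H (f K) = 0" by (rule zero[OF _ _ _ K(1)])
    then show "G (- int i) (- int i) (f K) = complex_of_real (l i + spin_wt J i) *c f K" by (simp add: c_def)
  qed
  have Ks: "K \<subseteq> {1..k}" "w K \<noteq> 0" using K(1) by auto
  note irr = gen_irred[OF w(1,2)[OF Ks(1)] Ks(2) w(3)[OF Ks(1)]]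
  obtain c where c: "f K = c *c w K" using t.hw_irred_singular[OF irr f s] by blast
  have "spin_wt K i = spin_wt J i" if i: "i \<in> {1..k}" for i
  proof -
    have "complex_of_real (l i + spin_wt K i) *c f K = G (- int i) (- int i) (f K)"
      using w(3)[OF Ks(1)] i clin_scale[OF t.F_diag_clin[OF i], of c "w K"]
      unfolding c by (simp add: has_wt_def mult.commute)
    also have "\<dots> = complex_of_real (l i + spin_wt J i) *c f K" using h i by (simp add: has_wt_def)
    finally have "complex_of_real (l i + spin_wt K i) = complex_of_real (l i + spin_wt J i)"
      using K(2) by (simp only: cv.scale_cancel_right simp_thms)
    then show ?thesis by (simp only: of_real_eq_iff add_left_cancel)
  qed
  then have "K = J" by (rule spin_wt_inj[OF Ks(1) J])
  then show ?thesis using Ks by simp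
qed

section \<open>Comparison of the two descriptions of dominant weights\<close>

lemma dominant_weights_real:
  assumes "\<nu> \<in> dominant_weights n" "i < n"
  shows "\<nu> $ i = complex_of_real (Re (\<nu> $ i))"
proof -
  have "\<nu> $ i \<in> \<int> \<or> \<nu> $ i - 1 / 2 \<in> \<int>" using assms by (auto simp: dominant_weights_def)
  then have "Im (\<nu> $ i) = 0"
  proof
    assume "\<nu> $ i \<in> \<int>"
    then show ?thesis by (auto elim!: Ints_cases)
  next
    assume "\<nu> $ i - 1 / 2 \<in> \<int>"
    then obtain m where "\<nu> $ i - 1 / 2 = of_int m" by (auto elim: Ints_cases)
    then have "Im (\<nu> $ i - 1 / 2) = Im (of_int m)" by (rule arg_cong)
    then show ?thesis by simp
  qed
  then show ?thesis by (simp add: complex_eq_iff)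
qed

lemma of_real_in_Ints_iff: "complex_of_real x \<in> \<int> \<longleftrightarrow> x \<in> \<int>"
proof
  assume "complex_of_real x \<in> \<int>"
  then obtain m where "complex_of_real x = of_int m" by (auto elim: Ints_cases)
  then have "Re (complex_of_real x) = Re (of_int m)" by (rule arg_cong)
  then show "x \<in> \<int>" by simp
qed (auto elim!: Ints_cases)

text \<open>The two integrality classes come from the roots: adding \<open>r 0 - r 1\<close> and
  \<open>r 0 + r 1\<close> shows that \<open>2 * r 0\<close> is an integer, and its parity decides
  between integers and half-integers for all entries.\<close>

lemma dominant_weights_iff:
  assumes n: "2 \<le> n" and c: "\<nu> \<in> carrier_vec n" and l: "\<And>i. i \<in> {1..n} \<Longrightarrow> \<nu> $ (n - i) = complex_of_real (l i)"
  shows "\<nu> \<in> dominant_weights n \<longleftrightarrow> dominant n l"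
proof -
  define r where "r a = l (n - a)" for a
  have \<nu>: "\<nu> $ a = complex_of_real (r a)" if "a < n" for a using l[of "n - a"] that by (simp add: r_def)
  have half: "complex_of_real x - 1 / 2 \<in> \<int> \<longleftrightarrow> x - 1 / 2 \<in> \<int>" for x
    using of_real_in_Ints_iff[of "x - 1 / 2"] by simp
  have dw: "\<nu> \<in> dominant_weights n \<longleftrightarrow> ((\<forall>i<n. r i \<in> \<int>) \<or> (\<forall>i<n. r i - 1 / 2 \<in> \<int>)) \<and>
     (\<forall>i. i + 2 < n \<longrightarrow> r (i + 1) \<le> r i) \<and> \<bar>r (n - 1)\<bar> \<le> r (n - 2)"
    using c n by (auto simp: dominant_weights_def \<nu> of_real_in_Ints_iff half)
  have dl: "dominant n l \<longleftrightarrow> (\<forall>a b. a < b \<longrightarrow> b < n \<longrightarrow> r a - r b \<in> \<nat> \<and> r a + r b \<in> \<nat>)"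
  proof
    assume d: "dominant n l"
    show "\<forall>a b. a < b \<longrightarrow> b < n \<longrightarrow> r a - r b \<in> \<nat> \<and> r a + r b \<in> \<nat>"
    proof (intro allI impI)
      fix a b :: nat assume "a < b" "b < n"
      then have "1 \<le> n - b" "n - b < n - a" "n - a \<le> n" by auto
      then show "r a - r b \<in> \<nat> \<and> r a + r b \<in> \<nat>" using d unfolding dominant_def r_def by blast
    qed
  next
    assume d: "\<forall>a b. a < b \<longrightarrow> b < n \<longrightarrow> r a - r b \<in> \<nat> \<and> r a + r b \<in> \<nat>"
    show "dominant n l" unfolding dominant_def
    proof (intro allI impI)
      fix i j assume ij: "1 \<le> i" "i < j" "j \<le> n"
      then have "n - j < n - i" "n - i < n" by auto
      then have "r (n - j) - r (n - i) \<in> \<nat> \<and> r (n - j) + r (n - i) \<in> \<nat>" using d by blast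
      then show "l j - l i \<in> \<nat> \<and> l j + l i \<in> \<nat>" using ij by (simp add: r_def)
    qed
  qed
  have nat: "x \<in> \<nat>" if "x \<in> \<int>" "0 \<le> x" for x :: real using that by (simp add: Nats_altdef2)
  show ?thesis unfolding dw dl
  proof (intro iffI allI impI)
    fix a b assume D: "((\<forall>i<n. r i \<in> \<int>) \<or> (\<forall>i<n. r i - 1 / 2 \<in> \<int>)) \<and>
     (\<forall>i. i + 2 < n \<longrightarrow> r (i + 1) \<le> r i) \<and> \<bar>r (n - 1)\<bar> \<le> r (n - 2)" and ab: "a < b" "b < n"
    have mono: "i \<le> j \<Longrightarrow> j \<le> n - 2 \<Longrightarrow> r j \<le> r i" for i j
    proof (induction j rule: dec_induct)
      case (step m)
      then have "r (m + 1) \<le> r m" using D n by (intro D[THEN conjunct2, THEN conjunct1, rule_format]) auto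
      then have "r (Suc m) \<le> r m" unfolding Suc_eq_plus1 .
      then show ?case using step by simp
    qed simp
    have "\<bar>r b\<bar> \<le> r a"
    proof (cases "b = n - 1")
      case True
      then have "r (n - 2) \<le> r a" using ab by (intro mono) auto
      moreover have "\<bar>r (n - 1)\<bar> \<le> r (n - 2)" using D by blast
      ultimately show ?thesis unfolding True by (rule order_trans[rotated])
    next
      case False
      then have "r (n - 2) \<le> r b" "r b \<le> r a" using ab by (intro mono; simp)+
      then show ?thesis using D by linarith
    qed
    moreover have "r a - r b \<in> \<int>" "r a + r b \<in> \<int>"
    proof -
      have "(r a \<in> \<int> \<and> r b \<in> \<int>) \<or> (r a - 1 / 2 \<in> \<int> \<and> r b - 1 / 2 \<in> \<int>)" using D ab by auto
      then have "r a - r b \<in> \<int> \<and> r a + r b \<in> \<int>"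
      proof
        assume h: "r a - 1 / 2 \<in> \<int> \<and> r b - 1 / 2 \<in> \<int>"
        then obtain p q where "r a - 1 / 2 = of_int p" "r b - 1 / 2 = of_int q" by (auto elim!: Ints_cases)
        then have "r a - r b = of_int (p - q)" "r a + r b = of_int (p + q + 1)" by simp_all
        then show ?thesis by (metis Ints_of_int)
      qed simp
      then show "r a - r b \<in> \<int>" "r a + r b \<in> \<int>" by auto
    qed
    ultimately show "r a - r b \<in> \<nat> \<and> r a + r b \<in> \<nat>" by (intro conjI nat) linarith+
  next
    assume D: "\<forall>a b. a < b \<longrightarrow> b < n \<longrightarrow> r a - r b \<in> \<nat> \<and> r a + r b \<in> \<nat>"
    have ge: "0 \<le> r a - r b" "0 \<le> r a + r b" if "a < b" "b < n" for a b
      using D that by (metis Nats_altdef2 mem_Collect_eq)+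
    have int: "r a - r b \<in> \<int>" "r a + r b \<in> \<int>" if "a < b" "b < n" for a b
      using D that by (metis Nats_altdef2 mem_Collect_eq)+
    have "(0::nat) < 1" "1 < n" using n by simp_all
    from Ints_add[OF int[OF this]] obtain m where "r 0 - r 1 + (r 0 + r 1) = of_int m" by (rule Ints_cases)
    then have m: "2 * r 0 = of_int m" by simp
    have diff: "r i - r 0 \<in> \<int>" if "i < n" for i
    proof (cases "i = 0")
      case False
      then have "- (r 0 - r i) \<in> \<int>" using that by (intro Ints_minus int(1)) simp_all
      then show ?thesis unfolding minus_diff_eq .
    qed simp
    have "(\<forall>i<n. r i \<in> \<int>) \<or> (\<forall>i<n. r i - 1 / 2 \<in> \<int>)"
    proof (cases "even m")
      case True
      then obtain k where "m = 2 * k" by blast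
      then have "r 0 = of_int k" using m by simp
      then have "r 0 \<in> \<int>" by simp
      from Ints_add[OF diff this] have "r i \<in> \<int>" if "i < n" for i using that by simp
      then show ?thesis by blast
    next
      case False
      then obtain k where "m = 2 * k + 1" by (elim oddE)
      then have "r 0 - 1 / 2 = of_int k" using m by simp
      then have "r 0 - 1 / 2 \<in> \<int>" by simp
      from Ints_add[OF diff this] have "r i - 1 / 2 \<in> \<int>" if "i < n" for i
        using that by (simp only: diff_add_cancel add_diff_eq)
      then show ?thesis by blast
    qed
    moreover have "r (i + 1) \<le> r i" if "i + 2 < n" for i using ge(1)[of i "i + 1"] that by simp
    moreover have "\<bar>r (n - 1)\<bar> \<le> r (n - 2)" 
    proof -
      have "n - 2 < n - 1" "n - 1 < n" using n by simp_all
      from ge[OF this] show ?thesis unfolding abs_le_iff by (intro conjI; linarith)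
    qed
    ultimately show "((\<forall>i<n. r i \<in> \<int>) \<or> (\<forall>i<n. r i - 1 / 2 \<in> \<int>)) \<and>
     (\<forall>i. i + 2 < n \<longrightarrow> r (i + 1) \<le> r i) \<and> \<bar>r (n - 1)\<bar> \<le> r (n - 2)" by blast
  qed
qed

lemma tsp_supp_fun_span:
  "tsp n (supp_fun d) \<subseteq> cv.span ((\<lambda>(j, J). pure (unit_fun j) J) ` ({..<d} \<times> Pow {1..n}))"
proof
  let ?B = "(\<lambda>(j, J). pure (unit_fun j) J) ` ({..<d} \<times> Pow {1..n})"
  fix \<phi> :: "nat set \<Rightarrow> nat \<Rightarrow> complex" assume \<phi>: "\<phi> \<in> tsp n (supp_fun d)"
  have "pure (\<phi> J) J \<in> cv.span ?B" if J: "J \<in> Pow {1..n}" for J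
  proof -
    have m: "\<phi> J \<in> supp_fun d" using \<phi> by (simp add: tsp_def)
    have "pure (\<phi> J) J = pure (\<Sum>j<d. \<phi> J j *c unit_fun j) J" using supp_fun_eq_sum[OF m] by (rule arg_cong)
    also have "\<dots> = (\<Sum>j<d. \<phi> J j *c pure (unit_fun j) J)"
      unfolding clin_sum[OF pure_clin, of _ _ J] clin_scale[OF pure_clin, of _ _ J] ..
    also have "\<dots> \<in> cv.span ?B" using J by (intro cv.span_sum cv.span_scale cv.span_base) auto
    finally show ?thesis .
  qed
  then have "(\<Sum>J\<in>Pow {1..n}. pure (\<phi> J) J) \<in> cv.span ?B" by (intro cv.span_sum)
  then show "\<phi> \<in> cv.span ?B" unfolding tsp_eq_sum_pure[OF \<phi>, symmetric] .
qed

text \<open>\<open>P\<close> is the matrix of the inverse of \<open>g\<close>, because the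
  isomorphism is wanted from the tensor product to the direct sum while \<open>g\<close> goes the
  other way. The dimensions agree by the trace argument for two mutually inverse matrices.\<close>

lemma bijective_map_matrix:
  assumes g: "clin g" "\<And>f. f \<in> supp_fun M \<Longrightarrow> g f \<in> supp_fun D" "\<And>f. f \<in> supp_fun M \<Longrightarrow> g f = 0 \<Longrightarrow> f = 0"
    "\<And>y. y \<in> supp_fun D \<Longrightarrow> \<exists>f\<in>supp_fun M. g f = y"
  shows "M = D \<and> (\<exists>P\<in>carrier_mat M D. invertible_mat P \<and> (\<forall>A B. A \<in> carrier_mat D D \<longrightarrow> B \<in> carrier_mat M M \<longrightarrow>
    (\<forall>f\<in>supp_fun M. g (mop B f) = mop A (g f)) \<longrightarrow> P * A = B * P))"
proof -
  define h where "h y = (SOME f. f \<in> supp_fun M \<and> g f = y)" for y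
  have h: "h y \<in> supp_fun M" "g (h y) = y" if "y \<in> supp_fun D" for y
    using someI_ex[of "\<lambda>f. f \<in> supp_fun M \<and> g f = y"] g(4)[OF that] unfolding h_def by blast+
  note sM = supp_fun_subspace[of M] and sD = supp_fun_subspace[of D]
  have inj: "x = y" if "x \<in> supp_fun M" "y \<in> supp_fun M" "g x = g y" for x y
  proof -
    have "g (x - y) = 0" unfolding clin_diff[OF g(1)] that(3) by simp
    then have "x - y = 0" by (rule g(3)[OF cv.subspace_diff[OF sM that(1,2)]])
    then show ?thesis by (rule eq_iff_diff_eq_0[THEN iffD2])
  qed
  have hg: "h (g f) = f" if "f \<in> supp_fun M" for f
    by (rule inj[OF h(1)[OF g(2)[OF that]] that h(2)[OF g(2)[OF that]]])
  have h_add: "h (x + y) = h x + h y" if "x \<in> supp_fun D" "y \<in> supp_fun D" for x y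
    by (rule inj) (simp_all only: h that cv.subspace_add[OF sD] cv.subspace_add[OF sM] clin_add[OF g(1)])
  have h_scale: "h (c *c x) = c *c h x" if "x \<in> supp_fun D" for x c
    by (rule inj) (simp_all only: h that cv.subspace_scale[OF sD] cv.subspace_scale[OF sM] clin_scale[OF g(1)])
  let ?P = "mat_of M D h" and ?Q = "mat_of D M g"
  have P: "?P \<in> carrier_mat M D" and Q: "?Q \<in> carrier_mat D M" by (simp_all add: mat_of_def)
  have mP: "mop ?P f = h f" if "f \<in> supp_fun D" for f
    by (rule mop_mat_of[OF that]) (simp_all only: h_add h_scale h)
  have mQ: "mop ?Q f = g f" if "f \<in> supp_fun M" for f
    by (rule mop_mat_of[OF that]) (simp_all only: clin_add[OF g(1)] clin_scale[OF g(1)] g(2))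
  have PQ: "?P * ?Q = 1\<^sub>m M"
  proof (rule mop_eqI)
    fix f assume f: "f \<in> supp_fun M"
    show "mop (?P * ?Q) f = mop (1\<^sub>m M) f" unfolding mop_mult[OF P Q] mQ[OF f] mP[OF g(2)[OF f]] hg[OF f] mop_one[OF f] ..
  qed (use P Q in auto)
  have QP: "?Q * ?P = 1\<^sub>m D"
  proof (rule mop_eqI)
    fix f assume f: "f \<in> supp_fun D"
    show "mop (?Q * ?P) f = mop (1\<^sub>m D) f" unfolding mop_mult[OF Q P] mP[OF f] mQ[OF h(1)[OF f]] h(2)[OF f] mop_one[OF f] ..
  qed (use P Q in auto)
  have MD: "M = D" by (rule inverse_mats_square[OF P Q PQ QP])
  have inv: "invertible_mat ?P"
    unfolding invertible_mat_def inverts_mat_def square_mat.simps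
    using PQ QP P Q MD by (intro conjI exI[of _ ?Q]) auto
  have "?P * A = B * ?P" if A: "A \<in> carrier_mat D D" and B: "B \<in> carrier_mat M M"
    and AB: "\<forall>f\<in>supp_fun M. g (mop B f) = mop A (g f)" for A B
  proof (rule mop_eqI)
    fix f assume f: "f \<in> supp_fun D"
    have "g (mop B (h f)) = mop A f" using AB h[OF f] by simp
    then have "h (mop A f) = mop B (h f)" using hg[OF mop_mem[OF B], of "h f"] by simp
    then show "mop (?P * A) f = mop (B * ?P) f"
      unfolding mop_mult[OF P A] mop_mult[OF B P] mP[OF f] mP[OF mop_mem[OF A]] .
  qed (use P A B in auto)
  then show ?thesis using MD inv P by blast
qed

lemma intertwines_orth:
  assumes n: "1 \<le> n" and V: "is_rep n V" and V': "is_rep n V'"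
    and T_add: "\<And>x y. x \<in> supp_fun (rdim V) \<Longrightarrow> y \<in> supp_fun (rdim V) \<Longrightarrow> T (x + y) = T x + T y"
    and T_scale: "\<And>c x. x \<in> supp_fun (rdim V) \<Longrightarrow> T (c *c x) = c *c T x"
    and xm: "\<And>p q f. p \<in> index_set n \<Longrightarrow> q \<in> index_set n \<Longrightarrow> f \<in> supp_fun (rdim V) \<Longrightarrow>
      T (mop (act V (xmat n p q)) f) = mop (tensor_act n V' (xmat n p q)) (T f)"
    and X: "X \<in> orth n" and f: "f \<in> supp_fun (rdim V)"
  shows "T (mop (act V X) f) = mop (tensor_act n V' X) (T f)"
  using n X f
proof (induction X arbitrary: f rule: orth_induct)
  case (xmat p q)
  then show ?case by (rule xm)
next
  case (smult c X)
  have a: "act V (c \<cdot>\<^sub>m X) = c \<cdot>\<^sub>m act V X" "act V X \<in> carrier_mat (rdim V) (rdim V)"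
    using V smult(1) by (simp_all add: is_rep_def)
  show ?case
    unfolding a(1) tensor_act_linear(1)[OF V' smult(1)] mop_smult T_scale[OF mop_mem[OF a(2)]] smult(2)[OF smult(3)] ..
next
  case (add X Y)
  have a: "act V (X + Y) = act V X + act V Y" "act V X \<in> carrier_mat (rdim V) (rdim V)" "act V Y \<in> carrier_mat (rdim V) (rdim V)"
    "act V' X \<in> carrier_mat (rdim V') (rdim V')" "act V' Y \<in> carrier_mat (rdim V') (rdim V')"
    using V V' add(1,2) by (simp_all add: is_rep_def)
  show ?case
    unfolding a(1) tensor_act_linear(2)[OF V' add(1,2)] mop_add[OF a(2,3)]
      mop_add[OF tensor_act_carrier[OF a(4)] tensor_act_carrier[OF a(5)]]
      T_add[OF mop_mem[OF a(2)] mop_mem[OF a(3)]] add(3)[OF add(5)] add(4)[OF add(5)] ..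
qed

lemma spin_vec_at: "i \<in> {1..n} \<Longrightarrow> spin_vec n J $ (n - i) = complex_of_real (spin_wt J i)"
  by (simp add: spin_vec_def)

lemma spin_vec_inj: "inj_on (spin_vec n) (Pow {1..n})"
proof (rule inj_onI)
  fix J K assume JK: "J \<in> Pow {1..n}" "K \<in> Pow {1..n}" and e: "spin_vec n J = spin_vec n K"
  show "J = K"
  proof (rule spin_wt_inj[of _ n])
    fix i assume "i \<in> {1..n}"
    then show "spin_wt J i = spin_wt K i" using spin_vec_at[of i n J] spin_vec_at[of i n K] e by simp
  qed (use JK in auto)
qed

theorem theorem3p1:
  fixes n :: nat and L :: "complex vec \<Rightarrow> rep" and lam :: "complex vec"
  assumes "n \<ge> 2"
    and "\<And>\<nu>. \<nu> \<in> dominant_weights n \<Longrightarrow> irreducible_of_highest_weight n \<nu> (L \<nu>)"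
    and "lam \<in> dominant_weights n"
  shows "\<exists>\<mu>s. distinct \<mu>s \<and>
           set \<mu>s = {\<mu> \<in> weights n (spinor n). lam + \<mu> \<in> dominant_weights n} \<and>
           rep_iso n (tensor_rep (L lam) (spinor n)) (direct_sum_rep (map (\<lambda>\<mu>. L (lam + \<mu>)) \<mu>s))"
proof -
  note L = assms(2)
  have n1: "1 \<le> n" using assms(1) by simp
  have lamc: "lam \<in> carrier_vec n" using assms(3) by (simp add: dominant_weights_def)
  have Lrep: "is_rep n (L \<nu>)" if "\<nu> \<in> dominant_weights n" for \<nu>
    using L[OF that] by (simp add: irreducible_of_highest_weight_def irreducible_rep_def)
  let ?d = "rdim (L lam)" and ?F = "repF n (L lam)"
  define l where "l i = Re (lam $ (n - i))" for i
  have lam_l: "lam $ (n - i) = complex_of_real (l i)" if "i \<in> {1..n}" for i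
    unfolding l_def by (rule dominant_weights_real[OF assms(3)]) (use that in simp)
  have dom: "dominant n l"
    using dominant_weights_iff[OF assms(1) lamc lam_l] assms(3) by blast
  define \<nu> where "\<nu> J = lam + spin_vec n J" for J
  have \<nu>c: "\<nu> J \<in> carrier_vec n" for J using lamc by (simp add: \<nu>_def spin_vec_def)
  have \<nu>_at: "\<nu> J $ (n - i) = complex_of_real (l i + spin_wt J i)" if "i \<in> {1..n}" for i J
  proof -
    have "\<nu> J $ (n - i) = lam $ (n - i) + spin_vec n J $ (n - i)"
      using that lamc by (simp add: \<nu>_def spin_vec_def)
    then show ?thesis using lam_l[OF that] spin_vec_at[OF that] by simp
  qed
  have \<nu>_dom: "\<nu> J \<in> dominant_weights n \<longleftrightarrow> dominant n (\<lambda>i. l i + spin_wt J i)" for J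
    by (rule dominant_weights_iff[OF assms(1) \<nu>c \<nu>_at])
  obtain v where v: "hw_irred n ?F (supp_fun ?d) l v"
    using hw_irred_repF[OF L[OF assms(3)] n1 lam_l] by blast
  have Frep: "so_rep n ?F" by (rule so_rep_repF[OF Lrep[OF assms(3)]])
  interpret S: spin_tensor n ?F "supp_fun ?d" l v
    by (intro spin_tensor.intro spin_tensor_axioms.intro Frep v dom)
  have hwJ: "\<exists>v'. hw_irred n (repF n (L (\<nu> J))) (supp_fun (rdim (L (\<nu> J)))) (\<lambda>i. l i + spin_wt J i) v'"
    if "\<nu> J \<in> dominant_weights n" for J
    by (rule hw_irred_repF[OF L[OF that] n1 \<nu>_at])
  define A where "A = {J. J \<subseteq> {1..n} \<and> \<nu> J \<in> dominant_weights n}"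
  have finA: "finite A" by (rule finite_subset[of _ "Pow {1..n}"]) (auto simp: A_def)
  have w_iff: "S.w J \<noteq> 0 \<longleftrightarrow> \<nu> J \<in> dominant_weights n" if J: "J \<subseteq> {1..n}" for J
  proof
    assume "S.w J \<noteq> 0"
    then show "\<nu> J \<in> dominant_weights n"
      unfolding \<nu>_dom by (intro S.singular_dominant[OF J _ _ tsp_supp_fun_span]) auto
  next
    assume d: "\<nu> J \<in> dominant_weights n"
    obtain v' where v': "hw_irred n (repF n (L (\<nu> J))) (supp_fun (rdim (L (\<nu> J)))) (\<lambda>i. l i + spin_wt J i) v'"
      using hwJ[OF d] by blast
    \<comment> \<open>The irreducible module of highest weight \<open>\<nu> J\<close> required here
      is the member \<open>L (\<nu> J)\<close> of the given family.\<close>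
    obtain u where "u \<in> S.V" "u \<noteq> 0" "sing n S.G u" "has_wt n S.G (\<lambda>i. l i + spin_wt J i) u"
      using singular_vector_exists[OF Frep so_rep_repF[OF Lrep[OF d]] v v' dom \<nu>_dom[THEN iffD1, OF d] J refl] by blast
    then show "S.w J \<noteq> 0" by (rule S.singular_component_nonzero[OF _ _ _ _ J])
  qed
  have A_w: "A = {J. J \<subseteq> {1..n} \<and> S.w J \<noteq> 0}" using w_iff by (auto simp: A_def)
  define C where "C J = gen n S.G (S.w J)" for J
  have C_V: "C J \<subseteq> S.V" if "J \<in> A" for J
    unfolding C_def by (rule gens_least[OF S.inv_V]) (use S.w(1)[of J] that in \<open>auto simp: A_def\<close>)
  have "\<exists>T. hom_on n (repF n (L (\<nu> J))) S.G (supp_fun (rdim (L (\<nu> J)))) T \<and>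
      bij_betw T (supp_fun (rdim (L (\<nu> J)))) (C J)" if J: "J \<in> A" for J
  proof -
    have d: "\<nu> J \<in> dominant_weights n" "J \<subseteq> {1..n}" "S.w J \<noteq> 0" using J w_iff[of J] by (auto simp: A_def)
    obtain v' where v': "hw_irred n (repF n (L (\<nu> J))) (supp_fun (rdim (L (\<nu> J)))) (\<lambda>i. l i + spin_wt J i) v'"
      using hwJ[OF d(1)] by blast
    show ?thesis
      using hw_irred_iso[OF so_rep_repF[OF Lrep[OF d(1)]] S.t.so_rep_axioms v' S.gen_irred[OF S.w(1,2)[OF d(2)] d(3) S.w(3)[OF d(2)]]]
      unfolding C_def by blast
  qed
  then obtain T where hom: "\<And>J. J \<in> A \<Longrightarrow> hom_on n (repF n (L (\<nu> J))) S.G (supp_fun (rdim (L (\<nu> J)))) (T J)"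
    and bij: "\<And>J. J \<in> A \<Longrightarrow> bij_betw (T J) (supp_fun (rdim (L (\<nu> J)))) (C J)" by metis
  define U where "U = untensor n ?d"
  have U: "clin U" unfolding U_def by (rule untensor_clin)
  \<comment> \<open>\<open>g J\<close> embeds \<open>L (\<nu> J)\<close> into the coordinates of the
    tensor product: onto the submodule generated by \<open>S.w J\<close>, then through
    \<open>untensor\<close>.\<close>
  define g where "g J f = U (T J f)" for J f
  have g_add: "g J (x + y) = g J x + g J y"
    if "J \<in> A" "x \<in> supp_fun (rdim (L (\<nu> J)))" "y \<in> supp_fun (rdim (L (\<nu> J)))" for J x y
  proof -
    have "T J (x + y) = T J x + T J y" using hom[OF that(1)] that(2,3) unfolding hom_on_def by blast
    then show ?thesis by (simp only: g_def clin_add[OF U])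
  qed
  have g_scale: "g J (c *c x) = c *c g J x" if "J \<in> A" "x \<in> supp_fun (rdim (L (\<nu> J)))" for J x c
  proof -
    have "T J (c *c x) = c *c T J x" using hom[OF that(1)] that(2) unfolding hom_on_def by blast
    then show ?thesis by (simp only: g_def clin_scale[OF U])
  qed
  have T_C: "T J f \<in> C J" if "J \<in> A" "f \<in> supp_fun (rdim (L (\<nu> J)))" for J f
    using bij_betw_apply[OF bij[OF that(1)] that(2)] .
  have g_image: "g J ` supp_fun (rdim (L (\<nu> J))) = U ` C J" if "J \<in> A" for J
    unfolding bij_betw_imp_surj_on[OF bij[OF that], symmetric] by (auto simp: g_def)
  have U_inj: "x = y" if "x \<in> S.V" "y \<in> S.V" "U x = U y" for x y
  proof -
    have "U (x - y) = 0" unfolding clin_diff[OF U] that(3) by simp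
    then have "x - y = 0" unfolding U_def by (rule untensor_inj[OF inv_subD(5)[OF S.inv_V that(1,2)]])
    then show ?thesis by (rule eq_iff_diff_eq_0[THEN iffD2])
  qed
  have g_inj: "inj_on (g J) (supp_fun (rdim (L (\<nu> J))))" if J: "J \<in> A" for J
  proof (rule inj_onI)
    fix x y assume xy: "x \<in> supp_fun (rdim (L (\<nu> J)))" "y \<in> supp_fun (rdim (L (\<nu> J)))" "g J x = g J y"
    have "T J x = T J y"
      by (rule U_inj) (use T_C[OF J] C_V[OF J] xy in \<open>auto simp: g_def\<close>)
    then show "x = y" by (rule inj_onD[OF bij_betw_imp_inj_on[OF bij[OF J]] _ xy(1,2)])
  qed
  have g_zero: "g J 0 = 0" if "J \<in> A" for J
    using g_scale[OF that cv.subspace_0[OF supp_fun_subspace], of 0] by (simp only: cv.scale_zero_left)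
  have g_act: "g J (mop (act (L (\<nu> J)) X) f) = mop (tensor_act n (L lam) X) (g J f)"
    if J: "J \<in> A" and X: "X \<in> orth n" and f: "f \<in> supp_fun (rdim (L (\<nu> J)))" for J X f
  proof (rule intertwines_orth[OF n1 _ Lrep[OF assms(3)] g_add[OF J] g_scale[OF J] _ X f])
    show "is_rep n (L (\<nu> J))" using Lrep J by (simp add: A_def)
    fix p q f assume pq: "p \<in> index_set n" "q \<in> index_set n" and f: "f \<in> supp_fun (rdim (L (\<nu> J)))"
    have TV: "T J f \<in> S.V" using T_C[OF J f] C_V[OF J] by blast
    have "T J (repF n (L (\<nu> J)) p q f) = S.G p q (T J f)" using hom[OF J] pq f unfolding hom_on_def by blast
    then show "g J (mop (act (L (\<nu> J)) (xmat n p q)) f) = mop (tensor_act n (L lam) (xmat n p q)) (g J f)"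
      unfolding g_def U_def tensor_act_untensor[OF Lrep[OF assms(3)] pq TV] by (simp only: repF_def)
  qed
  \<comment> \<open>One enumeration of the admissible \<open>J\<close> orders the weights, the
    summands and the blocks alike.\<close>
  obtain Js where Js: "set Js = A" "distinct Js" using finite_distinct_list[OF finA] by blast
  define xs where "xs = map (\<lambda>J. (L (\<nu> J), g J)) Js"
  define ys where "ys = map (\<lambda>(V, g). (rdim V, g)) xs"
  have ys: "ys = map (\<lambda>J. (rdim (L (\<nu> J)), g J)) Js" by (simp add: ys_def xs_def)
  define \<mu>s where "\<mu>s = map (spin_vec n) Js"
  define W where "W = direct_sum_rep (map (\<lambda>\<mu>. L (lam + \<mu>)) \<mu>s)"
  define M where "M = rdim W"
  define D where "D = ?d * 2 ^ n"
  have fst_xs: "map (\<lambda>\<mu>. L (lam + \<mu>)) \<mu>s = map fst xs" by (simp add: \<mu>s_def xs_def \<nu>_def o_def)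
  have M: "M = sum_list (map fst ys)" unfolding M_def W_def fst_xs by (simp add: direct_sum_rep_def ys_def o_def case_prod_beta)
  have act_W: "act W X = diag_block_mat (map (\<lambda>V. act V X) (map fst xs))" for X
    unfolding W_def fst_xs by (simp add: direct_sum_rep_def)
  have act_c: "act (L (\<nu> J)) X \<in> carrier_mat (rdim (L (\<nu> J))) (rdim (L (\<nu> J)))" if "J \<in> A" "X \<in> orth n" for J X
    using Lrep[of "\<nu> J"] that by (simp add: A_def is_rep_def)
  have W_c: "act W X \<in> carrier_mat M M" if X: "X \<in> orth n" for X
  proof -
    have "dim_row (act (L (\<nu> J)) X) = rdim (L (\<nu> J))" "dim_col (act (L (\<nu> J)) X) = rdim (L (\<nu> J))" if "J \<in> set Js" for J
      using act_c[OF _ X, of J] that Js(1) by auto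
    then have "sum_list (map dim_row (map (\<lambda>V. act V X) (map fst xs))) = M"
      "sum_list (map dim_col (map (\<lambda>V. act V X) (map fst xs))) = M"
      unfolding M ys xs_def by (auto simp: o_def intro!: arg_cong[where f = sum_list])
    then show ?thesis unfolding act_W by (intro carrier_matI) (simp_all only: dim_diag_block_mat)
  qed
  define \<Phi> where "\<Phi> = block_sum ys"
  have \<Phi>_clin: "clin \<Phi>" unfolding \<Phi>_def
  proof (rule block_sum_clin)
    fix d g' assume "(d, g') \<in> set ys"
    then obtain J where J: "J \<in> A" and e: "d = rdim (L (\<nu> J))" "g' = g J" using Js(1) by (auto simp: ys)
    show "(\<forall>x\<in>supp_fun d. \<forall>y\<in>supp_fun d. g' (x + y) = g' x + g' y) \<and> (\<forall>c. \<forall>x\<in>supp_fun d. g' (c *c x) = c *c g' x)"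
      unfolding e using g_add[OF J] g_scale[OF J] by blast
  qed
  \<comment> \<open>Block images are regrouped from list positions to subsets \<open>J\<close>,
    where independence of the submodules \<open>C J\<close> is available.\<close>
  have \<Phi>_sum: "\<exists>\<phi>. (\<forall>J\<in>A. \<phi> J \<in> C J) \<and> \<Phi> f = U (\<Sum>J\<in>A. \<phi> J) \<and> ((\<forall>J\<in>A. \<phi> J = 0) \<longrightarrow> f = 0)"
    if f: "f \<in> supp_fun M" for f
  proof -
    have "g' 0 = 0 \<and> inj_on g' (supp_fun d)" if "(d, g') \<in> set ys" for d g'
    proof -
      obtain J where J: "J \<in> A" and e: "d = rdim (L (\<nu> J))" "g' = g J" using Js(1) \<open>(d, g') \<in> set ys\<close> by (auto simp: ys)
      show ?thesis unfolding e using g_zero[OF J] g_inj[OF J] by blast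
    qed
    from block_sum_components[OF this f[unfolded M]] obtain h where h: "length h = length ys"
      "\<And>i. i < length ys \<Longrightarrow> h ! i \<in> snd (ys ! i) ` supp_fun (fst (ys ! i))"
      "block_sum ys f = sum_list h" "(\<forall>i<length ys. h ! i = 0) \<longrightarrow> f = 0" by blast
    have len: "length ys = length Js" by (simp add: ys)
    have "\<exists>c. c \<in> C (Js ! i) \<and> h ! i = U c" if i: "i < length Js" for i
    proof -
      have J: "Js ! i \<in> A" using i Js(1) nth_mem by blast
      have "h ! i \<in> g (Js ! i) ` supp_fun (rdim (L (\<nu> (Js ! i))))" using h(2)[of i] i by (simp add: ys)
      then show ?thesis unfolding g_image[OF J] by blast
    qed
    then obtain c where c: "\<And>i. i < length Js \<Longrightarrow> c i \<in> C (Js ! i)" "\<And>i. i < length Js \<Longrightarrow> h ! i = U (c i)" by metis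
    define \<phi> where "\<phi> J = c (inv_into {..<length Js} ((!) Js) J)" for J
    have nth: "bij_betw ((!) Js) {..<length Js} A" using bij_betw_nth[OF Js(2) refl Js(1)[symmetric]] .
    have \<phi>_nth: "\<phi> (Js ! i) = c i" if "i < length Js" for i
      unfolding \<phi>_def using inv_into_f_f[OF bij_betw_imp_inj_on[OF nth], of i] that by simp
    have mem: "\<exists>i<length Js. J = Js ! i" if "J \<in> A" for J using that unfolding Js(1)[symmetric] in_set_conv_nth by blast
    have "\<Phi> f = (\<Sum>i<length Js. h ! i)"
      unfolding \<Phi>_def h(3) sum_list_sum_nth h(1) len atLeast0LessThan ..
    also have "\<dots> = (\<Sum>i<length Js. U (\<phi> (Js ! i)))" by (intro sum.cong) (simp_all add: c \<phi>_nth)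
    also have "\<dots> = (\<Sum>J\<in>A. U (\<phi> J))" by (rule sum.reindex_bij_betw[OF nth])
    finally have "\<Phi> f = U (\<Sum>J\<in>A. \<phi> J)" unfolding clin_sum[OF U] .
    moreover have "\<forall>J\<in>A. \<phi> J \<in> C J" using mem c(1) \<phi>_nth by metis
    moreover have "f = 0" if z: "\<forall>J\<in>A. \<phi> J = 0"
    proof -
      have "h ! i = 0" if "i < length ys" for i
      proof -
        have i: "i < length Js" using that len by simp
        have "Js ! i \<in> A" using i Js(1) nth_mem by blast
        then have "c i = 0" using z \<phi>_nth[OF i] by metis
        then show ?thesis using c(2)[OF i] clin_zero[OF U] by metis
      qed
      then show ?thesis using h(4) by blast
    qed
    ultimately show ?thesis by blast
  qed
  have \<Phi>_mem: "\<Phi> f \<in> supp_fun D" if f: "f \<in> supp_fun M" for f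
    using \<Phi>_sum[OF f] untensor_mem unfolding U_def D_def by metis
  have \<Phi>_ker: "f = 0" if f: "f \<in> supp_fun M" and z: "\<Phi> f = 0" for f
  proof -
    obtain \<phi> where \<phi>: "\<And>J. J \<in> A \<Longrightarrow> \<phi> J \<in> C J" "\<Phi> f = U (\<Sum>J\<in>A. \<phi> J)" "(\<forall>J\<in>A. \<phi> J = 0) \<longrightarrow> f = 0"
      using \<Phi>_sum[OF f] by blast
    have "(\<Sum>J\<in>A. \<phi> J) \<in> S.V" by (rule inv_subD(7)[OF S.inv_V]) (use \<phi>(1) C_V in blast)
    then have 0: "(\<Sum>J\<in>A. \<phi> J) = 0" using \<phi>(2) z untensor_inj unfolding U_def by metis
    have "\<phi> J = 0" if "J \<in> A" for J
      by (rule S.components_independent[OF finA _ _ 0 that]) (use \<phi>(1) in \<open>auto simp: A_w C_def\<close>)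
    then show ?thesis using \<phi>(3) by blast
  qed
  have \<Phi>_surj: "\<exists>f\<in>supp_fun M. \<Phi> f = y" if y: "y \<in> supp_fun D" for y
  proof -
    obtain \<psi> where \<psi>: "\<psi> \<in> S.V" "U \<psi> = y" using untensor_surj[OF y[unfolded D_def]] unfolding U_def by blast
    obtain f where f: "\<And>J. f J \<in> C J" "\<psi> = (\<Sum>J\<in>A. f J)"
      using S.components_span[OF \<psi>(1)] unfolding A_w C_def by blast
    define h where "h = map (\<lambda>J. U (f J)) Js"
    have "h ! i \<in> snd (ys ! i) ` supp_fun (fst (ys ! i))" if "i < length ys" for i
    proof -
      have i: "i < length Js" using that by (simp add: ys)
      have J: "Js ! i \<in> A" using i Js(1) nth_mem by blast
      have "h ! i \<in> g (Js ! i) ` supp_fun (rdim (L (\<nu> (Js ! i))))"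
        unfolding g_image[OF J] using i f(1) by (simp add: h_def)
      then show ?thesis using i by (simp add: ys)
    qed
    then obtain f' where f': "f' \<in> supp_fun M" "\<Phi> f' = sum_list h"
      using block_sum_surj[of h ys] unfolding M \<Phi>_def by (auto simp: h_def ys)
    have "sum_list h = (\<Sum>J\<in>A. U (f J))"
      unfolding h_def Js(1)[symmetric] by (rule sum_list_distinct_conv_sum_set[OF Js(2)])
    then have "\<Phi> f' = y" unfolding f'(2) \<psi>(2)[symmetric] f(2) clin_sum[OF U] .
    then show ?thesis using f'(1) by blast
  qed
  have \<Phi>_act: "\<Phi> (mop (act W X) f) = mop (tensor_act n (L lam) X) (\<Phi> f)" if X: "X \<in> orth n" for X f
    unfolding \<Phi>_def ys_def act_W
  proof (rule block_sum_hom)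
    fix V g' assume "(V, g') \<in> set xs"
    then obtain J where J: "J \<in> A" and e: "V = L (\<nu> J)" "g' = g J" using Js(1) by (auto simp: xs_def)
    show "act V X \<in> carrier_mat (rdim V) (rdim V) \<and>
      (\<forall>f\<in>supp_fun (rdim V). g' (mop (act V X) f) = mop (tensor_act n (L lam) X) (g' f))"
      unfolding e using act_c[OF J X] g_act[OF J X] by blast
  qed
  have t_c: "tensor_act n (L lam) X \<in> carrier_mat D D" if "X \<in> orth n" for X
    unfolding D_def by (rule tensor_act_carrier) (use Lrep[OF assms(3)] that in \<open>simp add: is_rep_def\<close>)
  have rt: "rdim (tensor_rep (L lam) (spinor n)) = D" by (simp add: D_def tensor_rep_def spinor_def)
  obtain P where MD: "M = D" and P: "P \<in> carrier_mat M D" "invertible_mat P"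
    "\<And>A B. A \<in> carrier_mat D D \<Longrightarrow> B \<in> carrier_mat M M \<Longrightarrow>
      \<forall>f\<in>supp_fun M. \<Phi> (mop B f) = mop A (\<Phi> f) \<Longrightarrow> P * A = B * P"
    using bijective_map_matrix[OF \<Phi>_clin \<Phi>_mem \<Phi>_ker \<Phi>_surj] by metis
  have "rep_iso n (tensor_rep (L lam) (spinor n)) W"
    unfolding rep_iso_def rt M_def[symmetric]
  proof (intro conjI bexI[OF _ P(1)] ballI)
    fix X assume X: "X \<in> orth n"
    show "P * act (tensor_rep (L lam) (spinor n)) X = act W X * P"
      unfolding tensor_act_def[symmetric] by (rule P(3)[OF t_c[OF X] W_c[OF X]]) (use \<Phi>_act[OF X] in blast)
  qed (use MD P(2) in simp_all)
  moreover have "distinct \<mu>s"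
    unfolding \<mu>s_def distinct_map using Js inj_on_subset[OF spin_vec_inj, of A n] by (auto simp: A_def)
  moreover have "set \<mu>s = {\<mu> \<in> weights n (spinor n). lam + \<mu> \<in> dominant_weights n}"
    unfolding \<mu>s_def set_map Js(1) weights_spinor A_def \<nu>_def by auto
  ultimately show ?thesis unfolding W_def by blast
qed


end
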